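(* Let $n\ge 2$, $s\in(0,1)$, and let $p\in\left(1,\frac{n+2}{n-2}\right)$ if $n>2$, $p\in(1,+\infty)$ if $n=2$. Let $u\in H^1(\mathbb{R}^n)$ be a weak solution of $-\Delta u+(-\Delta)^su+u=u^p$ in $\mathbb{R}^n$. Then $u\in C^{0,\mu}(\mathbb{R}^n)$ for some $\mu\in(0,1)$ and $$\|u\|_{C^{0,\mu}(\mathbb{R}^n)}\le C,$$ for some $C>0$ depending only on $n$, $s$, $p$ and $\|u\|_{H^1(\mathbb{R}^n)}$.
   Context: Weak solution: $u\in H^1(\mathbb{R}^n)$ is a weak solution of the equation $-\Delta u+(-\Delta)^su+u=u^p$ in $\mathbb{R}^n$ if for all $v\in H^1(\mathbb{R}^n)$ $$\int_{\mathbb{R}^n}\big(u(x)v(x)+\nabla u(x)\cdot\nabla v(x)\big)\,dx+\iint_{\mathbb{R}^{2n}}\frac{(u(x)-u(y))(v(x)-v(y))}{|x-y|^{n+2s}}\,dx\,dy=\int_{\mathbb{R}^n}|u(x)|^{p-1}u(x)v(x)\,dx.$$ $\|u\|_{H^1(\mathbb{R}^n)}=\|u\|_{L^2(\mathbb{R}^n)}+\|\nabla u\|_{L^2(\mathbb{R}^n)}$. The space $C^{0,\mu}(\mathbb{R}^n)$ has its usual norm (sup norm plus Hölder seminorm); membership is understood up to a.e. modification. *)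

theory Defs
  imports "HOL-Analysis.Analysis"
begin

text \<open>
  Elements of $L^2$ and $H^1$ are represented by arbitrary representatives of their
  almost-everywhere classes with respect to the Lebesgue measure.  The Hoelder notions, on the
  other hand, concern an individual function.
\<close>

definition partial :: "'n \<Rightarrow> (real ^ 'n \<Rightarrow> real) \<Rightarrow> real ^ 'n \<Rightarrow> real" where
  "partial i f x = frechet_derivative f (at x) (axis i 1)"

primrec C_k :: "nat \<Rightarrow> (real ^ 'n \<Rightarrow> real) \<Rightarrow> bool" where
  "C_k 0 f \<longleftrightarrow> continuous_on UNIV f"
| "C_k (Suc k) f \<longleftrightarrow> (\<forall>x. f differentiable at x) \<and> (\<forall>i. C_k k (partial i f))"

definition test_function :: "(real ^ 'n \<Rightarrow> real) \<Rightarrow> bool" where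
  "test_function \<phi> \<longleftrightarrow> (\<forall>k. C_k k \<phi>) \<and> compact (closure {x. \<phi> x \<noteq> 0})"

definition L2 :: "('a::euclidean_space \<Rightarrow> 'b::euclidean_space) set" where
  "L2 = {f \<in> borel_measurable lebesgue. integrable lebesgue (\<lambda>x. (norm (f x))\<^sup>2)}"

definition L2_norm :: "('a::euclidean_space \<Rightarrow> 'b::euclidean_space) \<Rightarrow> real" where
  "L2_norm f = sqrt (\<integral>x. (norm (f x))\<^sup>2 \<partial>lebesgue)"

definition has_weak_gradient :: "(real ^ 'n \<Rightarrow> real) \<Rightarrow> (real ^ 'n \<Rightarrow> real ^ 'n) \<Rightarrow> bool" where
  "has_weak_gradient u g \<longleftrightarrow>
     (\<forall>K. compact K \<longrightarrow> u absolutely_integrable_on K \<and> g absolutely_integrable_on K) \<and>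
     (\<forall>\<phi> i. test_function \<phi> \<longrightarrow>
        (\<integral>x. u x * partial i \<phi> x \<partial>lebesgue) = - (\<integral>x. g x $ i * \<phi> x \<partial>lebesgue))"

text \<open>The weak gradient is unique up to a null set, so the choice of \<open>g\<close> is immaterial.\<close>

definition weak_gradient :: "(real ^ 'n \<Rightarrow> real) \<Rightarrow> real ^ 'n \<Rightarrow> real ^ 'n" where
  "weak_gradient u = (SOME g. has_weak_gradient u g)"

definition H1 :: "(real ^ 'n \<Rightarrow> real) set" where
  "H1 = {u \<in> L2. \<exists>g. has_weak_gradient u g \<and> g \<in> L2}"

definition H1_norm :: "(real ^ 'n \<Rightarrow> real) \<Rightarrow> real" where
  "H1_norm u = L2_norm u + L2_norm (weak_gradient u)"

text \<open>
  Bochner integrals of non-integrable functions are \<open>0\<close> by convention.  This is harmless for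
  $u, v \in H^1$, $0 < s < 1$ and $p$ in the subcritical range: there all three integrands are
  integrable, since $H^1$ embeds into $H^s$ and into $L^{p+1}$.  The integrand of the
  double integral takes the value \<open>0\<close> on the (null) diagonal.
\<close>

definition weak_solution :: "real \<Rightarrow> real \<Rightarrow> (real ^ 'n \<Rightarrow> real) \<Rightarrow> bool" where
  "weak_solution s p u \<longleftrightarrow> u \<in> H1 \<and>
     (\<forall>v\<in>H1.
        (\<integral>x. u x * v x + weak_gradient u x \<bullet> weak_gradient v x \<partial>lebesgue)
        + (\<integral>(x, y). (u x - u y) * (v x - v y) / norm (x - y) powr (real CARD('n) + 2 * s)
              \<partial>(lebesgue :: ((real ^ 'n) \<times> (real ^ 'n)) measure))
        = (\<integral>x. \<bar>u x\<bar> powr (p - 1) * u x * v x \<partial>lebesgue))"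

definition holder_quotients :: "real \<Rightarrow> (real ^ 'n \<Rightarrow> real) \<Rightarrow> real set" where
  "holder_quotients \<mu> w = {\<bar>w x - w y\<bar> / norm (x - y) powr \<mu> | x y. x \<noteq> y}"

definition holder_space :: "real \<Rightarrow> (real ^ 'n \<Rightarrow> real) set" where
  "holder_space \<mu> = {w. bdd_above (range (\<lambda>x. \<bar>w x\<bar>)) \<and> bdd_above (holder_quotients \<mu> w)}"

definition holder_norm :: "real \<Rightarrow> (real ^ 'n \<Rightarrow> real) \<Rightarrow> real" where
  "holder_norm \<mu> w = (SUP x. \<bar>w x\<bar>) + Sup (holder_quotients \<mu> w)"

end

theory Submission
  imports Defs
begin

text \<open>
  The equation is tested only against dyadic rescalings of one test function.  Let \<open>\<rho>\<close> be a radial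
  mollifier and \<open>\<gamma>\<close> a radial test function with \<open>lap \<gamma> x = \<rho> x - 2\<^sup>n \<rho> (2 x)\<close>.  Rescaling \<open>\<gamma>\<close> to
  \<open>\<gamma>\<^sub>k\<close>, the mollifications \<open>u\<^sub>k\<close> of a solution \<open>u\<close> at scale \<open>2\<^sup>-\<^sup>k\<close> satisfy
  \<open>u\<^sub>k\<^sub>+\<^sub>1 - u\<^sub>k = \<integral> \<nabla>u \<bullet> \<nabla>\<gamma>\<^sub>k = \<integral> (\<bar>u\<bar>\<^sup>p\<^sup>-\<^sup>1 u - u) \<gamma>\<^sub>k - N(u, \<gamma>\<^sub>k)\<close>, where \<open>N\<close> is the nonlocal
  form.  Moving the difference quotient in \<open>N\<close> onto \<open>\<gamma>\<^sub>k\<close> bounds it by the integral of \<open>\<bar>u\<bar>\<close> against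
  the second differences of \<open>\<gamma>\<^sub>k\<close>.  Hence \<open>u\<^sub>k\<^sub>+\<^sub>1 - u\<^sub>k\<close> is dominated by averages at scale \<open>2\<^sup>-\<^sup>k\<close>: of
  \<open>\<bar>\<nabla>u\<bar>\<close> with a factor \<open>2\<^sup>-\<^sup>k\<close>, or of \<open>\<bar>u\<bar>\<^sup>p\<close> and \<open>\<bar>u\<bar>\<close> with the factors \<open>2\<^sup>-\<^sup>2\<^sup>k\<close> and \<open>2 powr (- (2 - 2 s) k)\<close>.

  A factor \<open>2 powr (- \<alpha> k)\<close> takes $L^a$ to $L^Q$ as soon as \<open>n (1 / a - 1 / Q) < \<alpha>\<close>.  The gradient
  bound thus gives the subcritical Sobolev embedding, and since \<open>p\<close> is subcritical, finitely many uses
  of the second bound make \<open>u\<^sub>k\<^sub>+\<^sub>1 - u\<^sub>k\<close> decay geometrically in the supremum norm.  As \<open>u\<^sub>k\<close> is Lipschitz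
  with constant of order \<open>2\<^sup>k\<close>, the uniform limit is Hoelder continuous.
\<close>

text \<open>The first obstacle is that \<gamma> must have compact support. The Newtonian potential
  of a general function of mean zero decays but does not vanish, so it is no test function. For
  radial data Newton's theorem removes the tail: outside both supports the potential sees only the
  total mass of the right-hand side, which is 0. Hence both functions are built from profiles in
  \<open>x \<bullet> x\<close>.

  The nonlocal operator has order 2 s < 2: it costs 2^(2 s k) against the factor 4^(-k) carried by
  the rescaled \<gamma>, so it is subordinate to the Laplacian. It does spread supports, so averages
  are taken against a bounded integrable envelope.

  The gradient step comes first because the equation improves an exponent q only if n (p - 1) / q <
  2. For n > 2 the gradient reaches every q below 2 n / (n - 2), and such a q satisfies the
  condition exactly when p < (n + 2) / (n - 2).

  The dependence of the final constant is settled by the order of choice: kernels, envelope,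
  exponents and constants are all fixed before a solution is named, and of the solution only its
  norm M enters.\<close>

section \<open>Smooth functions of one real variable\<close>

text \<open>The derivative is quantified existentially instead of being iterated through
  \<open>deriv\<close>, so closure properties are proved by exhibiting a derivative. The last
  derivative need not be continuous.\<close>

primrec deriv_k :: "nat \<Rightarrow> (real \<Rightarrow> real) \<Rightarrow> bool" where
  "deriv_k 0 g \<longleftrightarrow> True"
| "deriv_k (Suc k) g \<longleftrightarrow> (\<exists>g'. (\<forall>x. DERIV g x :> g' x) \<and> deriv_k k g')"

lemma deriv_k_Suc_D: "deriv_k (Suc k) g \<Longrightarrow> deriv_k k g"
  by (induction k arbitrary: g) (simp, metis deriv_k.simps(2))

lemma deriv_k_SucI:
  "(\<And>x. DERIV g x :> g' x) \<Longrightarrow> deriv_k k g' \<Longrightarrow> deriv_k (Suc k) g"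
  by auto

lemma deriv_k_const: "deriv_k k (\<lambda>x. c)"
  by (induction k arbitrary: c) (auto intro!: exI[of _ "\<lambda>x. 0"])

lemma deriv_k_add: "deriv_k k f \<Longrightarrow> deriv_k k g \<Longrightarrow> deriv_k k (\<lambda>x. f x + g x)"
proof (induction k arbitrary: f g)
  case (Suc k)
  then obtain f' g' where "\<And>x. DERIV f x :> f' x" "deriv_k k f'"
    "\<And>x. DERIV g x :> g' x" "deriv_k k g'" by auto
  then show ?case by (intro deriv_k_SucI[of _ "\<lambda>x. f' x + g' x"] Suc.IH) (auto intro: DERIV_add)
qed simp

lemma deriv_k_mult: "deriv_k k f \<Longrightarrow> deriv_k k g \<Longrightarrow> deriv_k k (\<lambda>x. f x * g x)"
proof (induction k arbitrary: f g)
  case (Suc k)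
  then obtain f' g' where *: "\<And>x. DERIV f x :> f' x" "deriv_k k f'"
    "\<And>x. DERIV g x :> g' x" "deriv_k k g'" by auto
  have "deriv_k k f" "deriv_k k g" using Suc.prems deriv_k_Suc_D by auto
  with * show ?case
    by (intro deriv_k_SucI[of _ "\<lambda>x. f' x * g x + g' x * f x"] deriv_k_add Suc.IH DERIV_mult) auto
qed simp

lemma deriv_k_cmult: "deriv_k k f \<Longrightarrow> deriv_k k (\<lambda>x. c * f x)"
  using deriv_k_mult[OF deriv_k_const] .

lemma deriv_k_affine: "deriv_k k f \<Longrightarrow> deriv_k k (\<lambda>x. f (c * x + d))"
proof (induction k arbitrary: f)
  case (Suc k)
  then obtain f' where *: "\<And>x. DERIV f x :> f' x" "deriv_k k f'" by auto
  have "((\<lambda>x. f (c * x + d)) has_real_derivative c * f' (c * x + d)) (at x)" for x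
    by (rule DERIV_cong[OF DERIV_chain2[OF *(1)]]) (auto intro!: derivative_eq_intros)
  then show ?case
    by (intro deriv_k_SucI[of _ "\<lambda>x. c * f' (c * x + d)"] deriv_k_cmult Suc.IH *(2))
qed simp

lemma DERIV_zero_left:
  assumes "\<And>t. t < a \<Longrightarrow> g t = (0::real)" "t < a" "DERIV g t :> d"
  shows "d = 0"
proof -
  have "((\<lambda>x. 0) has_real_derivative d) (at t)"
    by (rule has_field_derivative_transform_within_open[of g _ _ "{..<a}"]) (use assms in auto)
  then show ?thesis using DERIV_const DERIV_unique by blast
qed

text \<open>The power is singular only at 0, and \<open>g\<close> vanishes on a neighbourhood of 0
  and on the whole negative axis. The derivative is a sum of two products of the same kind, one with
  exponent \<open>r - 1\<close>, so the induction runs over all \<open>r\<close> at once.\<close>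

lemma deriv_k_powr_mult:
  assumes "deriv_k k g" "0 < a" "\<And>t. t < a \<Longrightarrow> g t = 0"
  shows "deriv_k k (\<lambda>t. t powr r * g t)"
  using assms(1,3)
proof (induction k arbitrary: g r)
  case (Suc k)
  then obtain g' where *: "\<And>x. DERIV g x :> g' x" "deriv_k k g'" by auto
  have g'0: "g' t = 0" if "t < a" for t
    using DERIV_zero_left[OF Suc.prems(2) that *(1)] .
  have "((\<lambda>t. t powr r * g t) has_real_derivative r * (x powr (r - 1) * g x) + x powr r * g' x) (at x)" for x
  proof (cases "x > 0")
    case True
    then show ?thesis
      by (auto intro!: derivative_eq_intros *(1) simp: algebra_simps)
  next
    case False
    then have x: "x < a" using assms(2) by auto
    have "((\<lambda>t. t powr r * g t) has_real_derivative 0) (at x)"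
      by (rule has_field_derivative_transform_within_open[of "\<lambda>x. 0" _ _ "{..<a}"])
        (use x Suc.prems in auto)
    with x g'0 Suc.prems(2) show ?thesis by simp
  qed
  then show ?case
    using * g'0 Suc.prems deriv_k_Suc_D
    by (intro deriv_k_SucI[of _ "\<lambda>x. r * (x powr (r - 1) * g x) + x powr r * g' x"]
        deriv_k_add deriv_k_cmult Suc.IH) auto
qed simp

text \<open>The case \<open>j = 0\<close> is the classical smooth function that is flat at 0. The
  extra powers of \<open>1 / t\<close> close the family under differentiation up to linear
  combinations.\<close>

definition flat :: "nat \<Rightarrow> real \<Rightarrow> real" where
  "flat j t = (if t > 0 then (1 / t) ^ j * exp (- (1 / t)) else 0)"

lemma flat_tendsto_0: "(flat j \<longlongrightarrow> 0) (at 0)"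
proof -
  have "((\<lambda>y. y ^ j / exp y) \<longlongrightarrow> (0::real)) at_top"
    by (rule tendsto_power_div_exp_0)
  from filterlim_compose[OF this filterlim_inverse_at_top_right]
  have *: "((\<lambda>t::real. inverse t ^ j / exp (inverse t)) \<longlongrightarrow> 0) (at_right 0)" .
  have "(flat j \<longlongrightarrow> 0) (at_right 0)"
    by (rule Lim_transform_eventually[OF *])
      (auto simp: eventually_at_right_less flat_def exp_minus field_simps
        intro!: eventually_mono[OF eventually_at_right_less])
  moreover have "(flat j \<longlongrightarrow> 0) (at_left 0)"
    by (rule Lim_transform_eventually[OF tendsto_const])
      (auto simp: flat_def eventually_at_left_field intro!: exI[of _ "-1"])
  ultimately show ?thesis using filterlim_split_at by blast
qed

lemma flat_deriv: "(flat j has_real_derivative - real j * flat (Suc j) t + flat (j + 2) t) (at t)"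
proof -
  consider "t > 0" | "t < 0" | "t = 0" by linarith
  then show ?thesis
  proof cases
    case 1
    have "((\<lambda>t. (1 / t) ^ j * exp (- (1 / t))) has_real_derivative
        - real j * flat (Suc j) t + flat (j + 2) t) (at t)"
      using 1 by (cases j) (auto intro!: derivative_eq_intros simp: flat_def field_simps power2_eq_square,
          metis One_nat_def power_eq_if)
    then show ?thesis
      by (rule has_field_derivative_transform_within_open[of _ _ _ "{0<..}"])
        (use 1 in \<open>auto simp: flat_def\<close>)
  next
    case 2
    have "((\<lambda>t. 0) has_real_derivative - real j * flat (Suc j) t + flat (j + 2) t) (at t)"
      using 2 by (simp add: flat_def)
    then show ?thesis
      by (rule has_field_derivative_transform_within_open[of _ _ _ "{..<0}"])
        (use 2 in \<open>auto simp: flat_def\<close>)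
  next
    case 3
    \<comment> \<open>At 0 the difference quotient of one member of the family is the next member,
      whose limit is already known.\<close>
    have "(\<lambda>h. (flat j (0 + h) - flat j 0) / h) = flat (Suc j)"
      by (auto simp: flat_def)
    then show ?thesis
      using flat_tendsto_0[of "Suc j"] 3 by (simp add: DERIV_def flat_def[of _ 0])
  qed
qed

lemma deriv_k_flat: "deriv_k k (flat j)"
proof (induction k arbitrary: j)
  case (Suc k)
  show ?case
    by (rule deriv_k_SucI[OF flat_deriv deriv_k_add[OF deriv_k_cmult[OF Suc] Suc]])
qed simp

lemma ex_antiderivative:
  assumes h: "continuous_on UNIV h" "0 < a" "\<And>t. t < a \<Longrightarrow> h t = (0::real)"
  shows "\<exists>H. (\<forall>t. DERIV H t :> h t) \<and> (\<forall>t<a. H t = 0)"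
proof (intro exI conjI allI impI)
  \<comment> \<open>For negative \<open>t\<close> the interval is empty and the integral is 0, which
    is the right value because \<open>h\<close> vanishes below \<open>a\<close>.\<close>
  let ?H = "\<lambda>t. integral {0..t} h"
  show 0: "?H t = 0" if "t < a" for t
  proof -
    have "integral {0..t} h = integral {0..t} (\<lambda>x. 0)"
      by (rule integral_cong) (use that h in auto)
    then show ?thesis by simp
  qed
  show "DERIV ?H t :> h t" for t
  proof (cases "t > 0")
    case True
    have "(?H has_real_derivative h t) (at t within {0..t+1})"
      by (rule integral_has_real_derivative) (use True continuous_on_subset[OF h(1)] in auto)
    moreover have "t \<in> interior {0..t+1}" using True by auto
    ultimately show ?thesis using at_within_interior by metis
  next
    case False
    then have t: "t < a" using h by auto
    have "((\<lambda>x. 0) has_real_derivative h t) (at t)" using h(3)[OF t] by simp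
    then show ?thesis
      by (rule has_field_derivative_transform_within_open[of _ _ _ "{..<a}"]) (use t 0 in auto)
  qed
qed

text \<open>
  The Laplacian of \<open>G (x \<bullet> x)\<close> is \<open>4 t G'' + 2 n G' = 4 t powr (1 - n / 2) * (t powr (n / 2) G')'\<close> at
  \<open>t = x \<bullet> x\<close>, so the equation for \<open>G'\<close> is solved by one integration of \<open>t powr (n / 2 - 1) * b t\<close>.
\<close>

lemma smooth_radial_profile:
  fixes n :: real
  shows "\<exists>b G G'. (\<forall>k. deriv_k k b) \<and> (\<forall>k. deriv_k k G) \<and> (\<forall>t. DERIV G t :> G' t) \<and>
    (\<forall>t. 0 \<le> b t) \<and> (\<forall>t. 1 < t \<and> t < 2 \<longrightarrow> 0 < b t) \<and> (\<forall>t. t \<le> 1 \<or> 2 \<le> t \<longrightarrow> b t = 0) \<and>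
    (\<forall>t\<ge>2. G t = 0) \<and> (\<exists>G''. \<forall>t. DERIV G' t :> G'' t \<and>
        4 * t * G'' t + 2 * n * G' t = b t - 2 powr n * b (4 * t))"
proof -
  \<comment> \<open>The support lies in [1, 2], away from 0, so that multiplication by powers of
    \<open>t\<close> stays smooth.\<close>
  define b where "b = (\<lambda>t. flat 0 (1 * t + (-1)) * flat 0 ((-1) * t + 2))"
  have b: "deriv_k k b" for k
    unfolding b_def by (intro deriv_k_mult deriv_k_affine deriv_k_flat)
  have b0: "b t = 0" if "t \<le> 1 \<or> 2 \<le> t" for t using that by (auto simp: b_def flat_def)
  have b1: "0 \<le> b t" "1 < t \<Longrightarrow> t < 2 \<Longrightarrow> 0 < b t" for t by (auto simp: b_def flat_def)
  define h where "h = (\<lambda>t. t powr (n / 2 - 1) * b t)"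
  have h: "deriv_k k h" for k
    unfolding h_def using b b0 by (intro deriv_k_powr_mult[of _ _ 1]) auto
  have cont: "continuous_on UNIV f" if "\<And>k. deriv_k k f" for f
    using that[of "Suc 0"] by (auto simp: continuous_on_eq_continuous_at intro: DERIV_isCont)
  obtain S where S: "\<And>t. DERIV S t :> h t" "\<And>t. t < 1 \<Longrightarrow> S t = 0"
    using ex_antiderivative[of h 1] cont[OF h] b0 h_def by auto
  have Sk: "deriv_k k S" for k using S h deriv_k_SucI deriv_k_Suc_D by blast
  have isconst: "f t = f 2" if "\<And>x. DERIV f x :> f' x" "\<And>x. 2 < x \<Longrightarrow> f' x = 0" "t \<ge> 2"
    for f f' :: "real \<Rightarrow> real" and t
  proof (cases "t = 2")
    case False
    have "\<And>x. 2 < x \<Longrightarrow> DERIV f x :> 0" using that by metis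
    moreover have "continuous_on {2..t} f"
      using that(1) DERIV_continuous_on has_field_derivative_at_within by blast
    ultimately show ?thesis using that(3) False by (intro DERIV_isconst_end) auto
  qed simp
  have S2: "S t = S 2" if "t \<ge> 2" for t
    by (rule isconst[OF S(1)]) (use that b0 in \<open>auto simp: h_def\<close>)
  \<comment> \<open>Up to a constant, \<open>S t\<close> is the mass of the radial function with
    profile \<open>b\<close> in the ball of squared radius \<open>t\<close>, and
    \<open>S (4 * t)\<close> is that of its dilation. The total masses agree, hence \<open>T\<close>
    vanishes for large \<open>t\<close>; this is what makes \<gamma> compactly supported.\<close>
  define T where "T = (\<lambda>t. S (4 * t + 0) + (-1) * S t)"
  have Tk: "deriv_k k T" for k
    unfolding T_def by (intro deriv_k_add deriv_k_cmult deriv_k_affine Sk)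
  have T0: "T t = 0" if "t < 1/4 \<or> t \<ge> 2" for t
    using that S S2[of t] S2[of "4*t"] by (auto simp: T_def)
  have dT: "(T has_real_derivative 4 * h (4 * t) - h t) (at t)" for t
    unfolding T_def by (rule derivative_eq_intros DERIV_chain2[OF S(1)] S(1) refl | simp)+
  \<comment> \<open>Divergence theorem: the radial derivative is the enclosed mass over the area
    r^(n - 1). Dividing also by the inner derivative 2 r of the squared radius leaves the power -n/2
    of \<open>t\<close>.\<close>
  define G' where "G' = (\<lambda>t. (-1/4) * (t powr (-n/2) * T t))"
  have G'k: "deriv_k k G'" for k
    unfolding G'_def using Tk T0 by (intro deriv_k_cmult deriv_k_powr_mult[of _ _ "1/4"]) auto
  obtain G0 where G0: "\<And>t. DERIV G0 t :> G' t" "\<And>t. t < 1/4 \<Longrightarrow> G0 t = 0"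
    using ex_antiderivative[of G' "1/4"] cont[OF G'k] T0 G'_def by auto
  \<comment> \<open>\<open>G0\<close> vanishes near the origin and is constant from 2 on;
    subtracting that constant moves the vanishing to the outside.\<close>
  define G where "G = (\<lambda>t. G0 t + (- G0 2))"
  have dG: "DERIV G t :> G' t" for t
    unfolding G_def by (auto intro!: derivative_eq_intros G0)
  have Gk: "deriv_k k G" for k using dG G'k deriv_k_SucI deriv_k_Suc_D by blast
  have G2: "G t = 0" if "t \<ge> 2" for t
  proof -
    have "G0 t = G0 2"
      by (rule isconst[OF G0(1)]) (use that T0 in \<open>auto simp: G'_def\<close>)
    then show ?thesis by (simp add: G_def)
  qed
  obtain G'' where G'': "\<And>t. DERIV G' t :> G'' t"
    using G'k[of "Suc 0"] by auto
  have "4 * t * G'' t + 2 * n * G' t = b t - 2 powr n * b (4 * t)" for t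
  proof (cases "t > 0")
    case True
    have "(G' has_real_derivative (-1/4) * ((-n/2) * t powr (-n/2-1) * T t + t powr (-n/2) * (4 * h (4 * t) - h t))) (at t)"
      unfolding G'_def using True by (auto intro!: derivative_eq_intros dT simp: field_simps)
    then have e: "G'' t = (-1/4) * ((-n/2) * t powr (-n/2-1) * T t + t powr (-n/2) * (4 * h (4 * t) - h t))"
      using G'' DERIV_unique by blast
    have p1: "t powr (-n/2-1) * t = t powr (-n/2)" using True by (simp add: powr_diff)
    have p2: "t * t powr (-n/2) * t powr (n/2 - 1) = 1" 
      using True powr_add[of t 1 "- n/2"] powr_add[of t "1 + - n/2" "n/2 - 1"] by simp
    have p3: "(4 * t) powr (n/2 - 1) * 4 = 2 powr n * t powr (n/2-1)"
    proof -
      have "(4::real) powr (n/2) = (2 powr 2) powr (n/2)" by simp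
      also have "\<dots> = 2 powr n" by (subst powr_powr) simp
      finally show ?thesis using True by (simp add: powr_mult powr_diff field_simps)
    qed
    have "4 * t * G'' t + 2 * n * G' t = - (t * t powr (-n/2) * (4 * h (4*t) - h t))
       + (n/2) * (t powr (-n/2-1) * t) * T t - (n/2) * t powr (-n/2) * T t"
      unfolding e G'_def by (simp add: algebra_simps)
    also have "\<dots> = - (t * t powr (-n/2) * (4 * h (4*t) - h t))" unfolding p1 by simp
    also have "4 * h (4*t) - h t = t powr (n/2-1) * (2 powr n * b (4 * t) - b t)"
      unfolding h_def using p3 by (simp add: algebra_simps)
    also have "- (t * t powr (-n/2) * (t powr (n/2-1) * (2 powr n * b (4 * t) - b t))) =
        - (t * t powr (-n/2) * t powr (n/2-1)) * (2 powr n * b (4 * t) - b t)" by simp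
    also have "\<dots> = b t - 2 powr n * b (4 * t)" unfolding p2 by simp
    finally show ?thesis .
  next
    case False
    have "G'' t = 0"
      by (rule DERIV_zero_left[of "1/4" G' t]) (use G'' T0 False in \<open>auto simp: G'_def\<close>)
    then show ?thesis using False b0[of t] b0[of "4*t"] T0[of t] by (simp add: G'_def)
  qed
  then show ?thesis
    by (intro exI[of _ b] exI[of _ G] exI[of _ G'] conjI allI impI exI[of _ G'']
        b Gk dG b1(1) b0 G2 G'') (auto intro: b1(2))
qed

section \<open>Test functions\<close>

lemma partial_eqI: "(f has_derivative f') (at x) \<Longrightarrow> partial i f x = f' (axis i 1)"
  unfolding partial_def using frechet_derivative_at by metis

lemma C_k_continuous: "C_k k f \<Longrightarrow> continuous_on UNIV f"
  by (cases k) (auto simp: continuous_on_eq_continuous_at differentiable_imp_continuous_within)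

lemma C_k_Suc_D: "C_k (Suc k) f \<Longrightarrow> C_k k f"
proof (induction k arbitrary: f)
  case 0
  then have "continuous_on UNIV f" by (rule C_k_continuous)
  then show ?case by simp
qed auto

lemma C_k_SucI:
  assumes "\<And>x. (f has_derivative f' x) (at x)" "\<And>i. C_k k (\<lambda>x. f' x (axis i 1))"
  shows "C_k (Suc k) f"
proof -
  have "partial i f = (\<lambda>x. f' x (axis i 1))" for i
    using partial_eqI[OF assms(1)] by blast
  with assms show ?thesis by (auto simp: differentiable_def)
qed

lemma C_k_const: "C_k k (\<lambda>x. c)"
  by (induction k arbitrary: c) (auto intro!: C_k_SucI[of _ "\<lambda>x h. 0"] simp del: C_k.simps(2))

lemma has_derivative_grad:
  assumes "C_k (Suc k) f"
  shows "(f has_derivative (\<lambda>h. (\<chi> i. partial i f x) \<bullet> h)) (at x)"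
proof -
  have d: "(f has_derivative frechet_derivative f (at x)) (at x)"
    using assms frechet_derivative_works by auto
  then have l: "linear (frechet_derivative f (at x))" by (rule has_derivative_linear)
  have "frechet_derivative f (at x) h = (\<chi> i. partial i f x) \<bullet> h" for h
  proof -
    have "frechet_derivative f (at x) h = frechet_derivative f (at x) (\<Sum>i\<in>UNIV. h $ i *\<^sub>R axis i 1)"
      using basis_expansion[of h] by (simp add: scalar_mult_eq_scaleR)
    also have "\<dots> = (\<Sum>i\<in>UNIV. h $ i * partial i f x)"
      by (simp add: linear_sum[OF l] linear_cmul[OF l] partial_def)
    finally show ?thesis by (simp add: inner_vec_def mult.commute)
  qed
  then have "frechet_derivative f (at x) = (\<lambda>h. (\<chi> i. partial i f x) \<bullet> h)" by blast
  with d show ?thesis by simp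
qed

lemma C_k_add: "C_k k f \<Longrightarrow> C_k k g \<Longrightarrow> C_k k (\<lambda>x. f x + g x)"
proof (induction k arbitrary: f g)
  case 0 then show ?case by (auto intro: continuous_intros)
next
  case (Suc k)
  show ?case
    using Suc.prems
    by (intro C_k_SucI[OF has_derivative_add[OF has_derivative_grad[OF Suc.prems(1)] has_derivative_grad[OF Suc.prems(2)]]])
       (auto simp: inner_axis intro!: Suc.IH)
qed

lemma C_k_mult: "C_k k f \<Longrightarrow> C_k k g \<Longrightarrow> C_k k (\<lambda>x. f x * g x)"
proof (induction k arbitrary: f g)
  case 0 then show ?case by (auto intro: continuous_intros)
next
  case (Suc k)
  have "C_k k f" "C_k k g" using Suc.prems C_k_Suc_D by auto
  with Suc.prems show ?case
    by (intro C_k_SucI[OF has_derivative_mult[OF has_derivative_grad[OF Suc.prems(1)] has_derivative_grad[OF Suc.prems(2)]]])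
       (auto simp: inner_axis intro!: C_k_add Suc.IH)
qed

lemma C_k_affine: "C_k k f \<Longrightarrow> C_k k (\<lambda>y. f (c *\<^sub>R (y - a)))"
proof (induction k arbitrary: f)
  case 0 then show ?case
    by (auto intro!: continuous_on_compose2[of UNIV f] continuous_intros)
next
  case (Suc k)
  have "((\<lambda>y. f (c *\<^sub>R (y - a))) has_derivative (\<lambda>h. (\<chi> i. partial i f (c *\<^sub>R (x - a))) \<bullet> (c *\<^sub>R h))) (at x)" for x
    by (rule has_derivative_compose[OF _ has_derivative_grad[OF Suc.prems], of "\<lambda>y. c *\<^sub>R (y - a)" "\<lambda>h. c *\<^sub>R h"])
      (auto intro!: derivative_eq_intros)
  then show ?case
    by (rule C_k_SucI) (use Suc.prems in \<open>auto simp: inner_axis intro!: C_k_mult C_k_const Suc.IH\<close>)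
qed

lemma partial_affine:
  assumes "C_k (Suc k) f"
  shows "partial i (\<lambda>y. f (c *\<^sub>R (y - a))) = (\<lambda>y. c * partial i f (c *\<^sub>R (y - a)))"
proof
  fix x
  have "((\<lambda>y. f (c *\<^sub>R (y - a))) has_derivative (\<lambda>h. (\<chi> i. partial i f (c *\<^sub>R (x - a))) \<bullet> (c *\<^sub>R h))) (at x)"
    by (rule has_derivative_compose[OF _ has_derivative_grad[OF assms], of "\<lambda>y. c *\<^sub>R (y - a)" "\<lambda>h. c *\<^sub>R h"])
      (auto intro!: derivative_eq_intros)
  from partial_eqI[OF this] show "partial i (\<lambda>y. f (c *\<^sub>R (y - a))) x = c * partial i f (c *\<^sub>R (x - a))"
    by (simp add: inner_axis)
qed

lemma partial_cmult:
  assumes "C_k (Suc k) f"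
  shows "partial i (\<lambda>y. c * f y) = (\<lambda>y. c * partial i f y)"
proof
  fix x
  have "((\<lambda>y. c * f y) has_derivative (\<lambda>h. c * ((\<chi> i. partial i f x) \<bullet> h))) (at x)"
    by (rule has_derivative_mult_right[OF has_derivative_grad[OF assms]])
  from partial_eqI[OF this] show "partial i (\<lambda>y. c * f y) x = c * partial i f x"
    by (simp add: inner_axis)
qed

lemma C_k_component: "C_k k (\<lambda>x::real^'n. x $ i)"
proof (cases k)
  case 0 then show ?thesis by (auto intro: continuous_intros)
next
  case (Suc m)
  have "((\<lambda>x. x $ i) has_derivative (\<lambda>h. h $ i)) (at x)" for x :: "real^'n"
    by (rule bounded_linear_imp_has_derivative[OF bounded_linear_vec_nth])
  then show ?thesis unfolding Suc by (rule C_k_SucI) (rule C_k_const)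
qed

lemma has_derivative_radial:
  assumes "\<And>t. DERIV g t :> g' t"
  shows "((\<lambda>x::real^'n. g (x \<bullet> x)) has_derivative (\<lambda>h. g' (x \<bullet> x) * (2 * (x \<bullet> h)))) (at x)"
proof -
  have "((\<lambda>x::real^'n. x \<bullet> x) has_derivative (\<lambda>h. 2 * (x \<bullet> h))) (at x)"
    by (auto intro!: derivative_eq_intros simp: inner_commute)
  from has_derivative_compose[OF this assms[unfolded has_field_derivative_def]] show ?thesis .
qed

text \<open>One derivative more is assumed than is concluded, because \<open>C_k\<close> asks for a
  continuous last derivative and \<open>deriv_k\<close> does not provide it.\<close>

lemma C_k_radial: "deriv_k (Suc k) g \<Longrightarrow> C_k k (\<lambda>x::real^'n. g (x \<bullet> x))"
proof (induction k arbitrary: g)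
  case 0
  then obtain g' where "\<And>x. DERIV g x :> g' x" by auto
  from has_derivative_radial[OF this] show ?case
    by (auto simp: continuous_on_eq_continuous_at intro: has_derivative_continuous)
next
  case (Suc k)
  then obtain g' where g': "\<And>x. DERIV g x :> g' x" "deriv_k (Suc k) g'"
    by (subst (asm) deriv_k.simps) blast
  from has_derivative_radial[OF g'(1)] show ?case
    by (rule C_k_SucI) (auto simp: inner_axis intro!: C_k_mult C_k_const C_k_component Suc.IH[OF g'(2)])
qed

definition grad :: "(real ^ 'n \<Rightarrow> real) \<Rightarrow> real ^ 'n \<Rightarrow> real ^ 'n" where
  "grad f x = (\<chi> i. partial i f x)"

definition lap :: "(real ^ 'n::finite \<Rightarrow> real) \<Rightarrow> real ^ 'n \<Rightarrow> real" where
  "lap f x = (\<Sum>i\<in>UNIV. partial i (partial i f) x)"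

lemma lap_radial:
  assumes "\<And>t. DERIV g t :> g' t" "\<And>t. DERIV g' t :> g'' t"
  shows "lap (\<lambda>x::real^'n::finite. g (x \<bullet> x)) x = 4 * (x \<bullet> x) * g'' (x \<bullet> x) + 2 * real CARD('n) * g' (x \<bullet> x)"
proof -
  have 1: "partial i (\<lambda>x::real^'n. g (x \<bullet> x)) = (\<lambda>x. g' (x \<bullet> x) * (2 * x $ i))" for i
    using partial_eqI[OF has_derivative_radial[OF assms(1)]] by (fastforce simp: inner_axis)
  have 2: "partial i (\<lambda>x::real^'n. g' (x \<bullet> x) * (2 * x $ i)) x = g' (x \<bullet> x) * 2 + g'' (x \<bullet> x) * (2 * x $ i) * (2 * x $ i)" for i
  proof -
    have "((\<lambda>x::real^'n. g' (x \<bullet> x) * (2 * x $ i)) has_derivative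
       (\<lambda>h. g' (x \<bullet> x) * (2 * h $ i) + g'' (x \<bullet> x) * (2 * (x \<bullet> h)) * (2 * x $ i))) (at x)"
      by (intro has_derivative_mult has_derivative_radial assms has_derivative_mult_right
          bounded_linear_imp_has_derivative[OF bounded_linear_vec_nth])
    from partial_eqI[OF this, of i] show ?thesis by (simp add: inner_axis)
  qed
  show ?thesis
    unfolding lap_def 1 2
    by (simp add: sum.distrib inner_vec_def sum_distrib_left sum_distrib_right power2_eq_square algebra_simps)
qed

section \<open>Closure properties and bounds for test functions\<close>

lemma test_function_C_k: "test_function f \<Longrightarrow> C_k k f"
  by (simp add: test_function_def)

lemma test_functionI:
  assumes "\<And>k. C_k k f" "\<And>x. R < norm x \<Longrightarrow> f x = 0"
  shows "test_function f"
proof -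
  have "{x. f x \<noteq> 0} \<subseteq> cball 0 R" using assms(2) by (auto simp: not_less[symmetric])
  then have "bounded {x. f x \<noteq> 0}" using bounded_cball bounded_subset by blast
  with assms(1) show ?thesis by (simp add: test_function_def)
qed

lemma test_function_support:
  assumes "test_function f" obtains R where "R > 0" "\<And>x. R < norm x \<Longrightarrow> f x = 0"
proof -
  have "bounded (closure {x. f x \<noteq> 0})" using assms compact_imp_bounded by (auto simp: test_function_def)
  then obtain R where R: "R > 0" "\<And>x. x \<in> closure {x. f x \<noteq> 0} \<Longrightarrow> norm x \<le> R" unfolding bounded_pos by blast
  show ?thesis
    by (rule that[of R]) (use R closure_subset[of "{x. f x \<noteq> 0}"] in \<open>force+\<close>)
qed

lemma partial_zero_outside:
  assumes "\<And>x. R < norm x \<Longrightarrow> f x = 0" "R < norm x"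
  shows "partial i f x = 0"
proof -
  have "open {x::real^'n. R < norm x}" by (intro open_Collect_less continuous_intros)
  then have "(f has_derivative (\<lambda>h. 0)) (at x)"
    by (rule has_derivative_transform_within_open[OF has_derivative_const[of 0]]) (use assms in auto)
  from partial_eqI[OF this] show ?thesis by simp
qed

lemma test_function_partial:
  assumes "test_function f" shows "test_function (partial i f)"
proof -
  obtain R where R: "\<And>x. R < norm x \<Longrightarrow> f x = 0" using test_function_support[OF assms] by metis
  show ?thesis
  proof (rule test_functionI)
    show "C_k k (partial i f)" for k using test_function_C_k[OF assms, of "Suc k"] by simp
  qed (rule partial_zero_outside[OF R])
qed

lemma test_function_affine:
  assumes "test_function f" "c \<noteq> 0" shows "test_function (\<lambda>y. f (c *\<^sub>R (y - a)))"
proof -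
  obtain R where R: "R > 0" "\<And>x. R < norm x \<Longrightarrow> f x = 0" using test_function_support[OF assms(1)] by metis
  show ?thesis
  proof (rule test_functionI)
    show "C_k k (\<lambda>y. f (c *\<^sub>R (y - a)))" for k using test_function_C_k[OF assms(1)] C_k_affine by blast
    fix x :: "real^'a" assume "R / \<bar>c\<bar> + norm a < norm x"
    then have "R / \<bar>c\<bar> < norm (x - a)" using norm_triangle_sub[of x a] by simp
    then have "R < \<bar>c\<bar> * norm (x - a)" using assms(2) by (simp add: field_simps)
    then have "R < norm (c *\<^sub>R (x - a))" by simp
    then show "f (c *\<^sub>R (x - a)) = 0" using R by blast
  qed
qed

lemma test_function_cmult:
  assumes "test_function f" shows "test_function (\<lambda>y. c * f y)"
proof -
  obtain R where R: "\<And>x. R < norm x \<Longrightarrow> f x = 0" using test_function_support[OF assms] by metis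
  show ?thesis
    by (rule test_functionI[of _ R], rule C_k_mult[OF C_k_const test_function_C_k[OF assms]]) (simp add: R)
qed

lemma test_function_continuous: "test_function f \<Longrightarrow> continuous_on A f"
  using C_k_continuous test_function_C_k continuous_on_subset by blast

lemma test_function_measurable: "test_function f \<Longrightarrow> f \<in> borel_measurable borel"
  using test_function_continuous borel_measurable_continuous_onI by blast

lemma test_function_bounded:
  assumes "test_function f" obtains B where "B > 0" "\<And>x. \<bar>f x\<bar> \<le> B"
proof -
  obtain R where R: "R > 0" "\<And>x. R < norm x \<Longrightarrow> f x = 0" using test_function_support[OF assms] by metis
  have "bounded (f ` cball 0 R)"
    by (intro compact_imp_bounded compact_continuous_image test_function_continuous assms) auto
  then obtain B where B: "B > 0" "\<And>x. norm x \<le> R \<Longrightarrow> \<bar>f x\<bar> \<le> B" unfolding bounded_pos by auto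
  have "\<bar>f x\<bar> \<le> B" for x using B R by (cases "norm x \<le> R") auto
  with B that show ?thesis by blast
qed

lemma test_function_integrable:
  fixes f :: "real^'n \<Rightarrow> real"
  assumes "test_function f" shows "integrable lborel f"
proof -
  obtain R where R: "R > 0" "\<And>x. R < norm x \<Longrightarrow> f x = 0" using test_function_support[OF assms] by metis
  have "integrable lborel (\<lambda>x. indicator (cball 0 R) x *\<^sub>R f x)"
    by (rule borel_integrable_compact) (auto intro: test_function_continuous assms)
  also have "(\<lambda>x. indicator (cball 0 R) x *\<^sub>R f x) = f" using R(2) by (fastforce simp: indicator_def)
  finally show ?thesis .
qed

lemma test_function_has_derivative:
  "test_function f \<Longrightarrow> (f has_derivative (\<lambda>h. grad f x \<bullet> h)) (at x)"
  unfolding grad_def by (rule has_derivative_grad[OF test_function_C_k[of _ "Suc 0"]])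

text \<open>A nonnegative function with integral 0 vanishes almost everywhere, while a nonempty open
  set is not negligible. This allows the mollifier to be normalised.\<close>

lemma integral_pos_continuous:
  fixes f :: "'a::euclidean_space \<Rightarrow> real"
  assumes "continuous_on UNIV f" "f x > 0" "\<And>x. f x \<ge> 0" "integrable lborel f"
  shows "(LBINT x. f x) > 0"
proof -
  have "(LBINT x. f x) \<noteq> 0"
  proof
    assume "(LBINT x. f x) = 0"
    then have "AE x in lborel. f x = 0"
      using integral_nonneg_eq_0_iff_AE[of lborel f] assms by auto
    moreover have o: "open {x. 0 < f x}" using assms(1) by (intro open_Collect_less) auto
    moreover have "AE y in lborel. y \<notin> {x. 0 < f x}" using calculation(1) by eventually_elim auto
    ultimately have "{x. 0 < f x} \<in> null_sets lborel"
      by (subst AE_iff_null_sets) auto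
    then have "negligible {x. 0 < f x}"
      using null_sets_completionI by (auto simp: negligible_iff_null_sets)
    then show False using open_not_negligible o assms(2) by blast
  qed
  then show ?thesis using integral_nonneg_AE[of f lborel] assms(3) by (simp add: less_le)
qed

lemma ex_mollifier_pair:
  "\<exists>\<rho> \<gamma> :: real^'n::finite \<Rightarrow> real. test_function \<rho> \<and> test_function \<gamma> \<and> (\<forall>x. 0 \<le> \<rho> x) \<and>
     (LBINT x. \<rho> x) = 1 \<and> (\<forall>x. lap \<gamma> x = \<rho> x - 2 ^ CARD('n) * \<rho> (2 *\<^sub>R x))"
proof -
  obtain b G G' G'' where *: "\<forall>k. deriv_k k b" "\<forall>k. deriv_k k G" "\<forall>t. DERIV G t :> G' t"
    "\<forall>t. 0 \<le> b t" "\<forall>t. 1 < t \<and> t < 2 \<longrightarrow> 0 < b t" "\<forall>t. t \<le> 1 \<or> 2 \<le> t \<longrightarrow> b t = 0"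
    "\<forall>t\<ge>2. G t = 0" "\<forall>t. DERIV G' t :> G'' t \<and>
        4 * t * G'' t + 2 * real CARD('n) * G' t = b t - 2 powr real CARD('n) * b (4 * t)"
    using smooth_radial_profile[of "real CARD('n)"] by metis
  define r g where "r = (\<lambda>x::real^'n. b (x \<bullet> x))" and "g = (\<lambda>x::real^'n. G (x \<bullet> x))"
  have big: "2 \<le> x \<bullet> x" if "2 < norm x" for x :: "real^'n"
  proof -
    have "2 * 2 \<le> norm x * norm x" using that by (intro mult_mono) auto
    then show ?thesis by (simp add: power2_norm_eq_inner[symmetric] power2_eq_square)
  qed
  have r: "test_function r" and g: "test_function g"
    unfolding r_def g_def using * big by (auto intro!: test_functionI[of _ 2] C_k_radial simp del: deriv_k.simps)
  define c where "c = (LBINT x. r x)"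
  obtain i :: 'n where True by simp
  \<comment> \<open>The squared norm 25/16 of this point lies strictly between 1 and 2, where the
    profile is positive.\<close>
  have "r (axis i (5/4)) > 0" using *(5) by (simp add: r_def inner_axis_axis)
  then have c: "c > 0" unfolding c_def
    by (rule integral_pos_continuous[OF test_function_continuous[OF r]])
      (use * in \<open>auto simp: r_def intro: test_function_integrable[OF r, unfolded r_def]\<close>)
  have lg: "lap g x = r x - 2 ^ CARD('n) * r (2 *\<^sub>R x)" for x
    using lap_radial[of G G' G'' x] * by (simp add: g_def r_def powr_realpow)
  have "lap (\<lambda>x. (1/c) * g x) x = (1/c) * lap g x" for x
    using partial_cmult[OF test_function_C_k[OF g, of "Suc 0"]]
      partial_cmult[OF test_function_C_k[OF test_function_partial[OF g], of "Suc 0"]]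
    unfolding lap_def sum_distrib_left by metis
  then have "lap (\<lambda>x. (1/c) * g x) x = (1/c) * r x - 2 ^ CARD('n) * ((1/c) * r (2 *\<^sub>R x))" for x
    by (simp add: lg diff_divide_distrib)
  moreover have "(LBINT x. (1/c) * r x) = 1" using c by (simp add: c_def[symmetric])
  moreover have "0 \<le> (1/c) * r x" for x using c * by (simp add: r_def)
  ultimately show ?thesis
    using test_function_cmult[OF r] test_function_cmult[OF g]
    by (intro exI[of _ "\<lambda>x. (1/c) * r x"] exI[of _ "\<lambda>x. (1/c) * g x"]) blast
qed

section \<open>Convolution estimates\<close>

lemma distr_lborel_minus: "distr lborel borel (\<lambda>y. y - x) = (lborel :: 'a::euclidean_space measure)"
proof -
  have "(\<lambda>y. y - x) = (+) (- x)" by auto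
  then show ?thesis using lborel_distr_plus[of "-x"] by simp
qed

lemma distr_lborel_reflect: "distr lborel borel (\<lambda>y. x - y) = (lborel :: 'a::euclidean_space measure)"
  by (subst (2) lborel_affine[of "-1" x]) (simp_all add: density_1)

lemma nn_integral_lborel_minus:
  fixes f :: "'a::euclidean_space \<Rightarrow> ennreal"
  assumes [measurable]: "f \<in> borel_measurable borel"
  shows "(\<integral>\<^sup>+y. f (y - x) \<partial>lborel) = (\<integral>\<^sup>+y. f y \<partial>lborel)"
  by (subst (2) distr_lborel_minus[of x, symmetric]) (simp add: nn_integral_distr)

lemma nn_integral_lborel_reflect:
  fixes f :: "'a::euclidean_space \<Rightarrow> ennreal"
  assumes [measurable]: "f \<in> borel_measurable borel"
  shows "(\<integral>\<^sup>+y. f (x - y) \<partial>lborel) = (\<integral>\<^sup>+y. f y \<partial>lborel)"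
  by (subst (2) distr_lborel_reflect[of x, symmetric]) (simp add: nn_integral_distr)

lemma integral_lborel_minus:
  fixes f :: "'a::euclidean_space \<Rightarrow> real"
  assumes [measurable]: "f \<in> borel_measurable borel"
  shows "(LBINT y. f (y - x)) = (LBINT y. f y)"
  by (subst (2) distr_lborel_minus[of x, symmetric]) (simp add: integral_distr)

lemma integrable_lborel_minus:
  fixes f :: "'a::euclidean_space \<Rightarrow> real"
  assumes "integrable lborel f"
  shows "integrable lborel (\<lambda>y. f (y - x))"
proof -
  have [measurable]: "f \<in> borel_measurable borel" using assms by auto
  have "integrable (distr lborel borel (\<lambda>y. y - x)) f" using assms by (simp add: distr_lborel_minus)
  then show ?thesis by (subst (asm) integrable_distr_eq) auto
qed

lemma integrable_indicator_cball:
  "integrable lborel (indicator (cball a r) :: 'a::euclidean_space \<Rightarrow> real)"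
  using emeasure_bounded_finite[of "cball a r"] by (intro integrable_real_indicator) auto

lemma nn_integral_lborel_scale:
  fixes f :: "'a::euclidean_space \<Rightarrow> ennreal"
  assumes [measurable]: "f \<in> borel_measurable borel" and "c > 0"
  shows "(\<integral>\<^sup>+y. ennreal (c ^ DIM('a)) * f (c *\<^sub>R y) \<partial>lborel) = (\<integral>\<^sup>+y. f y \<partial>lborel)"
  by (subst (2) lborel_affine[of c 0])
    (use assms(2) in \<open>auto simp: nn_integral_density nn_integral_distr\<close>)

lemma integral_lborel_scale:
  fixes f :: "'a::euclidean_space \<Rightarrow> real"
  assumes [measurable]: "f \<in> borel_measurable borel" and "c > 0"
  shows "(LBINT y. c ^ DIM('a) * f (c *\<^sub>R y)) = (LBINT y. f y)"
  by (subst (2) lborel_affine[of c 0])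
    (use assms(2) in \<open>auto simp: integral_density integral_distr\<close>)

lemma integrable_lborel_scale:
  fixes f :: "'a::euclidean_space \<Rightarrow> real"
  assumes "integrable lborel f" and "c > 0"
  shows "integrable lborel (\<lambda>y. f (c *\<^sub>R y))"
proof -
  have [measurable]: "f \<in> borel_measurable borel" using assms by auto
  have "integrable lborel (\<lambda>y. c ^ DIM('a) * f (c *\<^sub>R y))"
    using assms by (subst (asm) lborel_affine[of c 0]) (auto simp: integrable_density integrable_distr_eq)
  then show ?thesis using assms(2) by simp
qed

text \<open>After multiplication by \<open>a\<close> this is the tangent of the convex function t^a
  at \<open>m\<close>. For \<open>a > 1\<close> it is Young's inequality with exponents
  \<open>a\<close> and \<open>a / (a - 1)\<close>.\<close>

lemma tangent_powr:
  assumes "1 \<le> a" "0 \<le> t" "0 \<le> (m::real)"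
  shows "t * m powr (a - 1) \<le> t powr a / a + (1 - 1 / a) * m powr a"
proof (cases "a = 1")
  case True then show ?thesis using assms by (cases "m = 0") auto
next
  case False
  then have a: "a > 1" using assms by auto
  have "t * m powr (a - 1) \<le> t powr a / a + (m powr (a - 1)) powr (a / (a - 1)) / (a / (a - 1))"
    by (rule Youngs_inequality) (use a assms in \<open>auto simp: field_simps\<close>)
  also have "(m powr (a - 1)) powr (a / (a - 1)) = m powr a" using a by (simp add: powr_powr)
  finally show ?thesis using a by (simp add: field_simps)
qed

text \<open>The tangent inequality at the mean value \<open>m = I / A\<close> is integrated against
  the weight. The constant term is nonnegative, so total mass at most \<open>A\<close> suffices. The
  measure is arbitrary so that counting measure gives the version for sums.\<close>

lemma jensen_powr:
  fixes F w :: "'a \<Rightarrow> real"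
  assumes "1 \<le> a" "0 < A" "\<And>x. 0 \<le> F x" "\<And>x. 0 \<le> w x"
    and i: "integrable M w" "integrable M (\<lambda>x. F x * w x)" "integrable M (\<lambda>x. F x powr a * w x)"
    and A: "(\<integral>x. w x \<partial>M) \<le> A"
  shows "(\<integral>x. F x * w x \<partial>M) powr a \<le> A powr (a - 1) * (\<integral>x. F x powr a * w x \<partial>M)"
proof -
  define I J where "I = (\<integral>x. F x * w x \<partial>M)" and "J = (\<integral>x. F x powr a * w x \<partial>M)"
  define m where "m = I / A"
  have I0: "I \<ge> 0" unfolding I_def using assms by (intro integral_nonneg_AE) auto
  have m: "m \<ge> 0" "m * A = I" using I0 assms by (auto simp: m_def)
  have "I * m powr (a - 1) = (\<integral>x. (F x * w x) * m powr (a - 1) \<partial>M)" unfolding I_def using i by simp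
  also have "\<dots> \<le> (\<integral>x. F x powr a * w x / a + (1 - 1 / a) * m powr a * w x \<partial>M)"
  proof (rule integral_mono)
    fix x
    have "(F x * m powr (a - 1)) * w x \<le> (F x powr a / a + (1 - 1 / a) * m powr a) * w x"
      using tangent_powr[of a "F x" m] assms m by (intro mult_right_mono) auto
    then show "(F x * w x) * m powr (a - 1) \<le> F x powr a * w x / a + (1 - 1 / a) * m powr a * w x"
      by (simp add: algebra_simps)
  qed (use i in auto)
  also have "\<dots> = J / a + (1 - 1 / a) * m powr a * (\<integral>x. w x \<partial>M)" using i by (simp add: J_def)
  also have "\<dots> \<le> J / a + (1 - 1 / a) * m powr a * A"
    using A assms(1) by (intro add_left_mono mult_left_mono) auto
  finally have *: "I * m powr (a - 1) \<le> J / a + (1 - 1 / a) * m powr a * A" .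
  have mm: "m * m powr (a - 1) = m powr a"
  proof (cases "m = 0")
    case False
    then have "m powr 1 * m powr (a - 1) = m powr a" by (subst powr_add[symmetric]) simp
    then show ?thesis using m by simp
  qed simp
  have "I * m powr (a - 1) = m powr a * A" unfolding m(2)[symmetric] using mm by (simp add: algebra_simps)
  with * have "m powr a * A \<le> J" using assms(1) by (simp add: field_simps)
  moreover have "I powr a = m powr a * A powr a" using m assms(2) powr_mult[of m A a] by simp
  moreover have "A powr a = A powr (a - 1) * A" using assms(2) by (simp add: powr_diff)
  ultimately have "I powr a \<le> A powr (a - 1) * J" using assms(2)
    by (simp add: mult.left_commute mult_left_mono)
  then show ?thesis by (simp add: I_def J_def)
qed

lemma jensen_powr_sum:
  fixes F w :: "nat \<Rightarrow> real"
  assumes "1 \<le> a" "0 < A" "\<And>x. 0 \<le> F x" "\<And>x. 0 \<le> w x" "(\<Sum>k<m. w k) \<le> A"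
  shows "(\<Sum>k<m. F k * w k) powr a \<le> A powr (a - 1) * (\<Sum>k<m. F k powr a * w k)"
  using jensen_powr[of a A F w "count_space {..<m}"] assms
  by (simp add: lebesgue_integral_count_space_finite integrable_count_space)

lemma le_one_plus_powr:
  assumes "1 \<le> a" "0 \<le> (t::real)" shows "t \<le> 1 + t powr a"
proof (cases "t \<le> 1")
  case False
  then have "t powr 1 \<le> t powr a" using assms by (intro powr_mono) auto
  then show ?thesis using False by simp
qed (auto intro: add_increasing2)

text \<open>Only the power of order \<open>a\<close> of \<open>F\<close> is integrable. Since t
  \<le> 1 + t^a, the product with the kernel is still integrable: the 1 is absorbed by the
  integrability of \<kappa>, the power by its boundedness.\<close>

lemma kernel_bound:
  fixes \<kappa> F :: "'a::euclidean_space \<Rightarrow> real"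
  assumes [measurable]: "\<kappa> \<in> borel_measurable borel" "F \<in> borel_measurable borel"
    and k: "\<And>x. 0 \<le> \<kappa> x" "\<And>x. \<kappa> x \<le> B" "integrable lborel \<kappa>" "(LBINT x. \<kappa> x) \<le> A" "0 < A"
    and F: "\<And>x. 0 \<le> F x" "1 \<le> a" "integrable lborel (\<lambda>x. F x powr a)"
  shows "integrable lborel (\<lambda>y. F y * \<kappa> (y - x))" (is ?i1)
    and "integrable lborel (\<lambda>y. F y powr a * \<kappa> (y - x))" (is ?i2)
    and "(LBINT y. F y * \<kappa> (y - x)) powr a \<le> A powr (a - 1) * (LBINT y. F y powr a * \<kappa> (y - x))"
    and "(LBINT y. F y powr a * \<kappa> (y - x)) \<le> B * (LBINT y. F y powr a)"
proof -
  have ik: "integrable lborel (\<lambda>y. \<kappa> (y - x))" by (rule integrable_lborel_minus[OF k(3)])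
  have B: "B \<ge> 0" using k(1,2) order_trans by blast
  show i2: ?i2
    by (rule Bochner_Integration.integrable_bound[OF integrable_mult_left[OF F(3), of B]])
      (use k F B in \<open>auto simp: abs_mult intro!: mult_left_mono\<close>)
  show i1: ?i1
  proof (rule Bochner_Integration.integrable_bound[OF Bochner_Integration.integrable_add[OF ik i2]])
    have "F y * \<kappa> (y - x) \<le> \<kappa> (y - x) + F y powr a * \<kappa> (y - x)" for y
      using mult_right_mono[OF le_one_plus_powr[OF F(2) F(1)[of y]] k(1)[of "y - x"]] by (simp add: algebra_simps)
    then show "AE y in lborel. norm (F y * \<kappa> (y - x)) \<le> norm (\<kappa> (y - x) + F y powr a * \<kappa> (y - x))"
      using k F by (auto simp: abs_mult)
  qed auto
  have "(LBINT y. \<kappa> (y - x)) \<le> A" using k(4) by (simp add: integral_lborel_minus)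
  then show "(LBINT y. F y * \<kappa> (y - x)) powr a \<le> A powr (a - 1) * (LBINT y. F y powr a * \<kappa> (y - x))"
    by (intro jensen_powr F k ik i1 i2)
  have "(LBINT y. F y powr a * \<kappa> (y - x)) \<le> (LBINT y. F y powr a * B)"
    by (intro integral_mono i2 integrable_mult_left F mult_left_mono k) auto
  then show "(LBINT y. F y powr a * \<kappa> (y - x)) \<le> B * (LBINT y. F y powr a)"
    using F(3) by (simp add: mult.commute)
qed

text \<open>Stated in \<open>ennreal\<close> so that Tonelli applies before any integrability is
  known; integrability of averages is deduced from it.\<close>

lemma kernel_nn_integral:
  fixes \<kappa> F :: "'a::euclidean_space \<Rightarrow> ennreal"
  assumes [measurable]: "\<kappa> \<in> borel_measurable borel" "F \<in> borel_measurable borel"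
  shows "(\<integral>\<^sup>+x. (\<integral>\<^sup>+y. F y * \<kappa> (y - x) \<partial>lborel) \<partial>lborel) = (\<integral>\<^sup>+y. \<kappa> y \<partial>lborel) * (\<integral>\<^sup>+y. F y \<partial>lborel)"
proof -
  have "(\<integral>\<^sup>+x. (\<integral>\<^sup>+y. F y * \<kappa> (y - x) \<partial>lborel) \<partial>lborel) = (\<integral>\<^sup>+y. (\<integral>\<^sup>+x. F y * \<kappa> (y - x) \<partial>lborel) \<partial>lborel)"
    by (rule lborel_pair.Fubini') measurable
  also have "\<dots> = (\<integral>\<^sup>+y. F y * (\<integral>\<^sup>+x. \<kappa> x \<partial>lborel) \<partial>lborel)"
    by (simp add: nn_integral_cmult nn_integral_lborel_reflect)
  finally show ?thesis by (simp add: nn_integral_multc mult.commute)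
qed

text \<open>Here \<open>N\<close> bounds the integral of \<open>F powr a\<close>, not the norm of \<open>F\<close>.\<close>

definition Lp_bound :: "real \<Rightarrow> real \<Rightarrow> ('a::euclidean_space \<Rightarrow> real) \<Rightarrow> bool" where
  "Lp_bound a N F \<longleftrightarrow> F \<in> borel_measurable borel \<and> (\<forall>x. 0 \<le> F x) \<and>
     (\<integral>\<^sup>+x. ennreal (F x powr a) \<partial>lborel) \<le> ennreal N"

lemma Lp_boundD:
  assumes "Lp_bound a N F" "0 \<le> N"
  shows "integrable lborel (\<lambda>x. F x powr a)" "(LBINT x. F x powr a) \<le> N"
proof -
  have [measurable]: "F \<in> borel_measurable borel" and le: "(\<integral>\<^sup>+x. ennreal (F x powr a) \<partial>lborel) \<le> ennreal N"
    using assms by (auto simp: Lp_bound_def)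
  then have "(\<integral>\<^sup>+x. ennreal (F x powr a) \<partial>lborel) < \<infinity>" using le_less_trans ennreal_less_top by fastforce
  then show i: "integrable lborel (\<lambda>x. F x powr a)" by (intro integrableI_nonneg) auto
  from le have "ennreal (LBINT x. F x powr a) \<le> ennreal N" by (subst (asm) nn_integral_eq_integral[OF i]) auto
  then show "(LBINT x. F x powr a) \<le> N" using assms(2) by (simp add: ennreal_le_iff)
qed

section \<open>Dyadic averages against an integrable envelope\<close>

locale envelope =
  fixes \<Lambda> :: "'a::euclidean_space \<Rightarrow> real" and A B :: real
  assumes env_measurable [measurable]: "\<Lambda> \<in> borel_measurable borel"
    and env_nonneg: "0 \<le> \<Lambda> x" and env_le: "\<Lambda> x \<le> B"
    and env_integrable: "integrable lborel \<Lambda>" and env_integral: "(LBINT x. \<Lambda> x) \<le> A"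
    and A_pos: "0 < A" and B_pos: "0 < B"
begin

text \<open>This dilation preserves the integral, so all levels share the mass bound
  \<open>A\<close> while the supremum grows like 2^(k n). The gain of integrability comes from
  interpolating between the two.\<close>

definition scaled :: "nat \<Rightarrow> 'a \<Rightarrow> real" where
  "scaled k z = (2 ^ k) ^ DIM('a) * \<Lambda> (2 ^ k *\<^sub>R z)"

text \<open>The kernel is not reflected: \<open>y - x\<close> is its argument, so that an average at
  \<open>x\<close> is literally a pairing with a test function in \<open>y\<close>.\<close>

definition conv :: "nat \<Rightarrow> ('a \<Rightarrow> real) \<Rightarrow> 'a \<Rightarrow> real" where
  "conv k F x = (LBINT y. F y * scaled k (y - x))"

lemma scaled_measurable [measurable]: "scaled k \<in> borel_measurable borel"
  unfolding scaled_def[abs_def] by measurable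

lemma scaled_facts: "0 \<le> scaled k z" "scaled k z \<le> (2 ^ k) ^ DIM('a) * B"
  "integrable lborel (scaled k)" "(LBINT z. scaled k z) \<le> A"
  unfolding scaled_def[abs_def]
  using env_nonneg env_le integrable_lborel_scale[OF env_integrable, of "2^k"]
    integral_lborel_scale[OF env_measurable, of "2^k"] env_integral
  by (auto intro!: mult_left_mono)

context
  fixes a N :: real and F :: "'a \<Rightarrow> real"
  assumes a: "1 \<le> a" and N: "0 \<le> N" and F: "Lp_bound a N F"
begin

lemma F_measurable: "F \<in> borel_measurable borel"
  and F_nonneg: "0 \<le> F x" using F by (auto simp: Lp_bound_def)

lemmas kernel_bounds = kernel_bound[OF scaled_measurable F_measurable scaled_facts A_pos F_nonneg a Lp_boundD(1)[OF F N]]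

lemma conv_integrable: "integrable lborel (\<lambda>y. F y * scaled k (y - x))"
  by (rule kernel_bounds)

lemma conv_nonneg: "0 \<le> conv k F x"
  unfolding conv_def by (intro integral_nonneg_AE) (auto simp: F_nonneg scaled_facts)

text \<open>Jensen bounds the average by a power of the average \<open>h\<close> of F^a. Of h^(Q /
  a) all but one factor is replaced by the supremum bound of order 2^(k n); the remaining factor has
  an integral over \<open>x\<close> bounded uniformly in \<open>k\<close>.\<close>

lemma conv_powr:
  assumes Q: "a \<le> Q"
  shows "conv k F x powr Q \<le> A powr ((a - 1) * (Q / a)) * ((2 ^ k) ^ DIM('a) * (B * N)) powr (Q / a - 1) *
     (LBINT y. F y powr a * scaled k (y - x))"
proof -
  define h where "h = (LBINT y. F y powr a * scaled k (y - x))"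
  have h0: "h \<ge> 0" unfolding h_def by (intro integral_nonneg_AE) (auto simp: scaled_facts)
  have "h \<le> (2 ^ k) ^ DIM('a) * B * (LBINT y. F y powr a)" unfolding h_def by (rule kernel_bounds)
  also have "\<dots> \<le> (2 ^ k) ^ DIM('a) * B * N" using Lp_boundD(2)[OF F N] B_pos by (intro mult_left_mono) auto
  finally have hB: "h \<le> (2 ^ k) ^ DIM('a) * (B * N)" by simp
  have "conv k F x powr Q = (conv k F x powr a) powr (Q / a)" using a by (simp add: powr_powr)
  also have "\<dots> \<le> (A powr (a - 1) * h) powr (Q / a)"
    using a Q kernel_bounds(3) by (intro powr_mono2) (auto simp: conv_def h_def)
  also have "\<dots> = A powr ((a - 1) * (Q / a)) * h powr (Q / a)"
    using A_pos h0 by (simp add: powr_mult powr_powr)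
  also have "h powr (Q / a) = h powr (Q / a - 1) * h"
    using h0 by (cases "h = 0") (auto simp: powr_diff)
  also have "A powr ((a - 1) * (Q / a)) * (h powr (Q / a - 1) * h) \<le>
      A powr ((a - 1) * (Q / a)) * (((2 ^ k) ^ DIM('a) * (B * N)) powr (Q / a - 1) * h)"
    using a Q hB h0 by (intro mult_left_mono mult_right_mono powr_mono2) auto
  finally show ?thesis by (simp add: h_def mult.assoc)
qed

text \<open>The limiting case of infinite \<open>Q\<close>: every factor of \<open>h\<close> is
  replaced by its supremum bound.\<close>

lemma conv_sup:
  "conv k F x \<le> (A powr (a - 1) * (B * N)) powr (1 / a) * 2 powr (real k * real DIM('a) / a)"
proof -
  define h where "h = (LBINT y. F y powr a * scaled k (y - x))"
  have "h \<le> (2 ^ k) ^ DIM('a) * B * (LBINT y. F y powr a)" unfolding h_def by (rule kernel_bounds)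
  also have "\<dots> \<le> (2 ^ k) ^ DIM('a) * B * N" using Lp_boundD(2)[OF F N] B_pos by (intro mult_left_mono) auto
  finally have hB: "h \<le> (2 ^ k) ^ DIM('a) * (B * N)" by simp
  have "conv k F x = (conv k F x powr a) powr (1 / a)" using a conv_nonneg by (simp add: powr_powr)
  also have "\<dots> \<le> (A powr (a - 1) * ((2 ^ k) ^ DIM('a) * (B * N))) powr (1 / a)"
    using a order_trans[OF kernel_bounds(3)[of k x] mult_left_mono[OF hB[unfolded h_def]]]
    by (intro powr_mono2) (auto simp: conv_def)
  also have "\<dots> = (A powr (a - 1) * (B * N)) powr (1 / a) * ((2 ^ k) ^ DIM('a)) powr (1 / a)"
    using A_pos B_pos N by (simp add: powr_mult[symmetric] mult_ac)
  also have "((2 ^ k) ^ DIM('a)) powr (1 / a) = 2 powr (real k * real DIM('a) / a)"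
    by (simp add: powr_realpow[symmetric] powr_powr power_mult[symmetric])
  finally show ?thesis .
qed

text \<open>
  Half of the surplus in \<open>\<alpha>\<close> is spent on the geometric weights \<open>2 powr (- \<epsilon> k)\<close>, with respect to which
  Jensen's inequality replaces the power of the sum by a sum of powers.
\<close>

lemma conv_series:
  assumes Q: "a \<le> Q" and \<alpha>: "real DIM('a) * (1 / a - 1 / Q) < \<alpha>"
  defines "\<epsilon> \<equiv> (\<alpha> - real DIM('a) * (1 / a - 1 / Q)) / 2"
  defines "W \<equiv> 1 / (1 - 2 powr (- \<epsilon>))"
  defines "C \<equiv> A powr ((a - 1) * (Q / a)) * (B * N) powr (Q / a - 1)"
  shows "\<exists>H. H \<in> borel_measurable borel \<and> (\<integral>\<^sup>+x. H x \<partial>lborel) \<le> ennreal (W powr (Q - 1) * C * (W * (A * N))) \<and>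
    (\<forall>m x. ennreal ((\<Sum>k<m. 2 powr (- \<alpha> * real k) * conv k F x) powr Q) \<le> H x)"
proof -
  note [measurable] = F_measurable
  define r where "r = 2 powr (- \<epsilon>)"
  have e: "\<epsilon> > 0" using \<alpha> by (simp add: \<epsilon>_def)
  have r: "0 < r" "r < 1" using e powr_less_mono[of "-\<epsilon>" 0 2] by (auto simp: r_def)
  have rk: "r ^ k = 2 powr (- \<epsilon> * real k)" for k
    by (simp add: r_def powr_realpow[symmetric] powr_powr)
  have W: "W > 0" and Wr: "(\<Sum>k. r ^ k) = W" using r by (auto simp: W_def r_def[symmetric] suminf_geometric)
  have Wm: "(\<Sum>k<m. r ^ k) \<le> W" for m
    unfolding Wr[symmetric] by (rule sum_le_suminf) (use r in auto)
  \<comment> \<open>The same average twice: \<open>hr\<close> serves the real inequalities,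
    \<open>hn\<close> measurability and Tonelli.\<close>
  define hr where "hr k x = (LBINT y. F y powr a * scaled k (y - x))" for k x
  define hn where "hn k x = (\<integral>\<^sup>+y. ennreal (F y powr a) * ennreal (scaled k (y - x)) \<partial>lborel)" for k x
  have [measurable]: "hn k \<in> borel_measurable borel" for k
    unfolding hn_def[abs_def] by measurable
  have hrn: "hn k x = ennreal (hr k x)" for k x
    unfolding hn_def hr_def
    by (subst nn_integral_eq_integral[symmetric, OF kernel_bounds(2)]) (auto simp: scaled_facts ennreal_mult)
  have hr0: "0 \<le> hr k x" for k x
    unfolding hr_def by (intro integral_nonneg_AE) (auto simp: scaled_facts)
  have ihn: "(\<integral>\<^sup>+x. hn k x \<partial>lborel) \<le> ennreal (A * N)" for k
  proof -
    have "(\<integral>\<^sup>+x. hn k x \<partial>lborel) = (\<integral>\<^sup>+y. ennreal (scaled k y) \<partial>lborel) * (\<integral>\<^sup>+y. ennreal (F y powr a) \<partial>lborel)"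
      unfolding hn_def by (rule kernel_nn_integral) measurable
    also have "\<dots> \<le> ennreal A * ennreal N"
      using F scaled_facts by (intro mult_mono) (auto simp: Lp_bound_def nn_integral_eq_integral ennreal_leI)
    finally show ?thesis using A_pos N by (simp add: ennreal_mult)
  qed
  have C0: "C \<ge> 0" by (simp add: C_def)
  \<comment> \<open>The geometric weight is divided out, so that \<open>b k x * r ^ k\<close> is the
    original term and Jensen applies with total weight at most \<open>W\<close>.\<close>
  define b where "b k x = 2 powr ((\<epsilon> - \<alpha>) * real k) * conv k F x" for k x
  have b0: "b k x \<ge> 0" for k x by (simp add: b_def conv_nonneg)
  have rb: "b k x * r ^ k = 2 powr (- \<alpha> * real k) * conv k F x" for k x
    by (simp add: b_def rk powr_add[symmetric] algebra_simps)
  have bQ: "b k x powr Q \<le> C * hr k x" for k x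
  proof -
    have "b k x powr Q = 2 powr ((\<epsilon> - \<alpha>) * real k * Q) * conv k F x powr Q"
      by (simp add: b_def powr_mult powr_powr conv_nonneg)
    also have "\<dots> \<le> 2 powr ((\<epsilon> - \<alpha>) * real k * Q) * (A powr ((a - 1) * (Q / a)) * ((2 ^ k) ^ DIM('a) * (B * N)) powr (Q / a - 1) * hr k x)"
      unfolding hr_def by (intro mult_left_mono conv_powr Q) auto
    also have "((2 ^ k) ^ DIM('a) * (B * N)) powr (Q / a - 1) = 2 powr (real k * real DIM('a) * (Q / a - 1)) * (B * N) powr (Q / a - 1)"
    proof -
      have "(2 ^ k) ^ DIM('a) = (2::real) powr (real k * real DIM('a))"
        by (simp add: powr_realpow[symmetric] powr_powr power_mult[symmetric])
      then show ?thesis using B_pos N by (simp add: powr_mult powr_powr)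
    qed
    also have "2 powr ((\<epsilon> - \<alpha>) * real k * Q) * (A powr ((a - 1) * (Q / a)) * (2 powr (real k * real DIM('a) * (Q / a - 1)) * (B * N) powr (Q / a - 1)) * hr k x)
      = 2 powr ((\<epsilon> - \<alpha>) * real k * Q + real k * real DIM('a) * (Q / a - 1)) * (C * hr k x)"
      by (simp add: C_def powr_add mult_ac)
    \<comment> \<open>Since \<alpha> exceeds the critical value by \<open>2 * \<epsilon>\<close>,
      the growth of the kernels is compensated and \<open>- \<epsilon>\<close> is left over in the
      exponent.\<close>
    also have "(\<epsilon> - \<alpha>) * real k * Q + real k * real DIM('a) * (Q / a - 1) = real k * Q * (\<epsilon> - 2 * \<epsilon>)"
      using a Q by (simp add: \<epsilon>_def field_simps)
    also have "2 powr (real k * Q * (\<epsilon> - 2 * \<epsilon>)) * (C * hr k x) \<le> 1 * (C * hr k x)"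
    proof (rule mult_right_mono)
      have "2 powr (real k * Q * (\<epsilon> - 2 * \<epsilon>)) \<le> (2::real) powr 0"
        using e a Q by (intro powr_mono) (auto simp: mult_nonneg_nonpos)
      then show "2 powr (real k * Q * (\<epsilon> - 2 * \<epsilon>)) \<le> (1::real)" by simp
    qed (use C0 hr0 in auto)
    finally show ?thesis by simp
  qed
  \<comment> \<open>The full series is used, so one integrable function dominates all partial sums
    at once.\<close>
  define H where "H x = ennreal (W powr (Q - 1) * C) * (\<Sum>k. ennreal (r ^ k) * hn k x)" for x
  have "(\<integral>\<^sup>+x. H x \<partial>lborel) = ennreal (W powr (Q - 1) * C) * (\<Sum>k. ennreal (r ^ k) * (\<integral>\<^sup>+x. hn k x \<partial>lborel))"
    unfolding H_def by (simp add: nn_integral_cmult nn_integral_suminf)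
  also have "\<dots> \<le> ennreal (W powr (Q - 1) * C) * (\<Sum>k. ennreal (r ^ k) * ennreal (A * N))"
    by (intro mult_left_mono suminf_le ihn) auto
  also have "(\<Sum>k. ennreal (r ^ k) * ennreal (A * N)) = ennreal (W * (A * N))"
  proof -
    have "(\<Sum>k. ennreal (r ^ k)) = ennreal W"
      unfolding Wr[symmetric] by (rule suminf_ennreal2) (use r in auto)
    then show ?thesis using W A_pos N by (simp add: ennreal_suminf_multc ennreal_mult)
  qed
  also have "ennreal (W powr (Q - 1) * C) * ennreal (W * (A * N)) = ennreal (W powr (Q - 1) * C * (W * (A * N)))"
    using W A_pos N C0 by (simp add: ennreal_mult)
  finally have 1: "(\<integral>\<^sup>+x. H x \<partial>lborel) \<le> ennreal (W powr (Q - 1) * C * (W * (A * N)))" .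
  have 2: "ennreal ((\<Sum>k<m. 2 powr (- \<alpha> * real k) * conv k F x) powr Q) \<le> H x" for m x
  proof -
    have "(\<Sum>k<m. 2 powr (- \<alpha> * real k) * conv k F x) powr Q = (\<Sum>k<m. b k x * r ^ k) powr Q"
      by (simp add: rb)
    also have "\<dots> \<le> W powr (Q - 1) * (\<Sum>k<m. b k x powr Q * r ^ k)"
      by (rule jensen_powr_sum) (use a Q W b0 r Wm in auto)
    also have "\<dots> \<le> W powr (Q - 1) * (\<Sum>k<m. C * hr k x * r ^ k)"
      using W r bQ by (intro mult_left_mono sum_mono mult_right_mono) auto
    also have "\<dots> = W powr (Q - 1) * C * (\<Sum>k<m. r ^ k * hr k x)"
      by (simp add: sum_distrib_left mult_ac)
    finally have "ennreal ((\<Sum>k<m. 2 powr (- \<alpha> * real k) * conv k F x) powr Q) \<le> ennreal (W powr (Q - 1) * C * (\<Sum>k<m. r ^ k * hr k x))"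
      by (rule ennreal_leI)
    also have "\<dots> = ennreal (W powr (Q - 1) * C) * (\<Sum>k<m. ennreal (r ^ k) * hn k x)"
      using W C0 r hr0 by (simp add: ennreal_mult hrn sum_nonneg flip: sum_ennreal)
    also have "\<dots> \<le> H x"
      unfolding H_def by (intro mult_left_mono sum_le_suminf) auto
    finally show ?thesis .
  qed
  show ?thesis using 1 2 by (intro exI[of _ H]) (auto simp: H_def[abs_def])
qed

end


lemma powr_sum3_le:
  assumes "1 \<le> Q" "0 \<le> p" "0 \<le> q" "0 \<le> (r::real)"
  shows "(p + q + r) powr Q \<le> 3 powr Q * (p powr Q + q powr Q + r powr Q)"
proof -
  define m where "m = max p (max q r)"
  have "(p + q + r) powr Q \<le> (3 * m) powr Q" using assms by (intro powr_mono2) (auto simp: m_def)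
  also have "\<dots> = 3 powr Q * m powr Q" using assms by (simp add: m_def powr_mult)
  also have "m powr Q \<le> p powr Q + q powr Q + r powr Q" by (auto simp: m_def max_def)
  finally show ?thesis by simp
qed

text \<open>This isolates what a gain of integrability needs from a solution: approximations whose
  first member and increments are dominated by averages. It is used with the gradient and with the
  equation as source of the increments. Convergence is asked for only along a subsequence, which may
  depend on the point.\<close>

definition decomposable :: "real \<Rightarrow> real \<Rightarrow> real \<Rightarrow> real \<Rightarrow> real \<Rightarrow> real \<Rightarrow> real \<Rightarrow> real \<Rightarrow> ('a \<Rightarrow> real) \<Rightarrow> bool" where
  "decomposable a0 N0 a1 N1 \<alpha>1 a2 N2 \<alpha>2 u \<longleftrightarrow> u \<in> borel_measurable borel \<and> (\<exists>U F0 F1 F2.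
     (AE x in lborel. \<exists>r. strict_mono r \<and> (\<lambda>k. U (r k) x) \<longlonglongrightarrow> u x) \<and>
     Lp_bound a0 N0 F0 \<and> Lp_bound a1 N1 F1 \<and> Lp_bound a2 N2 F2 \<and>
     (\<forall>x. \<bar>U 0 x\<bar> \<le> conv 0 F0 x) \<and>
     (\<forall>k x. \<bar>U (Suc k) x - U k x\<bar> \<le> 2 powr (- \<alpha>1 * real k) * conv k F1 x + 2 powr (- \<alpha>2 * real k) * conv k F2 x))"

lemma bootstrap_Lp:
  assumes a: "1 \<le> a0" "1 \<le> a1" "1 \<le> a2" "a0 \<le> Q" "a1 \<le> Q" "a2 \<le> Q"
    and N: "0 \<le> N0" "0 \<le> N1" "0 \<le> N2"
    and \<alpha>: "real DIM('a) * (1 / a1 - 1 / Q) < \<alpha>1" "real DIM('a) * (1 / a2 - 1 / Q) < \<alpha>2"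
  shows "\<exists>D\<ge>0. \<forall>u. decomposable a0 N0 a1 N1 \<alpha>1 a2 N2 \<alpha>2 u \<longrightarrow> Lp_bound Q D (\<lambda>x. \<bar>u x\<bar>)"
proof -
  \<comment> \<open>Only level 0 of this series matters, where the weight is 1 for any \<alpha>0;
    adding 1 just exceeds the threshold.\<close>
  define \<alpha>0 where "\<alpha>0 = real DIM('a) * (1 / a0 - 1 / Q) + 1"
  have \<alpha>0: "real DIM('a) * (1 / a0 - 1 / Q) < \<alpha>0" by (simp add: \<alpha>0_def)
  obtain D0 where D0: "\<And>F. Lp_bound a0 N0 F \<Longrightarrow> \<exists>H. H \<in> borel_measurable borel \<and> (\<integral>\<^sup>+x. H x \<partial>lborel) \<le> ennreal D0 \<and>
    (\<forall>m x. ennreal ((\<Sum>k<m. 2 powr (- \<alpha>0 * real k) * conv k F x) powr Q) \<le> H x)"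
    using conv_series[OF a(1) N(1) _ a(4) \<alpha>0] by blast
  obtain D1 where D1: "\<And>F. Lp_bound a1 N1 F \<Longrightarrow> \<exists>H. H \<in> borel_measurable borel \<and> (\<integral>\<^sup>+x. H x \<partial>lborel) \<le> ennreal D1 \<and>
    (\<forall>m x. ennreal ((\<Sum>k<m. 2 powr (- \<alpha>1 * real k) * conv k F x) powr Q) \<le> H x)"
    using conv_series[OF a(2) N(2) _ a(5) \<alpha>(1)] by blast
  obtain D2 where D2: "\<And>F. Lp_bound a2 N2 F \<Longrightarrow> \<exists>H. H \<in> borel_measurable borel \<and> (\<integral>\<^sup>+x. H x \<partial>lborel) \<le> ennreal D2 \<and>
    (\<forall>m x. ennreal ((\<Sum>k<m. 2 powr (- \<alpha>2 * real k) * conv k F x) powr Q) \<le> H x)"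
    using conv_series[OF a(3) N(3) _ a(6) \<alpha>(2)] by blast
  define D where "D = 3 powr Q * (max 0 D0 + max 0 D1 + max 0 D2)"
  have Q: "1 \<le> Q" using a by linarith
  show ?thesis
  proof (intro exI[of _ D] conjI allI impI)
    show "0 \<le> D" by (simp add: D_def)
    fix u assume dec: "decomposable a0 N0 a1 N1 \<alpha>1 a2 N2 \<alpha>2 u"
    then have [measurable]: "u \<in> borel_measurable borel" by (simp add: decomposable_def)
    from dec obtain U F0 F1 F2
      where conv_ae: "AE x in lborel. \<exists>r. strict_mono r \<and> (\<lambda>k. U (r k) x) \<longlonglongrightarrow> u x"
      and F: "Lp_bound a0 N0 F0" "Lp_bound a1 N1 F1" "Lp_bound a2 N2 F2"
      and U0: "\<forall>x. \<bar>U 0 x\<bar> \<le> conv 0 F0 x"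
      and U: "\<forall>k x. \<bar>U (Suc k) x - U k x\<bar> \<le> 2 powr (- \<alpha>1 * real k) * conv k F1 x + 2 powr (- \<alpha>2 * real k) * conv k F2 x"
      unfolding decomposable_def by (elim conjE exE)
    obtain H0 where H0: "H0 \<in> borel_measurable borel" "(\<integral>\<^sup>+x. H0 x \<partial>lborel) \<le> ennreal D0"
      "\<And>m x. ennreal ((\<Sum>k<m. 2 powr (- \<alpha>0 * real k) * conv k F0 x) powr Q) \<le> H0 x" using D0[OF F(1)] by blast
    obtain H1 where H1: "H1 \<in> borel_measurable borel" "(\<integral>\<^sup>+x. H1 x \<partial>lborel) \<le> ennreal D1"
      "\<And>m x. ennreal ((\<Sum>k<m. 2 powr (- \<alpha>1 * real k) * conv k F1 x) powr Q) \<le> H1 x" using D1[OF F(2)] by blast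
    obtain H2 where H2: "H2 \<in> borel_measurable borel" "(\<integral>\<^sup>+x. H2 x \<partial>lborel) \<le> ennreal D2"
      "\<And>m x. ennreal ((\<Sum>k<m. 2 powr (- \<alpha>2 * real k) * conv k F2 x) powr Q) \<le> H2 x" using D2[OF F(3)] by blast
    note [measurable] = H0(1) H1(1) H2(1)
    define S1 where "S1 m x = (\<Sum>k<m. 2 powr (- \<alpha>1 * real k) * conv k F1 x)" for m x
    define S2 where "S2 m x = (\<Sum>k<m. 2 powr (- \<alpha>2 * real k) * conv k F2 x)" for m x
    have S0: "0 \<le> S1 m x" "0 \<le> S2 m x" "0 \<le> conv 0 F0 x" for m x
      using conv_nonneg[OF a(2) N(2) F(2)] conv_nonneg[OF a(3) N(3) F(3)] conv_nonneg[OF a(1) N(1) F(1)]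
      by (auto simp: S1_def S2_def intro!: sum_nonneg)
    have Um: "\<bar>U m x\<bar> \<le> conv 0 F0 x + S1 m x + S2 m x" for m x
    proof (induction m)
      case 0 show ?case using U0 by (simp add: S1_def S2_def)
    next
      case (Suc m)
      have "\<bar>U (Suc m) x\<bar> \<le> \<bar>U m x\<bar> + \<bar>U (Suc m) x - U m x\<bar>" by linarith
      with Suc U[rule_format, of m x] show ?case by (simp add: S1_def S2_def)
    qed
    define H where "H x = ennreal (3 powr Q) * (H0 x + H1 x + H2 x)" for x
    have UH: "ennreal (\<bar>U m x\<bar> powr Q) \<le> H x" for m x
    proof -
      have "\<bar>U m x\<bar> powr Q \<le> (conv 0 F0 x + S1 m x + S2 m x) powr Q" using Um Q by (intro powr_mono2) auto
      also have "\<dots> \<le> 3 powr Q * (conv 0 F0 x powr Q + S1 m x powr Q + S2 m x powr Q)" by (rule powr_sum3_le[OF Q]) (use S0 in auto)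
      finally have "ennreal (\<bar>U m x\<bar> powr Q) \<le> ennreal (3 powr Q) * (ennreal (conv 0 F0 x powr Q) + ennreal (S1 m x powr Q) + ennreal (S2 m x powr Q))"
        by (simp add: ennreal_mult[symmetric] flip: ennreal_plus)
      also have "\<dots> \<le> H x" unfolding H_def
        using H0(3)[of x "Suc 0"] H1(3)[of x m] H2(3)[of x m] by (intro mult_left_mono add_mono) (auto simp: S1_def S2_def)
      finally show ?thesis .
    qed
    have "AE x in lborel. ennreal (\<bar>u x\<bar> powr Q) \<le> H x"
      using conv_ae
    proof eventually_elim
      case (elim x)
      \<comment> \<open>The majorant does not depend on the level, so the bound survives the limit
        along whichever subsequence belongs to \<open>x\<close>.\<close>
      then obtain r where r: "(\<lambda>k. U (r k) x) \<longlonglongrightarrow> u x" by blast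
      have "(\<lambda>k. \<bar>U (r k) x\<bar> powr Q) \<longlonglongrightarrow> \<bar>u x\<bar> powr Q"
        by (rule tendsto_powr2[OF tendsto_rabs[OF r] tendsto_const]) (use Q in auto)
      then have "(\<lambda>k. ennreal (\<bar>U (r k) x\<bar> powr Q)) \<longlonglongrightarrow> ennreal (\<bar>u x\<bar> powr Q)" by (rule tendsto_ennrealI)
      then show ?case by (rule LIMSEQ_le_const2) (use UH in blast)
    qed
    then have "(\<integral>\<^sup>+x. ennreal (\<bar>u x\<bar> powr Q) \<partial>lborel) \<le> (\<integral>\<^sup>+x. H x \<partial>lborel)" by (rule nn_integral_mono_AE)
    also have "\<dots> = ennreal (3 powr Q) * ((\<integral>\<^sup>+x. H0 x \<partial>lborel) + (\<integral>\<^sup>+x. H1 x \<partial>lborel) + (\<integral>\<^sup>+x. H2 x \<partial>lborel))"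
      unfolding H_def by (simp add: nn_integral_cmult nn_integral_add)
    also have "\<dots> \<le> ennreal (3 powr Q) * (ennreal (max 0 D0) + ennreal (max 0 D1) + ennreal (max 0 D2))"
      using H0(2) H1(2) H2(2) by (intro mult_left_mono add_mono) (auto simp: max_def ennreal_neg not_le intro: order_trans)
    also have "\<dots> = ennreal D" by (simp add: D_def ennreal_mult[symmetric] flip: ennreal_plus)
    finally show "Lp_bound Q D (\<lambda>x. \<bar>u x\<bar>)" by (simp add: Lp_bound_def)
  qed
qed

end

section \<open>Mollification\<close>

definition locally_integrable :: "('a::euclidean_space \<Rightarrow> real) \<Rightarrow> bool" where
  "locally_integrable f \<longleftrightarrow> (\<forall>m::nat. integrable lborel (\<lambda>x. indicator (cball 0 (real m)) x * f x))"

locale mollifier =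
  fixes \<rho> :: "'a::euclidean_space \<Rightarrow> real" and R B :: real
  assumes moll_measurable [measurable]: "\<rho> \<in> borel_measurable borel"
    and moll_nonneg: "0 \<le> \<rho> x" and moll_le: "\<rho> x \<le> B" and moll_B: "0 < B"
    and moll_integrable: "integrable lborel \<rho>" and moll_integral: "(LBINT x. \<rho> x) = 1"
    and moll_support: "R < norm x \<Longrightarrow> \<rho> x = 0"
begin

sublocale envelope \<rho> 1 B
  by unfold_locales (use moll_nonneg moll_le moll_B moll_integrable moll_integral in auto)

lemma scaled_integral: "(LBINT z. scaled k z) = 1"
  unfolding scaled_def using integral_lborel_scale[OF moll_measurable, of "2^k"] moll_integral by simp

lemma scaled_support: "R < norm z \<Longrightarrow> scaled k z = 0"
proof -
  assume *: "R < norm z"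
  have "1 * norm z \<le> 2 ^ k * norm z" by (intro mult_right_mono) auto
  with * have "R < norm (2 ^ k *\<^sub>R z)" by simp
  then show ?thesis by (simp add: scaled_def moll_support)
qed

lemma scaled_support': "R < 2 ^ k * norm z \<Longrightarrow> scaled k z = 0"
  by (simp add: scaled_def moll_support)

lemma conv_integrable1:
  assumes "integrable lborel f"
  shows "integrable lborel (\<lambda>y. f y * scaled k (y - x))"
proof -
  have [measurable]: "f \<in> borel_measurable borel" using assms by auto
  show ?thesis
    by (rule Bochner_Integration.integrable_bound[OF integrable_mult_left[OF assms, of "(2 ^ k) ^ DIM('a) * B"]])
      (use scaled_facts moll_B in \<open>auto simp: abs_mult intro!: mult_left_mono\<close>)
qed

lemma conv_measurable [measurable]:
  assumes [measurable]: "f \<in> borel_measurable borel"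
  shows "conv k f \<in> borel_measurable borel"
  unfolding conv_def[abs_def] by measurable

lemma conv_L1:
  assumes "integrable lborel f"
  shows "integrable lborel (conv k f)" "(LBINT x. \<bar>conv k f x\<bar>) \<le> (LBINT x. \<bar>f x\<bar>)"
proof -
  have [measurable]: "f \<in> borel_measurable borel" using assms by auto
  have "(\<integral>\<^sup>+x. ennreal \<bar>conv k f x\<bar> \<partial>lborel) \<le> (\<integral>\<^sup>+x. (\<integral>\<^sup>+y. ennreal \<bar>f y\<bar> * ennreal (scaled k (y - x)) \<partial>lborel) \<partial>lborel)"
  proof (rule nn_integral_mono)
    fix x
    have "ennreal \<bar>conv k f x\<bar> \<le> (\<integral>\<^sup>+y. ennreal \<bar>f y * scaled k (y - x)\<bar> \<partial>lborel)"
      unfolding conv_def using integral_norm_bound_ennreal[OF conv_integrable1[OF assms]] by simp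
    then show "ennreal \<bar>conv k f x\<bar> \<le> (\<integral>\<^sup>+y. ennreal \<bar>f y\<bar> * ennreal (scaled k (y - x)) \<partial>lborel)"
      by (simp add: abs_mult scaled_facts ennreal_mult)
  qed
  also have "\<dots> = (\<integral>\<^sup>+y. ennreal (scaled k y) \<partial>lborel) * (\<integral>\<^sup>+y. ennreal \<bar>f y\<bar> \<partial>lborel)"
    by (rule kernel_nn_integral) measurable
  also have "\<dots> = ennreal (LBINT x. \<bar>f x\<bar>)"
    using assms by (simp add: nn_integral_eq_integral scaled_facts scaled_integral)
  finally have *: "(\<integral>\<^sup>+x. ennreal \<bar>conv k f x\<bar> \<partial>lborel) \<le> ennreal (LBINT x. \<bar>f x\<bar>)" .
  then show i: "integrable lborel (conv k f)"
    using le_less_trans[OF _ ennreal_less_top] by (intro integrableI_bounded) (auto simp: top_unique)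
  from * show "(LBINT x. \<bar>conv k f x\<bar>) \<le> (LBINT x. \<bar>f x\<bar>)"
    using i by (simp add: nn_integral_eq_integral ennreal_le_iff)
qed

section \<open>Approximation of the identity in L^1\<close>

definition L1_error :: "('a \<Rightarrow> real) \<Rightarrow> nat \<Rightarrow> real" where
  "L1_error f k = (LBINT x. \<bar>conv k f x - f x\<bar>)"

lemma L1_error_nonneg: "0 \<le> L1_error f k"
  unfolding L1_error_def by (intro integral_nonneg_AE) auto

lemma conv_add: "integrable lborel f \<Longrightarrow> integrable lborel g \<Longrightarrow> conv k (\<lambda>x. f x + g x) x = conv k f x + conv k g x"
  unfolding conv_def by (simp add: distrib_right conv_integrable1)

lemma L1_error_add:
  assumes "integrable lborel f" "integrable lborel g"
  shows "L1_error (\<lambda>x. f x + g x) k \<le> L1_error f k + L1_error g k"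
proof -
  have "L1_error (\<lambda>x. f x + g x) k \<le> (LBINT x. \<bar>conv k f x - f x\<bar> + \<bar>conv k g x - g x\<bar>)"
    unfolding L1_error_def
    by (intro integral_mono) (use assms conv_L1 conv_add[OF assms] in auto)
  also have "\<dots> = L1_error f k + L1_error g k"
    unfolding L1_error_def using assms conv_L1 by (intro Bochner_Integration.integral_add) auto
  finally show ?thesis .
qed

lemma L1_error_le:
  assumes "integrable lborel f"
  shows "L1_error f k \<le> 2 * (LBINT x. \<bar>f x\<bar>)"
proof -
  have "L1_error f k \<le> (LBINT x. \<bar>conv k f x\<bar> + \<bar>f x\<bar>)"
    unfolding L1_error_def by (intro integral_mono) (use assms conv_L1 in auto)
  also have "\<dots> = (LBINT x. \<bar>conv k f x\<bar>) + (LBINT x. \<bar>f x\<bar>)"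
    using assms conv_L1 by (intro Bochner_Integration.integral_add) auto
  finally show ?thesis using conv_L1(2)[OF assms, of k] by linarith
qed

text \<open>The error is subadditive and at most twice the L^1 norm, so convergence passes to L^1
  limits.\<close>

lemma L1_error_tendsto_approx:
  assumes f: "integrable lborel f"
    and ap: "\<And>e. 0 < e \<Longrightarrow> \<exists>g. integrable lborel g \<and> L1_error g \<longlonglongrightarrow> 0 \<and> (LBINT x. \<bar>f x - g x\<bar>) < e"
  shows "L1_error f \<longlonglongrightarrow> 0"
proof (rule LIMSEQ_I)
  fix e :: real assume "0 < e"
  then obtain g where g: "integrable lborel g" "L1_error g \<longlonglongrightarrow> 0" "(LBINT x. \<bar>f x - g x\<bar>) < e / 4"
    using ap[of "e/4"] by auto
  from LIMSEQ_D[OF g(2), of "e/2"] \<open>0 < e\<close> obtain k0 where k0: "\<And>k. k \<ge> k0 \<Longrightarrow> \<bar>L1_error g k\<bar> < e / 2" by auto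
  have "\<bar>L1_error f k\<bar> < e" if "k \<ge> k0" for k
  proof -
    have "L1_error (\<lambda>x. g x + (f x - g x)) k \<le> L1_error g k + L1_error (\<lambda>x. f x - g x) k"
      by (rule L1_error_add) (use f g in auto)
    moreover have "L1_error (\<lambda>x. f x - g x) k \<le> 2 * (LBINT x. \<bar>f x - g x\<bar>)"
      by (rule L1_error_le) (use f g in auto)
    ultimately show ?thesis using g(3) k0[OF that] L1_error_nonneg[of f k] by simp
  qed
  then show "\<exists>no. \<forall>n\<ge>no. norm (L1_error f n - 0) < e" by auto
qed

lemma integral_conv:
  assumes f: "integrable lborel f" "\<And>x. 0 \<le> f x"
  shows "(LBINT x. conv k f x) = (LBINT x. f x)"
proof -
  have [measurable]: "f \<in> borel_measurable borel" using assms by auto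
  have c0: "0 \<le> conv k f x" for x unfolding conv_def using f scaled_facts by (intro integral_nonneg_AE) auto
  have "ennreal (LBINT x. conv k f x) = (\<integral>\<^sup>+x. ennreal (conv k f x) \<partial>lborel)"
    using conv_L1(1)[OF f(1)] c0 by (simp add: nn_integral_eq_integral)
  also have "\<dots> = (\<integral>\<^sup>+x. (\<integral>\<^sup>+y. ennreal (f y) * ennreal (scaled k (y - x)) \<partial>lborel) \<partial>lborel)"
    unfolding conv_def using conv_integrable1[OF f(1)] f(2) scaled_facts
    by (intro nn_integral_cong) (simp add: nn_integral_eq_integral[symmetric] ennreal_mult)
  also have "\<dots> = (\<integral>\<^sup>+y. ennreal (scaled k y) \<partial>lborel) * (\<integral>\<^sup>+y. ennreal (f y) \<partial>lborel)"
    by (rule kernel_nn_integral) measurable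
  also have "\<dots> = ennreal (LBINT x. f x)"
    using f by (simp add: nn_integral_eq_integral scaled_facts scaled_integral)
  finally show ?thesis using c0 f by (simp add: integral_nonneg_AE)
qed

text \<open>
  Mollification preserves the integral, so the error is twice the integral of the positive part of
  \<open>indicator U - conv k (indicator U)\<close>, to which dominated convergence applies.
\<close>

lemma L1_error_open:
  assumes U: "open U" "emeasure lborel U < \<infinity>"
  shows "L1_error (indicator U) \<longlonglongrightarrow> 0"
proof -
  define f where "f = (indicator U :: 'a \<Rightarrow> real)"
  have [measurable]: "U \<in> sets borel" using U by auto
  have f: "integrable lborel f" unfolding f_def using U by auto
  have f1: "f y \<le> 1" "0 \<le> f y" for y by (auto simp: f_def indicator_def)
  have c0: "0 \<le> conv k f x" for k x unfolding conv_def using f1 scaled_facts by (intro integral_nonneg_AE) auto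
  have eq: "L1_error f k = 2 * (LBINT x. max 0 (f x - conv k f x))" for k
  proof -
    have "L1_error f k = (LBINT x. 2 * max 0 (f x - conv k f x) - (f x - conv k f x))"
      unfolding L1_error_def by (intro Bochner_Integration.integral_cong) (auto simp: max_def)
    also have "\<dots> = 2 * (LBINT x. max 0 (f x - conv k f x)) - ((LBINT x. f x) - (LBINT x. conv k f x))"
      using f conv_L1(1)[OF f] by (simp add: integrable_max)
    finally show ?thesis using integral_conv[OF f f1(2)] by simp
  qed
  have "(\<lambda>k. LBINT x. max 0 (f x - conv k f x)) \<longlonglongrightarrow> (\<integral>x. 0 \<partial>(lborel :: 'a measure))"
  proof (rule integral_dominated_convergence[where w = f])
    show "AE x in lborel. (\<lambda>k. max 0 (f x - conv k f x)) \<longlonglongrightarrow> 0"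
    proof (rule AE_I2)
      fix x
      show "(\<lambda>k. max 0 (f x - conv k f x)) \<longlonglongrightarrow> 0"
      proof (cases "x \<in> U")
        case True
        \<comment> \<open>Once \<open>R / 2 ^ k < e\<close>, the kernel at \<open>x\<close> sees
          only points of \<open>U\<close> and the average is exactly 1.\<close>
        then obtain e where e: "e > 0" "ball x e \<subseteq> U" using U open_contains_ball by blast
        have "(\<lambda>k. R / 2 ^ k) \<longlonglongrightarrow> 0" by (rule LIMSEQ_divide_realpow_zero) simp
        then have "\<forall>\<^sub>F k in sequentially. R / 2 ^ k < e" by (rule order_tendstoD) (use e in auto)
        then have "\<forall>\<^sub>F k in sequentially. max 0 (f x - conv k f x) = 0"
        proof eventually_elim
          case (elim k)
          have fy: "f y * scaled k (y - x) = scaled k (y - x)" for y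
          proof (cases "y \<in> U")
            case False
            then have "e \<le> norm (y - x)" using e by (auto simp: subset_eq dist_norm norm_minus_commute not_less)
            have "R < 2 ^ k * e" using elim by (simp add: field_simps)
            also have "\<dots> \<le> 2 ^ k * norm (y - x)" using \<open>e \<le> norm (y - x)\<close> by (intro mult_left_mono) auto
            finally have "R < 2 ^ k * norm (y - x)" .
            then show ?thesis using scaled_support' by simp
          qed (simp add: f_def)
          then have "conv k f x = 1" unfolding conv_def fy by (simp add: integral_lborel_minus scaled_integral)
          then show ?case using True by (simp add: f_def)
        qed
        then show ?thesis by (rule tendsto_eventually)
      next
        case False
        \<comment> \<open>Off \<open>U\<close> the positive part is 0 at every level. Hence boundary
          points, which may have positive measure, cause no trouble.\<close>
        then have "max 0 (f x - conv k f x) = 0" for k using c0[of k x] by (simp add: f_def)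
        then show ?thesis by simp
      qed
    qed
  qed (use f f1 c0 in \<open>auto simp: max_def f_def\<close>)
  then have "(\<lambda>k. 2 * (LBINT x. max 0 (f x - conv k f x))) \<longlonglongrightarrow> 2 * 0" by (intro tendsto_mult_left) simp
  moreover have "L1_error (indicator U) = (\<lambda>k. 2 * (LBINT x. max 0 (f x - conv k f x)))"
    using eq by (auto simp: f_def)
  ultimately show ?thesis by simp
qed

text \<open>Density argument: outer regularity replaces a measurable set by an open one, simple
  functions follow by linearity, and dominated convergence brings the general case.\<close>

lemma L1_error_tendsto:
  assumes "integrable lborel f"
  shows "L1_error f \<longlonglongrightarrow> 0"
  using assms
proof (induction rule: integrable_induct)
  case (base A c)
  then have [measurable]: "A \<in> sets borel" by simp
  have iA: "integrable lborel (\<lambda>x. indicator A x *\<^sub>R c)" using base by auto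
  show ?case
  proof (rule L1_error_tendsto_approx[OF iA])
    fix e :: real assume e: "0 < e"
    define d where "d = e / (\<bar>c\<bar> + 1)"
    have d: "d > 0" "\<bar>c\<bar> * d < e" using e by (auto simp: d_def field_simps)
    obtain U where U: "open U" "A \<subseteq> U" "emeasure lborel (U - A) < ennreal d"
    proof -
      have "A \<in> sets lebesgue" by simp
      from sets_lebesgue_outer_open[OF this d(1)] obtain T where "open T" "A \<subseteq> T" "T - A \<in> lmeasurable" "emeasure lebesgue (T - A) < ennreal d" .
      with that[of T] show thesis by simp
    qed
    have [measurable]: "U \<in> sets borel" using U by auto
    have "emeasure lborel U = emeasure lborel A + emeasure lborel (U - A)"
      using U(2) by (subst plus_emeasure) (auto simp: Un_absorb1)
    also have "\<dots> < \<infinity>" using base(2) less_trans[OF U(3) ennreal_less_top] by simp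
    finally have Uf: "emeasure lborel U < \<infinity>" .
    have "L1_error (\<lambda>x. indicator U x * c) k = \<bar>c\<bar> * L1_error (indicator U) k" for k
    proof -
      have cv: "conv k (\<lambda>x. indicator U x * c) x = conv k (indicator U) x * c" for x
        unfolding conv_def by (simp add: mult_ac flip: integral_mult_right_zero)
      have "\<bar>conv k (\<lambda>x. indicator U x * c) x - indicator U x * c\<bar> = \<bar>c\<bar> * \<bar>conv k (indicator U) x - indicator U x\<bar>" for x
        unfolding cv left_diff_distrib[symmetric] abs_mult by (rule mult.commute)
      then show ?thesis unfolding L1_error_def by simp
    qed
    then have 1: "L1_error (\<lambda>x. indicator U x * c) \<longlonglongrightarrow> 0"
      using tendsto_mult_left[OF L1_error_open[OF U(1) Uf], of "\<bar>c\<bar>"] by (subst ext[of "L1_error (\<lambda>x. indicator U x * c)"]) auto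
    have 2: "integrable lborel (\<lambda>x. indicator U x * c)" using Uf by (intro integrable_mult_left) auto
    have "(LBINT x. \<bar>indicator A x *\<^sub>R c - indicator U x * c\<bar>) = (LBINT x. \<bar>c\<bar> * indicator (U - A) x)"
      using U(2) by (intro Bochner_Integration.integral_cong) (auto simp: indicator_def)
    also have "\<dots> = \<bar>c\<bar> * measure lborel (U - A)" by simp
    also have "\<dots> \<le> \<bar>c\<bar> * d"
    proof -
      have "emeasure lborel (U - A) = ennreal (measure lborel (U - A))"
        using U(3) by (intro emeasure_eq_ennreal_measure) auto
      then have "measure lborel (U - A) \<le> d" using U(3) d(1) by (simp add: ennreal_less_iff)
      then show ?thesis by (intro mult_left_mono) auto
    qed
    finally show "\<exists>g. integrable lborel g \<and> L1_error g \<longlonglongrightarrow> 0 \<and> (LBINT x. \<bar>indicator A x *\<^sub>R c - g x\<bar>) < e"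
      using 1 2 d by (intro exI[of _ "\<lambda>x. indicator U x * c"]) auto
  qed
next
  case (add f g)
  show ?case
  proof (rule real_tendsto_sandwich[OF _ _ tendsto_const])
    show "(\<lambda>k. L1_error f k + L1_error g k) \<longlonglongrightarrow> 0" using tendsto_add[OF add.IH] by simp
    show "\<forall>\<^sub>F k in sequentially. L1_error (\<lambda>x. f x + g x) k \<le> L1_error f k + L1_error g k"
      using L1_error_add add by auto
  qed (use L1_error_nonneg in auto)
next
  case (lim f s)
  have [measurable]: "f \<in> borel_measurable borel" "\<And>i. s i \<in> borel_measurable borel" using lim by auto
  show ?case
  proof (rule L1_error_tendsto_approx[OF lim.hyps(4)])
    fix e :: real assume e: "0 < e"
    have "(\<lambda>i. LBINT x. \<bar>f x - s i x\<bar>) \<longlonglongrightarrow> (\<integral>x. 0 \<partial>(lborel :: 'a measure))"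
    proof (rule integral_dominated_convergence[where w = "\<lambda>x. 3 * \<bar>f x\<bar>"])
      show "AE x in lborel. (\<lambda>i. \<bar>f x - s i x\<bar>) \<longlonglongrightarrow> 0"
      proof (rule AE_I2)
        fix x
        have "(\<lambda>i. s i x) \<longlonglongrightarrow> f x" using lim by auto
        from tendsto_rabs[OF tendsto_diff[OF tendsto_const[of "f x"] this]] show "(\<lambda>i. \<bar>f x - s i x\<bar>) \<longlonglongrightarrow> 0" by simp
      qed
      show "AE x in lborel. norm \<bar>f x - s i x\<bar> \<le> 3 * \<bar>f x\<bar>" for i
      proof (rule AE_I2)
        fix x
        have "\<bar>s i x\<bar> \<le> 2 * \<bar>f x\<bar>" using lim by auto
        then show "norm \<bar>f x - s i x\<bar> \<le> 3 * \<bar>f x\<bar>" by simp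
      qed
    qed (use lim in auto)
    then have "\<forall>\<^sub>F i in sequentially. (LBINT x. \<bar>f x - s i x\<bar>) < e" by (rule order_tendstoD) (use e in auto)
    then obtain i where "(LBINT x. \<bar>f x - s i x\<bar>) < e" by (auto simp: eventually_sequentially)
    then show "\<exists>g. integrable lborel g \<and> L1_error g \<longlonglongrightarrow> 0 \<and> (LBINT x. \<bar>f x - g x\<bar>) < e"
      by (intro exI[of _ "s i"] conjI lim.hyps(1) lim.IH)
  qed
qed

text \<open>The counterpart of \<open>decomposable\<close> for the supremum norm, with the
  approximations now fixed to be the mollifications.\<close>

definition decay :: "real \<Rightarrow> real \<Rightarrow> ('a \<Rightarrow> real) \<Rightarrow> bool" where
  "decay C \<epsilon> u \<longleftrightarrow> u \<in> borel_measurable borel \<and>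
     (AE x in lborel. \<exists>r. strict_mono r \<and> (\<lambda>k. conv (r k) u x) \<longlonglongrightarrow> u x) \<and>
     (\<forall>x. \<bar>conv 0 u x\<bar> \<le> C) \<and> (\<forall>k x. \<bar>conv (Suc k) u x - conv k u x\<bar> \<le> C * 2 powr (- \<epsilon> * real k))"

text \<open>Truncation to a ball of radius \<open>m\<close> produces an L^1 function, whose
  mollifications converge almost everywhere along a subsequence. Near a given \<open>x\<close> a
  large enough \<open>m\<close> makes the truncation invisible to every kernel centred at
  \<open>x\<close>. The subsequence thus depends on \<open>x\<close>, but only through
  \<open>m\<close>, so countably many null sets are discarded.\<close>

lemma conv_AE_subseq:
  assumes [measurable]: "f \<in> borel_measurable borel"
    and loc: "locally_integrable f"
  shows "AE x in lborel. \<exists>r. strict_mono r \<and> (\<lambda>k. conv (r k) f x) \<longlonglongrightarrow> f x"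
proof -
  define g where "g m x = indicator (cball 0 (real m)) x * f x" for m :: nat and x
  have gi: "integrable lborel (g m)" for m using loc by (simp add: g_def[abs_def] locally_integrable_def)
  have "\<exists>r. strict_mono r \<and> (AE x in lborel. (\<lambda>k. conv (r k) (g m) x - g m x) \<longlonglongrightarrow> 0)" for m
  proof (rule tendsto_L1_AE_subseq)
    show "(\<lambda>k. LBINT x. norm (conv k (g m) x - g m x)) \<longlonglongrightarrow> 0"
      unfolding real_norm_def L1_error_def[symmetric] by (rule L1_error_tendsto[OF gi])
    show "integrable lborel (\<lambda>x. conv k (g m) x - g m x)" for k
      by (intro Bochner_Integration.integrable_diff conv_L1 gi)
  qed
  then have "\<exists>r. \<forall>m. strict_mono (r m) \<and> (AE x in lborel. (\<lambda>k. conv (r m k) (g m) x - g m x) \<longlonglongrightarrow> 0)"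
    by (intro choice allI)
  then obtain r where r: "\<And>m. strict_mono (r m)" "\<And>m. AE x in lborel. (\<lambda>k. conv (r m k) (g m) x - g m x) \<longlonglongrightarrow> 0"
    by blast
  have "AE x in lborel. \<forall>m. (\<lambda>k. conv (r m k) (g m) x - g m x) \<longlonglongrightarrow> 0" unfolding AE_all_countable using r(2) by blast
  then show ?thesis
  proof eventually_elim
    case (elim x)
    obtain m :: nat where m: "norm x + \<bar>R\<bar> < real m" using reals_Archimedean2 by blast
    have gx: "g m x = f x" using m by (simp add: g_def)
    have "conv k (g m) x = conv k f x" for k
      unfolding conv_def
    proof (rule Bochner_Integration.integral_cong[OF refl])
      fix y
      show "g m y * scaled k (y - x) = f y * scaled k (y - x)"
      proof (cases "norm y \<le> real m")
        case False
        then have "R < norm (y - x)" using m norm_triangle_sub[of y x] by linarith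
        then show ?thesis using scaled_support by simp
      qed (simp add: g_def)
    qed
    with elim[rule_format, of m] gx have "(\<lambda>k. conv (r m k) f x - f x) \<longlonglongrightarrow> 0" by simp
    then have "(\<lambda>k. conv (r m k) f x) \<longlonglongrightarrow> f x" by (simp add: LIM_zero_iff)
    with r(1) show ?case by blast
  qed
qed

end

section \<open>The nonlocal form\<close>

lemma grad_bounded:
  assumes "test_function f" obtains L where "L > 0" "\<And>x. norm (grad f x) \<le> L"
proof -
  have "\<forall>i. \<exists>B>0. \<forall>x. \<bar>partial i f x\<bar> \<le> B"
    using test_function_bounded[OF test_function_partial[OF assms]] by metis
  then obtain B where B: "\<And>i. B i > 0" "\<And>i x. \<bar>partial i f x\<bar> \<le> B i" by metis
  have "norm (grad f x) \<le> (\<Sum>i\<in>UNIV. B i)" for x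
    using norm_le_l1_cart[of "grad f x"] sum_mono[of UNIV "\<lambda>i. \<bar>partial i f x\<bar>" B] B(2)
    by (simp add: grad_def)
  moreover have "(\<Sum>i\<in>UNIV. B i) > 0" using B(1) by (intro sum_pos) auto
  ultimately show ?thesis using that by blast
qed

lemma test_function_lipschitz:
  assumes "test_function f" obtains L where "L > 0" "\<And>x y. \<bar>f x - f y\<bar> \<le> L * norm (x - y)"
proof -
  obtain L where L: "L > 0" "\<And>x. norm (grad f x) \<le> L" using grad_bounded[OF assms] by blast
  have "norm (f x - f y) \<le> L * norm (x - y)" for x y
  proof (rule differentiable_bound[of UNIV])
    show "(f has_derivative (\<lambda>h. grad f x \<bullet> h)) (at x within UNIV)" for x
      using test_function_has_derivative[OF assms] by simp
    show "onorm (\<lambda>h. grad f x \<bullet> h) \<le> L" for x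
    proof (rule onorm_le)
      fix h
      have "norm (grad f x \<bullet> h) \<le> norm (grad f x) * norm h" by (simp add: Cauchy_Schwarz_ineq2)
      also have "\<dots> \<le> L * norm h" using L by (intro mult_right_mono) auto
      finally show "norm (grad f x \<bullet> h) \<le> L * norm h" .
    qed
  qed auto
  with L(1) that show ?thesis by auto
qed

definition second_diff :: "('a::real_vector \<Rightarrow> real) \<Rightarrow> 'a \<Rightarrow> 'a \<Rightarrow> real" where
  "second_diff v z h = 2 * v z - v (z + h) - v (z - h)"

text \<open>For large \<open>h\<close> the values of \<open>v\<close> are bounded. For small
  \<open>h\<close> the mean value theorem for \<open>t \<mapsto> v (z + t h) + v (z - t h)\<close>
  produces a difference of gradients at distance at most \<open>2 * norm h\<close>, and the gradient
  is Lipschitz.\<close>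

lemma second_diff_bound:
  fixes v :: "real ^ 'n::finite \<Rightarrow> real"
  assumes v: "test_function v"
  obtains C where "C > 0" "\<And>z h. \<bar>second_diff v z h\<bar> \<le> C * min 1 ((norm h)\<^sup>2)"
proof -
  obtain B where B: "B > 0" "\<And>x. \<bar>v x\<bar> \<le> B" using test_function_bounded[OF v] by blast
  have "\<forall>i. \<exists>L>0. \<forall>x y. \<bar>partial i v x - partial i v y\<bar> \<le> L * norm (x - y)"
    using test_function_lipschitz[OF test_function_partial[OF v]] by metis
  then obtain L where L: "\<And>i. L i > 0" "\<And>i x y. \<bar>partial i v x - partial i v y\<bar> \<le> L i * norm (x - y)" by metis
  define M where "M = (\<Sum>i\<in>UNIV. L i)"
  have M: "M > 0" unfolding M_def using L by (intro sum_pos) auto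
  have gL: "norm (grad v x - grad v y) \<le> M * norm (x - y)" for x y
    using norm_le_l1_cart[of "grad v x - grad v y"] sum_mono[of UNIV "\<lambda>i. \<bar>partial i v x - partial i v y\<bar>" "\<lambda>i. L i * norm (x - y)"] L(2)
    by (simp add: grad_def M_def sum_distrib_right)
  have 1: "\<bar>second_diff v z h\<bar> \<le> (4 * B + 2 * M) * 1" for z h
    using B(2)[of z] B(2)[of "z + h"] B(2)[of "z - h"] M
    by (auto simp: second_diff_def abs_le_iff)
  have 2: "\<bar>second_diff v z h\<bar> \<le> (4 * B + 2 * M) * (norm h)\<^sup>2" for z h
  proof -
    define \<phi> where "\<phi> t = v (z + t *\<^sub>R h) + v (z - t *\<^sub>R h)" for t :: real
    have d: "(\<phi> has_real_derivative (grad v (z + t *\<^sub>R h) - grad v (z - t *\<^sub>R h)) \<bullet> h) (at t)" for t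
    proof -
      have "((\<lambda>t. v (z + t *\<^sub>R h)) has_derivative (\<lambda>s. grad v (z + t *\<^sub>R h) \<bullet> (s *\<^sub>R h))) (at t)"
        by (rule has_derivative_compose[OF _ test_function_has_derivative[OF v]]) (auto intro!: derivative_eq_intros)
      moreover have "((\<lambda>t. v (z - t *\<^sub>R h)) has_derivative (\<lambda>s. grad v (z - t *\<^sub>R h) \<bullet> (- (s *\<^sub>R h)))) (at t)"
        by (rule has_derivative_compose[OF _ test_function_has_derivative[OF v]]) (auto intro!: derivative_eq_intros)
      ultimately have "(\<phi> has_derivative (\<lambda>s. grad v (z + t *\<^sub>R h) \<bullet> (s *\<^sub>R h) + grad v (z - t *\<^sub>R h) \<bullet> (- (s *\<^sub>R h)))) (at t)"
        unfolding \<phi>_def by (rule has_derivative_add)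
      then show ?thesis unfolding has_field_derivative_def
        by (rule has_derivative_eq_rhs) (auto simp: algebra_simps)
    qed
    obtain \<xi> where \<xi>: "0 < \<xi>" "\<xi> < 1" "\<phi> 1 - \<phi> 0 = (1 - 0) * ((grad v (z + \<xi> *\<^sub>R h) - grad v (z - \<xi> *\<^sub>R h)) \<bullet> h)"
      using MVT2[of 0 1 \<phi>, OF _ d] by auto
    have "\<bar>second_diff v z h\<bar> = \<bar>\<phi> 1 - \<phi> 0\<bar>" by (simp add: second_diff_def \<phi>_def)
    also have "\<dots> \<le> norm (grad v (z + \<xi> *\<^sub>R h) - grad v (z - \<xi> *\<^sub>R h)) * norm h"
      unfolding \<xi>(3) by (simp add: Cauchy_Schwarz_ineq2)
    also have "\<dots> \<le> (M * norm ((z + \<xi> *\<^sub>R h) - (z - \<xi> *\<^sub>R h))) * norm h" by (intro mult_right_mono gL) auto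
    also have "(z + \<xi> *\<^sub>R h) - (z - \<xi> *\<^sub>R h) = (2 * \<xi>) *\<^sub>R h" by (simp add: algebra_simps flip: scaleR_2)
    also have "M * norm ((2 * \<xi>) *\<^sub>R h) * norm h = (2 * M) * (\<xi> * (norm h)\<^sup>2)" using \<xi> by (simp add: power2_eq_square)
    also have "\<dots> \<le> (2 * M) * (1 * (norm h)\<^sup>2)" using \<xi> M by (intro mult_left_mono mult_right_mono) auto
    also have "\<dots> \<le> (4 * B + 2 * M) * (norm h)\<^sup>2" using B by (simp add: mult_right_mono)
    finally show ?thesis .
  qed
  show ?thesis
    by (rule that[of "4 * B + 2 * M"]) (use 1 2 B M in \<open>auto simp: min_def\<close>)
qed

lemma ex_dyadic:
  assumes "1 \<le> (r::real)" shows "\<exists>j::nat. 2 ^ j \<le> r \<and> r < 2 ^ Suc j"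
proof -
  define n where "n = (LEAST n. r < 2 ^ n)"
  have ex: "\<exists>n::nat. r < 2 ^ n" using real_arch_pow[of 2 r] by auto
  then have n: "r < 2 ^ n" unfolding n_def by (rule LeastI_ex)
  then obtain j where j: "n = Suc j" using assms by (cases n) auto
  have "\<not> r < 2 ^ j" using not_less_Least[of j "\<lambda>n. r < 2 ^ n"] j n_def by auto
  with n j show ?thesis by (auto simp: not_less)
qed

text \<open>The integrand behaves like |h|^(-n - 2 s) at infinity and |h|^(2 - n - 2 s) at 0.
  Summing over dyadic shells gives geometric series with ratios 2^(-2 s) and 2^(-(2 - 2 s)), both
  below 1 since 0 < s < 1.\<close>

lemma levy_integral_finite:
  assumes s: "0 < s" "s < 1"
  shows "(\<integral>\<^sup>+h. ennreal (min 1 ((norm h)\<^sup>2) / norm h powr (real DIM('a) + 2 * s)) \<partial>(lborel :: 'a::euclidean_space measure)) < \<infinity>"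
proof -
  define d where "d = real DIM('a)"
  define c where "c = unit_ball_vol d"
  have c: "c \<ge> 0" by (simp add: c_def d_def)
  have vol: "emeasure lborel (cball (0::'a) r) = ennreal (c * r powr d)" if "r > 0" for r
    using that by (simp add: emeasure_cball c_def d_def powr_realpow)
  have pick: "f j \<le> (\<Sum>j. f j)" for f :: "nat \<Rightarrow> ennreal" and j
    using sum_le_suminf[of f "{j}"] by simp
  \<comment> \<open>\<open>a1\<close> bounds the integrand on the shell from 2^j to 2^(j + 1). On
    the shell from 2^(-j - 1) to 2^(-j), \<open>a2\<close> takes the square at the outer radius and
    the singular weight at the inner one. Each shell is enlarged to the ball of radius
    \<open>b1 j\<close> or \<open>b2 j\<close>.\<close>
  define a1 where "a1 j = 2 powr (- real j * (d + 2 * s))" for j :: nat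
  define a2 where "a2 j = 2 powr (- 2 * real j) * 2 powr ((real j + 1) * (d + 2 * s))" for j :: nat
  define b1 where "b1 j = (2::real) powr (real j + 1)" for j :: nat
  define b2 where "b2 j = (2::real) powr (- real j)" for j :: nat
  have a1: "0 \<le> a1 j" and a2: "0 \<le> a2 j" and b1: "0 < b1 j" and b2: "0 < b2 j" for j
    by (simp_all add: a1_def a2_def b1_def b2_def)
  have le: "ennreal (min 1 ((norm h)\<^sup>2) / norm h powr (d + 2 * s)) \<le>
     (\<Sum>j. ennreal (a1 j) * indicator (cball 0 (b1 j)) h) + (\<Sum>j. ennreal (a2 j) * indicator (cball 0 (b2 j)) h)" for h :: 'a
  proof -
    consider "h = 0" | "1 \<le> norm h" | "h \<noteq> 0" "1 \<le> 1 / norm h" by (cases "norm h \<ge> 1") (auto simp: field_simps)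
    then show ?thesis
    proof cases
      case 2
      then obtain j :: nat where j: "2 ^ j \<le> norm h" "norm h < 2 ^ Suc j" using ex_dyadic by blast
      have "min 1 ((norm h)\<^sup>2) / norm h powr (d + 2 * s) \<le> 1 / norm h powr (d + 2 * s)"
        by (intro divide_right_mono) auto
      also have "\<dots> = norm h powr (- (d + 2 * s))" by (simp only: powr_minus_divide)
      also have "\<dots> \<le> (2 powr real j) powr (- (d + 2 * s))"
        using j 2 s by (intro powr_mono2') (auto simp: powr_realpow d_def)
      also have "\<dots> = a1 j" unfolding a1_def powr_powr by (rule arg_cong[where f = "\<lambda>t. 2 powr t"]) (simp add: algebra_simps)
      finally have "ennreal (min 1 ((norm h)\<^sup>2) / norm h powr (d + 2 * s)) \<le> ennreal (a1 j) * indicator (cball 0 (b1 j)) h"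
        using j(2) by (simp add: b1_def powr_add powr_realpow ennreal_leI)
      also have "\<dots> \<le> (\<Sum>j. ennreal (a1 j) * indicator (cball 0 (b1 j)) h)"
        by (rule pick)
      finally show ?thesis by (simp add: add_increasing2)
    next
      case 3
      then obtain j :: nat where j: "2 ^ j \<le> 1 / norm h" "1 / norm h < 2 ^ Suc j" using ex_dyadic by blast
      have h1: "norm h \<le> 2 powr (- real j)" "2 powr (- (real j + 1)) \<le> norm h"
        using j 3 by (auto simp: powr_minus powr_add powr_diff powr_realpow field_simps)
      have "min 1 ((norm h)\<^sup>2) / norm h powr (d + 2 * s) \<le> (norm h)\<^sup>2 / norm h powr (d + 2 * s)"
        by (intro divide_right_mono) auto
      also have "\<dots> = (norm h)\<^sup>2 * norm h powr (- (d + 2 * s))"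
        by (simp only: powr_minus_divide) simp
      also have "\<dots> \<le> (2 powr (- real j))\<^sup>2 * (2 powr (- (real j + 1))) powr (- (d + 2 * s))"
        using h1 3 s by (intro mult_mono power_mono powr_mono2') (auto simp: d_def)
      also have "(2 powr (- real j))\<^sup>2 = (2::real) powr (- 2 * real j)"
        by (simp add: power2_eq_square powr_add[symmetric])
      also have "(2 powr (- (real j + 1))) powr (- (d + 2 * s)) = (2::real) powr ((real j + 1) * (d + 2 * s))"
        by (simp only: powr_powr minus_mult_minus)
      finally have "ennreal (min 1 ((norm h)\<^sup>2) / norm h powr (d + 2 * s)) \<le> ennreal (a2 j) * indicator (cball 0 (b2 j)) h"
        using h1(1) by (simp add: b2_def a2_def ennreal_leI)
      also have "\<dots> \<le> (\<Sum>j. ennreal (a2 j) * indicator (cball 0 (b2 j)) h)"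
        by (rule pick)
      finally show ?thesis by (simp add: add_increasing)
    qed simp
  qed
  have pw: "(2 powr t) ^ j = (2::real) powr (t * real j)" for t j
    by (simp add: powr_realpow[symmetric] powr_powr)
  have geo: "(\<Sum>j. ennreal (K * (2 powr (- t)) ^ j)) < \<infinity>" if "t > 0" "K \<ge> 0" for K t
  proof -
    have "(2::real) powr (- t) < 2 powr 0" using that by (intro powr_less_mono) auto
    then have "summable (\<lambda>j. K * (2 powr (- t)) ^ j)" by (intro summable_mult summable_geometric) auto
    then show ?thesis using that by (subst suminf_ennreal2) auto
  qed
  have [measurable]: "(indicator (cball 0 r) :: 'a \<Rightarrow> ennreal) \<in> borel_measurable borel" for r
    by (rule borel_measurable_indicator) simp
  have sums: "(\<integral>\<^sup>+h. (\<Sum>j. ennreal (a j) * indicator (cball 0 (b j)) h) \<partial>(lborel :: 'a measure)) =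
      (\<Sum>j. ennreal (a j) * emeasure lborel (cball (0::'a) (b j)))" for a b :: "nat \<Rightarrow> real"
  proof -
    have "(\<integral>\<^sup>+h. (\<Sum>j. ennreal (a j) * indicator (cball 0 (b j)) h) \<partial>(lborel :: 'a measure)) =
      (\<Sum>j. \<integral>\<^sup>+h. ennreal (a j) * indicator (cball 0 (b j)) h \<partial>(lborel :: 'a measure))"
      by (rule nn_integral_suminf) measurable
    then show ?thesis by (simp add: nn_integral_cmult)
  qed
  have "(\<integral>\<^sup>+h. ennreal (min 1 ((norm h)\<^sup>2) / norm h powr (d + 2 * s)) \<partial>(lborel :: 'a measure)) \<le>
     (\<integral>\<^sup>+h. (\<Sum>j. ennreal (a1 j) * indicator (cball 0 (b1 j)) h) + (\<Sum>j. ennreal (a2 j) * indicator (cball 0 (b2 j)) h) \<partial>(lborel :: 'a measure))"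
    by (intro nn_integral_mono le)
  also have "\<dots> = (\<Sum>j. ennreal (a1 j) * emeasure lborel (cball (0::'a) (b1 j))) + (\<Sum>j. ennreal (a2 j) * emeasure lborel (cball (0::'a) (b2 j)))"
    unfolding sums[symmetric] by (rule nn_integral_add) measurable
  also have "(\<lambda>j. ennreal (a1 j) * emeasure lborel (cball (0::'a) (b1 j))) = (\<lambda>j. ennreal ((2 powr d * c) * (2 powr (- (2 * s))) ^ j))"
  proof
    fix j
    have "a1 j * b1 j powr d = 2 powr d * (2 powr (- (2 * s))) ^ j"
      unfolding a1_def b1_def pw powr_powr powr_add[symmetric]
      by (rule arg_cong[where f = "\<lambda>t. 2 powr t"]) (simp add: algebra_simps)
    then have "a1 j * (c * b1 j powr d) = (2 powr d * c) * (2 powr (- (2 * s))) ^ j" by simp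
    then show "ennreal (a1 j) * emeasure lborel (cball (0::'a) (b1 j)) = ennreal ((2 powr d * c) * (2 powr (- (2 * s))) ^ j)"
      using c b1 a1 by (simp add: vol ennreal_mult[symmetric])
  qed
  also have "(\<lambda>j. ennreal (a2 j) * emeasure lborel (cball (0::'a) (b2 j))) = (\<lambda>j. ennreal ((2 powr (d + 2 * s) * c) * (2 powr (- (2 - 2 * s))) ^ j))"
  proof
    fix j
    have "a2 j * b2 j powr d = 2 powr (d + 2 * s) * (2 powr (- (2 - 2 * s))) ^ j"
      unfolding a2_def b2_def pw powr_powr powr_add[symmetric]
      by (rule arg_cong[where f = "\<lambda>t. 2 powr t"]) (simp add: algebra_simps)
    then have "a2 j * (c * b2 j powr d) = (2 powr (d + 2 * s) * c) * (2 powr (- (2 - 2 * s))) ^ j" by simp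
    then show "ennreal (a2 j) * emeasure lborel (cball (0::'a) (b2 j)) = ennreal ((2 powr (d + 2 * s) * c) * (2 powr (- (2 - 2 * s))) ^ j)"
      using c b2 a2 by (simp add: vol ennreal_mult[symmetric])
  qed
  also have "(\<Sum>j. ennreal ((2 powr d * c) * (2 powr (- (2 * s))) ^ j)) + (\<Sum>j. ennreal ((2 powr (d + 2 * s) * c) * (2 powr (- (2 - 2 * s))) ^ j)) < \<infinity>"
    unfolding infinity_ennreal_def ennreal_add_less_top
    by (intro conjI geo[unfolded infinity_ennreal_def]) (use s c in auto)
  finally show ?thesis by (simp add: d_def)
qed

text \<open>Up to its normalising constant the fractional Laplacian is the same integral without the
  absolute value, so this dominates its modulus. Its finiteness is a separate matter.\<close>

definition frac_env :: "real \<Rightarrow> (real ^ 'n::finite \<Rightarrow> real) \<Rightarrow> real ^ 'n \<Rightarrow> ennreal" where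
  "frac_env s v z = (\<integral>\<^sup>+h. ennreal (\<bar>second_diff v z h\<bar> / norm h powr (real CARD('n) + 2 * s)) \<partial>lborel)"

lemma frac_env_measurable [measurable]:
  fixes v :: "real ^ 'n::finite \<Rightarrow> real"
  assumes [measurable]: "v \<in> borel_measurable borel"
  shows "frac_env s v \<in> borel_measurable borel"
  unfolding frac_env_def[abs_def] second_diff_def by measurable

text \<open>For fixed \<open>h\<close> the second difference is supported in three balls of radius
  \<open>R\<close>, whose volume does not depend on \<open>h\<close>. After Tonelli both bounds
  reduce to the integral of the Levy weight.\<close>

lemma frac_env_finite:
  fixes v :: "real ^ 'n::finite \<Rightarrow> real"
  assumes v: "test_function v" and s: "0 < s" "s < 1"
  obtains C where "0 \<le> C" "\<And>z. frac_env s v z \<le> ennreal C" "(\<integral>\<^sup>+z. frac_env s v z \<partial>lborel) \<le> ennreal C"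
proof -
  let ?p = "real CARD('n) + 2 * s"
  note [measurable] = test_function_measurable[OF v]
  obtain C where C: "C > 0" "\<And>z h. \<bar>second_diff v z h\<bar> \<le> C * min 1 ((norm h)\<^sup>2)" using second_diff_bound[OF v] by blast
  obtain R where R: "R > 0" "\<And>x. R < norm x \<Longrightarrow> v x = 0" using test_function_support[OF v] by metis
  define I where "I = (\<integral>\<^sup>+h. ennreal (min 1 ((norm h)\<^sup>2) / norm h powr ?p) \<partial>(lborel :: (real^'n) measure))"
  have I: "I < \<infinity>" unfolding I_def using levy_integral_finite[OF s, where 'a = "real^'n"] by simp
  define V where "V = emeasure lborel (cball (0::real^'n) R)"
  have V: "V < \<infinity>" unfolding V_def using emeasure_bounded_finite by blast
  have "frac_env s v z \<le> (\<integral>\<^sup>+h. ennreal C * ennreal (min 1 ((norm h)\<^sup>2) / norm h powr ?p) \<partial>(lborel :: (real^'n) measure))" for z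
    unfolding frac_env_def
  proof (intro nn_integral_mono)
    fix h :: "real^'n"
    have "\<bar>second_diff v z h\<bar> / norm h powr ?p \<le> C * min 1 ((norm h)\<^sup>2) / norm h powr ?p"
      by (intro divide_right_mono C) auto
    then show "ennreal (\<bar>second_diff v z h\<bar> / norm h powr ?p) \<le> ennreal C * ennreal (min 1 ((norm h)\<^sup>2) / norm h powr ?p)"
      using C(1) by (simp add: ennreal_mult[symmetric] ennreal_leI)
  qed
  then have 1: "frac_env s v z \<le> ennreal C * I" for z by (simp add: nn_integral_cmult I_def)
  have [measurable]: "(indicator (cball 0 R) :: real^'n \<Rightarrow> ennreal) \<in> borel_measurable borel"
    by (rule borel_measurable_indicator) simp
  \<comment> \<open>\<open>z - (- h)\<close> is written for \<open>z + h\<close> so that one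
    translation lemma serves all three indicators.\<close>
  define S where "S h z = indicator (cball 0 R) z + indicator (cball 0 R) (z - (- h)) + (indicator (cball 0 R) (z - h) :: ennreal)" for h z :: "real^'n"
  have [measurable]: "S h \<in> borel_measurable borel" for h
    unfolding S_def by measurable
  have S: "ennreal \<bar>second_diff v z h\<bar> \<le> ennreal (C * min 1 ((norm h)\<^sup>2)) * S h z" for z h
  proof (cases "norm z \<le> R \<or> norm (z + h) \<le> R \<or> norm (z - h) \<le> R")
    case True
    have le3: "a \<le> a + b + c" "b \<le> a + b + c" "c \<le> a + b + c" for a b c :: ennreal
      by (simp_all add: add.commute add_increasing add.assoc add_increasing2)
    from True consider "z \<in> cball 0 R" | "z - (- h) \<in> cball 0 R" | "z - h \<in> cball 0 R" by auto
    then have "1 \<le> S h z"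
    proof cases
      case 1
      then have "1 = (indicator (cball 0 R) z :: ennreal)" by simp
      also have "\<dots> \<le> S h z" unfolding S_def by (rule le3)
      finally show ?thesis .
    next
      case 2
      then have "1 = (indicator (cball 0 R) (z - (- h)) :: ennreal)" by simp
      also have "\<dots> \<le> S h z" unfolding S_def by (rule le3)
      finally show ?thesis .
    next
      case 3
      then have "1 = (indicator (cball 0 R) (z - h) :: ennreal)" by simp
      also have "\<dots> \<le> S h z" unfolding S_def by (rule le3)
      finally show ?thesis .
    qed
    then have "ennreal (C * min 1 ((norm h)\<^sup>2)) * 1 \<le> ennreal (C * min 1 ((norm h)\<^sup>2)) * S h z" by (rule mult_left_mono) simp
    then show ?thesis using order_trans[OF ennreal_leI[OF C(2)[of z h]]] by simp
  next
    case False
    then have "second_diff v z h = 0" using R by (simp add: second_diff_def not_le)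
    then show ?thesis by simp
  qed
  have Si: "(\<integral>\<^sup>+z. S h z \<partial>lborel) = V + V + V" for h
  proof -
    have "(\<integral>\<^sup>+z. indicator (cball 0 R) (z - a) \<partial>lborel) = V" for a :: "real^'n"
      by (subst nn_integral_lborel_minus[of "indicator (cball 0 R)"]) (measurable, simp add: V_def)
    from this[of "-h"] this[of h] this[of 0] show ?thesis
      unfolding S_def by (subst nn_integral_add; (subst nn_integral_add)?) (simp_all add: algebra_simps)
  qed
  have "(\<integral>\<^sup>+z. frac_env s v z \<partial>lborel) = (\<integral>\<^sup>+h. (\<integral>\<^sup>+z. ennreal (\<bar>second_diff v z h\<bar> / norm h powr ?p) \<partial>lborel) \<partial>lborel)"
    unfolding frac_env_def second_diff_def by (rule lborel_pair.Fubini') measurable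
  also have "\<dots> \<le> (\<integral>\<^sup>+h. ennreal C * (V + V + V) * ennreal (min 1 ((norm h)\<^sup>2) / norm h powr ?p) \<partial>(lborel :: (real^'n) measure))"
  proof (rule nn_integral_mono)
    fix h :: "real^'n"
    let ?q = "ennreal (1 / norm h powr ?p)"
    have "(\<integral>\<^sup>+z. ennreal (\<bar>second_diff v z h\<bar> / norm h powr ?p) \<partial>lborel) = (\<integral>\<^sup>+z. ?q * ennreal \<bar>second_diff v z h\<bar> \<partial>lborel)"
      by (intro nn_integral_cong) (simp add: ennreal_mult[symmetric])
    also have "\<dots> \<le> (\<integral>\<^sup>+z. (?q * ennreal (C * min 1 ((norm h)\<^sup>2))) * S h z \<partial>lborel)"
      unfolding mult.assoc by (intro nn_integral_mono mult_left_mono S) simp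
    also have "\<dots> = ?q * ennreal (C * min 1 ((norm h)\<^sup>2)) * (V + V + V)"
      by (subst nn_integral_cmult) (simp_all only: Si, measurable)
    also have "?q * ennreal (C * min 1 ((norm h)\<^sup>2)) = ennreal C * ennreal (min 1 ((norm h)\<^sup>2) / norm h powr ?p)"
      using C(1) by (simp add: ennreal_mult[symmetric])
    finally show "(\<integral>\<^sup>+z. ennreal (\<bar>second_diff v z h\<bar> / norm h powr ?p) \<partial>lborel) \<le> ennreal C * (V + V + V) * ennreal (min 1 ((norm h)\<^sup>2) / norm h powr ?p)"
      by (simp add: mult_ac)
  qed
  also have "\<dots> = ennreal C * (V + V + V) * I" unfolding I_def by (simp add: nn_integral_cmult)
  finally have 2: "(\<integral>\<^sup>+z. frac_env s v z \<partial>lborel) \<le> ennreal C * (V + V + V) * I" .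
  define K where "K = max (ennreal C * I) (ennreal C * (V + V + V) * I)"
  have "K < top" using I V by (simp add: K_def ennreal_mult_less_top)
  then have K: "ennreal (enn2real K) = K" by (simp add: ennreal_enn2real)
  show ?thesis
    by (rule that[of "enn2real K"], simp, unfold K)
      (unfold K_def, rule order_trans[OF 1 max.cobounded1], rule order_trans[OF 2 max.cobounded2])
qed

text \<open>Under the substitution of \<open>r h\<close> for \<open>h\<close> the weight contributes
  n + 2 s powers of \<open>r\<close> and the volume takes n of them, which leaves the order 2 s of
  the operator.\<close>

lemma frac_env_scale:
  fixes v :: "real ^ 'n::finite \<Rightarrow> real"
  assumes [measurable]: "v \<in> borel_measurable borel" and r: "0 < r" and c: "0 \<le> c"
  shows "frac_env s (\<lambda>y. c * v (r *\<^sub>R (y - x))) y = ennreal (c * r powr (2 * s)) * frac_env s v (r *\<^sub>R (y - x))"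
proof -
  let ?p = "real CARD('n) + 2 * s"
  let ?w = "r *\<^sub>R (y - x)"
  have sd: "second_diff (\<lambda>y. c * v (r *\<^sub>R (y - x))) y h = c * second_diff v ?w (r *\<^sub>R h)" for h
    by (simp add: second_diff_def algebra_simps)
  have "frac_env s (\<lambda>y. c * v (r *\<^sub>R (y - x))) y =
    (\<integral>\<^sup>+h. ennreal (c * r powr (2 * s)) * (ennreal (r ^ DIM(real^'n)) * ennreal (\<bar>second_diff v ?w (r *\<^sub>R h)\<bar> / norm (r *\<^sub>R h) powr ?p)) \<partial>lborel)"
    unfolding frac_env_def sd
  proof (rule nn_integral_cong)
    fix h :: "real^'n"
    have "r powr ?p = r ^ CARD('n) * r powr (2 * s)" using r by (simp add: powr_add powr_realpow)
    then have "\<bar>c * second_diff v ?w (r *\<^sub>R h)\<bar> / norm h powr ?p = (c * r powr (2 * s)) * (r ^ DIM(real^'n) * (\<bar>second_diff v ?w (r *\<^sub>R h)\<bar> / norm (r *\<^sub>R h) powr ?p))"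
      using r c by (simp add: powr_mult abs_mult field_simps)
    then show "ennreal (\<bar>c * second_diff v ?w (r *\<^sub>R h)\<bar> / norm h powr ?p) = ennreal (c * r powr (2 * s)) * (ennreal (r ^ DIM(real^'n)) * ennreal (\<bar>second_diff v ?w (r *\<^sub>R h)\<bar> / norm (r *\<^sub>R h) powr ?p))"
      using r c by (simp add: ennreal_mult[symmetric])
  qed
  also have "\<dots> = ennreal (c * r powr (2 * s)) * frac_env s v ?w"
    unfolding frac_env_def second_diff_def
    by (subst nn_integral_cmult, measurable)
      (subst nn_integral_lborel_scale[of "\<lambda>h. ennreal (\<bar>2 * v ?w - v (?w + h) - v (?w - h)\<bar> / norm h powr ?p)"], measurable, rule r, rule refl)
  finally show ?thesis .
qed

definition nonlocal_form :: "real \<Rightarrow> (real ^ 'n::finite \<Rightarrow> real) \<Rightarrow> (real ^ 'n \<Rightarrow> real) \<Rightarrow> real" where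
  "nonlocal_form s u v = (\<integral>(x, y). (u x - u y) * (v x - v y) / norm (x - y) powr (real CARD('n) + 2 * s) \<partial>lborel)"

text \<open>Summation by parts: of the four products, the two containing \<open>u (x + h)\<close>
  are translated back, which moves the increment from \<open>u\<close> onto
  \<open>v\<close>.\<close>

lemma integral_increment_product:
  fixes u v :: "real ^ 'n::finite \<Rightarrow> real"
  assumes [measurable]: "u \<in> borel_measurable borel" and v: "test_function v"
    and uv: "\<And>\<psi>. test_function \<psi> \<Longrightarrow> integrable lborel (\<lambda>x. u x * \<psi> x)"
  shows "(LBINT x. (u x - u (x + h)) * (v x - v (x + h))) = (LBINT x. u x * second_diff v x h)"
proof -
  note [measurable] = test_function_measurable[OF v]
  have t: "test_function (\<lambda>x. v (x - a))" for a using test_function_affine[OF v, of 1 a] by simp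
  have i0: "integrable lborel (\<lambda>x. u x * v x)" by (rule uv[OF v])
  have i1: "integrable lborel (\<lambda>x. u x * v (x + h))" using uv[OF t[of "-h"]] by simp
  have i2: "integrable lborel (\<lambda>x. u x * v (x - h))" using uv[OF t[of h]] .
  have i3: "integrable lborel (\<lambda>x. u (x + h) * v (x + h))" using integrable_lborel_minus[OF i0, of "-h"] by simp
  have i4: "integrable lborel (\<lambda>x. u (x + h) * v x)" using integrable_lborel_minus[OF i2, of "-h"] by simp
  have e3: "(LBINT x. u (x + h) * v (x + h)) = (LBINT x. u x * v x)"
    using integral_lborel_minus[of "\<lambda>x. u x * v x" "-h"] by simp
  have e4: "(LBINT x. u (x + h) * v x) = (LBINT x. u x * v (x - h))"
    using integral_lborel_minus[of "\<lambda>x. u x * v (x - h)" "-h"] by simp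
  have "(LBINT x. (u x - u (x + h)) * (v x - v (x + h))) =
    (LBINT x. (u x * v x - u x * v (x + h)) + (u (x + h) * v (x + h) - u (x + h) * v x))"
    by (intro Bochner_Integration.integral_cong) (auto simp: algebra_simps)
  also have "\<dots> = (LBINT x. u x * v x) - (LBINT x. u x * v (x + h)) + ((LBINT x. u x * v x) - (LBINT x. u x * v (x - h)))"
    using i0 i1 i3 i4 e3 e4 by simp
  also have "\<dots> = (LBINT x. (u x * v x - u x * v (x + h)) + (u x * v x - u x * v (x - h)))"
    using i0 i1 i2 by simp
  also have "\<dots> = (LBINT x. u x * second_diff v x h)"
    by (intro Bochner_Integration.integral_cong) (auto simp: second_diff_def algebra_simps)
  finally show ?thesis .
qed

text \<open>For a function that is not integrable the left side is 0 by the convention for Bochner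
  integrals.\<close>

lemma abs_integral_le_nn_integral:
  fixes f :: "'a \<Rightarrow> real" shows "ennreal \<bar>\<integral>x. f x \<partial>M\<bar> \<le> (\<integral>\<^sup>+x. ennreal \<bar>f x\<bar> \<partial>M)"
  using integral_norm_bound_ennreal[of M f] by (cases "integrable M f") (auto simp: not_integrable_integral_eq)

text \<open>If the double integral diverges, the Bochner integral is 0 and the bound is trivial.\<close>

lemma nonlocal_form_bound:
  fixes u v :: "real ^ 'n::finite \<Rightarrow> real"
  assumes [measurable]: "u \<in> borel_measurable borel" and v: "test_function v"
    and uv: "\<And>\<psi>. test_function \<psi> \<Longrightarrow> integrable lborel (\<lambda>x. u x * \<psi> x)"
  shows "ennreal \<bar>nonlocal_form s u v\<bar> \<le> (\<integral>\<^sup>+z. ennreal \<bar>u z\<bar> * frac_env s v z \<partial>lborel)"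
proof -
  let ?p = "real CARD('n) + 2 * s"
  note [measurable] = test_function_measurable[OF v]
  define F where "F x y = (u x - u y) * (v x - v y) / norm (x - y) powr ?p" for x y
  \<comment> \<open>With the increment as second variable the singular weight is constant in
    \<open>x\<close>, so for fixed \<open>h\<close> the increment can be moved onto
    \<open>v\<close>.\<close>
  define G where "G x h = (u x - u (x + h)) * (v x - v (x + h)) / norm h powr ?p" for x h
  have FG: "F x y = G x (y - x)" for x y by (simp add: F_def G_def norm_minus_commute)
  have Fm [measurable]: "case_prod F \<in> borel_measurable (borel \<Otimes>\<^sub>M borel)"
    unfolding F_def by measurable
  have Gm [measurable]: "case_prod G \<in> borel_measurable (borel \<Otimes>\<^sub>M borel)"
    unfolding G_def by measurable
  have N: "nonlocal_form s u v = (\<integral>z. case_prod F z \<partial>(lborel \<Otimes>\<^sub>M lborel))"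
    unfolding nonlocal_form_def F_def lborel_prod ..
  show ?thesis
  proof (cases "integrable (lborel \<Otimes>\<^sub>M lborel) (case_prod F)")
    case False
    then show ?thesis unfolding N by (simp add: not_integrable_integral_eq)
  next
    case True
    have "(\<integral>\<^sup>+z. ennreal (norm (case_prod G z)) \<partial>(lborel \<Otimes>\<^sub>M lborel)) = (\<integral>\<^sup>+x. (\<integral>\<^sup>+h. ennreal \<bar>G x h\<bar> \<partial>lborel) \<partial>lborel)"
      by (subst lborel.nn_integral_fst[symmetric]) (auto simp: case_prod_beta)
    also have "\<dots> = (\<integral>\<^sup>+x. (\<integral>\<^sup>+y. ennreal \<bar>F x y\<bar> \<partial>lborel) \<partial>lborel)"
      unfolding FG by (intro nn_integral_cong nn_integral_lborel_minus[symmetric]) measurable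
    also have "\<dots> = (\<integral>\<^sup>+z. ennreal (norm (case_prod F z)) \<partial>(lborel \<Otimes>\<^sub>M lborel))"
      by (subst lborel.nn_integral_fst[symmetric]) (auto simp: case_prod_beta)
    also have "\<dots> < \<infinity>" using True by (simp add: integrable_iff_bounded)
    finally have Gi: "integrable (lborel \<Otimes>\<^sub>M lborel) (case_prod G)" by (intro integrableI_bounded) auto
    have "nonlocal_form s u v = (LBINT x. (LBINT y. F x y))"
      unfolding N using lborel_pair.integral_fst[OF True] by simp
    also have "\<dots> = (LBINT x. (LBINT h. G x h))"
      unfolding FG by (intro Bochner_Integration.integral_cong refl integral_lborel_minus) measurable
    \<comment> \<open>The order is exchanged before any absolute value is taken: the cancellation
      inside the inner integral is what produces second differences.\<close>
    also have "\<dots> = (LBINT h. (LBINT x. G x h))"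
      using lborel_pair.Fubini_integral[OF Gi] by simp
    also have "\<dots> = (LBINT h. (LBINT x. u x * second_diff v x h) / norm h powr ?p)"
      unfolding G_def by (simp add: integral_increment_product[OF _ v uv])
    finally have eq: "nonlocal_form s u v = (LBINT h. (LBINT x. u x * second_diff v x h) / norm h powr ?p)" .
    have "ennreal \<bar>nonlocal_form s u v\<bar> \<le> (\<integral>\<^sup>+h. ennreal \<bar>(LBINT x. u x * second_diff v x h) / norm h powr ?p\<bar> \<partial>lborel)"
      unfolding eq by (rule abs_integral_le_nn_integral)
    also have "\<dots> \<le> (\<integral>\<^sup>+h. (\<integral>\<^sup>+x. ennreal \<bar>u x\<bar> * ennreal (\<bar>second_diff v x h\<bar> / norm h powr ?p) \<partial>lborel) \<partial>lborel)"
    proof (rule nn_integral_mono)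
      fix h :: "real^'n"
      have "\<bar>(LBINT x. u x * second_diff v x h) / norm h powr ?p\<bar> = \<bar>LBINT x. u x * second_diff v x h / norm h powr ?p\<bar>"
        by simp
      also have "ennreal \<dots> \<le> (\<integral>\<^sup>+x. ennreal \<bar>u x * second_diff v x h / norm h powr ?p\<bar> \<partial>lborel)"
        by (rule abs_integral_le_nn_integral)
      also have "\<dots> = (\<integral>\<^sup>+x. ennreal \<bar>u x\<bar> * ennreal (\<bar>second_diff v x h\<bar> / norm h powr ?p) \<partial>lborel)"
        by (intro nn_integral_cong) (simp add: abs_mult ennreal_mult[symmetric])
      finally show "ennreal \<bar>(LBINT x. u x * second_diff v x h) / norm h powr ?p\<bar> \<le> \<dots>" .
    qed
    also have "\<dots> = (\<integral>\<^sup>+x. (\<integral>\<^sup>+h. ennreal \<bar>u x\<bar> * ennreal (\<bar>second_diff v x h\<bar> / norm h powr ?p) \<partial>lborel) \<partial>lborel)"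
      unfolding second_diff_def by (rule lborel_pair.Fubini') measurable
    also have "\<dots> = (\<integral>\<^sup>+z. ennreal \<bar>u z\<bar> * frac_env s v z \<partial>lborel)"
      unfolding frac_env_def second_diff_def by (intro nn_integral_cong nn_integral_cmult) measurable
    finally show ?thesis .
  qed
qed

section \<open>Weak gradients\<close>

text \<open>Solutions are only Lebesgue measurable, while Fubini and translations are used for
  \<open>lborel\<close>. All integrals of the equation are moved to Borel versions by this
  lemma.\<close>

lemma lebesgue_integral_borel_version:
  fixes f f' :: "'a::euclidean_space \<Rightarrow> real"
  assumes f': "f' \<in> borel_measurable borel" and ae: "AE x in lborel. f x = f' x"
  shows "(\<integral>x. f x \<partial>lebesgue) = (LBINT x. f' x)"
    and "integrable lebesgue f \<longleftrightarrow> integrable lborel f'"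
proof -
  have m': "f' \<in> borel_measurable lebesgue" using f' by (simp add: measurable_completion)
  have ae': "AE x in lebesgue. f' x = f x" using AE_completion[OF ae] by eventually_elim simp
  have m: "f \<in> borel_measurable lebesgue" using borel_measurable_AE[OF m' ae'] .
  show "(\<integral>x. f x \<partial>lebesgue) = (LBINT x. f' x)"
    using integral_cong_AE[OF m' m ae'] integral_completion[of f' lborel] f' by simp
  show "integrable lebesgue f \<longleftrightarrow> integrable lborel f'"
    using integrable_cong_AE[OF m' m ae'] integrable_completion[of f' lborel] f' by simp
qed

lemma locally_integrable_mult_test:
  fixes h :: "real ^ 'n::finite \<Rightarrow> real"
  assumes [measurable]: "h \<in> borel_measurable borel"
    and loc: "locally_integrable h"
    and \<phi>: "test_function \<phi>"
  shows "integrable lborel (\<lambda>x. h x * \<phi> x)"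
proof -
  note [measurable] = test_function_measurable[OF \<phi>]
  obtain R where R: "\<And>x. R < norm x \<Longrightarrow> \<phi> x = 0" using test_function_support[OF \<phi>] by metis
  obtain B where B: "B > 0" "\<And>x. \<bar>\<phi> x\<bar> \<le> B" using test_function_bounded[OF \<phi>] by blast
  obtain m :: nat where m: "R < real m" using reals_Archimedean2 by blast
  show ?thesis
  proof (rule Bochner_Integration.integrable_bound[OF integrable_mult_left[OF loc[unfolded locally_integrable_def, rule_format, of m], of B]])
    show "AE x in lborel. norm (h x * \<phi> x) \<le> norm (indicator (cball 0 (real m)) x * h x * B)"
    proof (rule AE_I2)
      fix x
      show "norm (h x * \<phi> x) \<le> norm (indicator (cball 0 (real m)) x * h x * B)"
      proof (cases "norm x \<le> real m")
        case True
        then show ?thesis using B by (simp add: abs_mult mult_left_mono)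
      qed (use R m in auto)
    qed
  qed measurable
qed

text \<open>Rescaled mollifiers are themselves test functions, so every mollification of
  \<open>h\<close> is 0, and these converge to \<open>h\<close> almost everywhere along
  subsequences.\<close>

lemma du_bois_reymond:
  fixes h :: "real ^ 'n::finite \<Rightarrow> real"
  assumes h [measurable]: "h \<in> borel_measurable borel"
    and loc: "locally_integrable h"
    and zero: "\<And>\<phi>. test_function \<phi> \<Longrightarrow> (LBINT x. h x * \<phi> x) = 0"
  shows "AE x in lborel. h x = 0"
proof -
  obtain \<rho> :: "real^'n \<Rightarrow> real" where \<rho>: "test_function \<rho>" "\<And>x. 0 \<le> \<rho> x" "(LBINT x. \<rho> x) = 1"
    using ex_mollifier_pair by metis
  obtain R where R: "\<And>x. R < norm x \<Longrightarrow> \<rho> x = 0" using test_function_support[OF \<rho>(1)] by metis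
  obtain B where B: "B > 0" "\<And>x. \<bar>\<rho> x\<bar> \<le> B" using test_function_bounded[OF \<rho>(1)] by blast
  interpret mollifier \<rho> R B
    by unfold_locales
      (use \<rho> R B test_function_measurable[OF \<rho>(1)] test_function_integrable[OF \<rho>(1)] in \<open>auto simp: abs_le_iff\<close>)
  have "conv k h x = 0" for k x
    unfolding conv_def scaled_def
    by (intro zero test_function_cmult test_function_affine \<rho>) simp
  then show ?thesis using conv_AE_subseq[OF h loc] by (auto simp: LIMSEQ_const_iff)
qed

lemma borel_version_vec:
  fixes g :: "'a::euclidean_space \<Rightarrow> real ^ 'n::finite"
  assumes "g \<in> borel_measurable lebesgue"
  shows "\<exists>g'\<in>borel_measurable borel. AE x in lborel. g x = g' x"
proof -
  have "\<forall>i. \<exists>g'\<in>borel_measurable lborel. (AE x in lborel. g x $ i = g' x)"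
  proof
    fix i
    have "(\<lambda>x. g x $ i) = (\<lambda>x. g x \<bullet> axis i 1)" by (simp add: inner_axis)
    then have "(\<lambda>x. g x $ i) \<in> borel_measurable lebesgue" using assms by simp
    from completion_ex_borel_measurable_real[OF this]
    show "\<exists>g'\<in>borel_measurable lborel. (AE x in lborel. g x $ i = g' x)" .
  qed
  then have "\<exists>G. \<forall>i. G i \<in> borel_measurable lborel \<and> (AE x in lborel. g x $ i = G i x)" by (intro choice) blast
  then obtain G where G: "\<And>i. G i \<in> borel_measurable lborel" "\<And>i. AE x in lborel. g x $ i = G i x" by blast
  define g' where "g' x = (\<chi> i. G i x)" for x
  have "g' \<in> borel_measurable borel"
    unfolding borel_measurable_euclidean_space[of g'] Basis_vec_def using G(1) by (auto simp: g'_def inner_axis)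
  moreover have "AE x in lborel. \<forall>i\<in>UNIV. g x $ i = G i x"
    by (subst AE_finite_all) (use G(2) in auto)
  then have "AE x in lborel. g x = g' x" by eventually_elim (simp add: g'_def vec_eq_iff)
  ultimately show ?thesis by blast
qed

lemma vec_nth_borel_measurable:
  assumes "g \<in> borel_measurable M" shows "(\<lambda>x. g x $ i :: real) \<in> borel_measurable M"
proof -
  have "(\<lambda>x. g x $ i) = (\<lambda>x. g x \<bullet> axis i 1)" by (simp add: inner_axis)
  then show ?thesis using assms by simp
qed

lemma locally_integrable_borel_version:
  fixes g :: "'a::euclidean_space \<Rightarrow> real ^ 'n::finite"
  assumes "\<And>K. compact K \<Longrightarrow> g absolutely_integrable_on K"
  obtains g' where "g' \<in> borel_measurable borel" "AE x in lborel. g x = g' x"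
    "\<And>i. locally_integrable (\<lambda>x. g' x $ i)"
proof -
  have i: "integrable lebesgue (\<lambda>x. indicator (cball 0 (real m)) x *\<^sub>R g x)" for m
    using assms[of "cball 0 (real m)"] by (simp add: set_integrable_def)
  \<comment> \<open>Integrability on compact sets yields measurability of the truncations;
    \<open>g\<close> is their pointwise limit.\<close>
  have "(\<lambda>m. indicator (cball 0 (real m)) x *\<^sub>R g x) \<longlonglongrightarrow> g x" for x
  proof (rule tendsto_eventually)
    obtain m0 :: nat where "norm x < real m0" using reals_Archimedean2 by blast
    then show "\<forall>\<^sub>F m in sequentially. indicator (cball 0 (real m)) x *\<^sub>R g x = g x"
      unfolding eventually_sequentially by (intro exI[of _ m0]) auto
  qed
  then have "g \<in> borel_measurable lebesgue"
    by (rule borel_measurable_LIMSEQ_metric[OF borel_measurable_integrable[OF i]])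
  then obtain g' where g' [measurable]: "g' \<in> borel_measurable borel" and ae: "AE x in lborel. g x = g' x"
    using borel_version_vec by blast
  have "integrable lborel (\<lambda>x. indicator (cball 0 (real m)) x * g' x $ j)" for m j
  proof (subst lebesgue_integral_borel_version(2)[symmetric])
    show "(\<lambda>x. indicator (cball 0 (real m)) x * g' x $ j) \<in> borel_measurable borel"
      by (intro borel_measurable_times borel_measurable_indicator vec_nth_borel_measurable g') simp
    show "AE x in lborel. (indicator (cball 0 (real m)) x *\<^sub>R g x) $ j = indicator (cball 0 (real m)) x * g' x $ j"
      using ae by eventually_elim simp
    show "integrable lebesgue (\<lambda>x. (indicator (cball 0 (real m)) x *\<^sub>R g x) $ j)"
      by (rule integrable_bounded_linear[OF bounded_linear_vec_nth i])
  qed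
  then show ?thesis using that g' ae unfolding locally_integrable_def by blast
qed

text \<open>\<open>weak_gradient\<close> is an arbitrary choice. Uniqueness lets the
  square-integrable gradient supplied by \<open>H1\<close>, or the classical gradient of a test
  function, stand for it.\<close>

lemma weak_gradient_unique:
  fixes u :: "real ^ 'n::finite \<Rightarrow> real"
  assumes "has_weak_gradient u g" "has_weak_gradient u h"
  shows "AE x in lborel. g x = h x"
proof -
  obtain g' where g' [measurable]: "g' \<in> borel_measurable borel" "AE x in lborel. g x = g' x"
    "\<And>i. locally_integrable (\<lambda>x. g' x $ i)"
    using locally_integrable_borel_version[of g] assms(1) unfolding has_weak_gradient_def by blast
  obtain h' where h' [measurable]: "h' \<in> borel_measurable borel" "AE x in lborel. h x = h' x"
    "\<And>i. locally_integrable (\<lambda>x. h' x $ i)"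
    using locally_integrable_borel_version[of h] assms(2) unfolding has_weak_gradient_def by blast
  note [measurable] = vec_nth_borel_measurable
  have "AE x in lborel. g' x $ i - h' x $ i = 0" for i
  proof (rule du_bois_reymond)
    show "locally_integrable (\<lambda>x. g' x $ i - h' x $ i)"
      using g'(3) h'(3) by (simp add: locally_integrable_def right_diff_distrib)
    fix \<phi> :: "real^'n \<Rightarrow> real" assume \<phi>: "test_function \<phi>"
    note [measurable] = test_function_measurable[OF \<phi>]
    have ig: "integrable lborel (\<lambda>x. g' x $ i * \<phi> x)"
      by (rule locally_integrable_mult_test[OF _ g'(3) \<phi>]) measurable
    have ih: "integrable lborel (\<lambda>x. h' x $ i * \<phi> x)"
      by (rule locally_integrable_mult_test[OF _ h'(3) \<phi>]) measurable
    have "AE x in lborel. g x $ i * \<phi> x = g' x $ i * \<phi> x" using g'(2) by eventually_elim simp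
    then have "(\<integral>x. g x $ i * \<phi> x \<partial>lebesgue) = (LBINT x. g' x $ i * \<phi> x)"
      by (intro lebesgue_integral_borel_version) measurable
    moreover have "AE x in lborel. h x $ i * \<phi> x = h' x $ i * \<phi> x" using h'(2) by eventually_elim simp
    then have "(\<integral>x. h x $ i * \<phi> x \<partial>lebesgue) = (LBINT x. h' x $ i * \<phi> x)"
      by (intro lebesgue_integral_borel_version) measurable
    moreover have "(\<integral>x. u x * partial i \<phi> x \<partial>lebesgue) = - (\<integral>x. g x $ i * \<phi> x \<partial>lebesgue)"
      "(\<integral>x. u x * partial i \<phi> x \<partial>lebesgue) = - (\<integral>x. h x $ i * \<phi> x \<partial>lebesgue)"
      using assms \<phi> unfolding has_weak_gradient_def by blast+
    then have "(\<integral>x. g x $ i * \<phi> x \<partial>lebesgue) = (\<integral>x. h x $ i * \<phi> x \<partial>lebesgue)" by linarith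
    ultimately show "(LBINT x. (g' x $ i - h' x $ i) * \<phi> x) = 0"
      using ig ih by (simp add: left_diff_distrib)
  qed measurable
  then have "AE x in lborel. \<forall>i\<in>UNIV. g' x $ i - h' x $ i = 0" by (subst AE_finite_all) auto
  with g'(2) h'(2) show ?thesis by eventually_elim (simp add: vec_eq_iff)
qed

section \<open>Test functions as elements of H^1\<close>

lemma test_function_mult:
  assumes "test_function f" "test_function g" shows "test_function (\<lambda>x. f x * g x)"
proof -
  obtain R where R: "\<And>x. R < norm x \<Longrightarrow> f x = 0" using test_function_support[OF assms(1)] by metis
  show ?thesis
    by (rule test_functionI[of _ R], rule C_k_mult) (use assms test_function_C_k R in auto)
qed

text \<open>Difference quotients have integral 0 by translation invariance. The Lipschitz bound and
  the compact support give a common majorant for the limit.\<close>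

lemma integral_partial_test:
  fixes f :: "real ^ 'n::finite \<Rightarrow> real"
  assumes f: "test_function f"
  shows "(LBINT x. partial i f x) = 0"
proof -
  note [measurable] = test_function_measurable[OF f]
  note [measurable] = test_function_measurable[OF test_function_partial[OF f]]
  obtain R where R: "R > 0" "\<And>x. R < norm x \<Longrightarrow> f x = 0" using test_function_support[OF f] by metis
  obtain L where L: "L > 0" "\<And>x y. \<bar>f x - f y\<bar> \<le> L * norm (x - y)" using test_function_lipschitz[OF f] by blast
  \<comment> \<open>Steps of size at most 1 keep the supports of all quotients in the ball of radius
    \<open>R + 1\<close>.\<close>
  define t where "t m = inverse (real (Suc m))" for m
  have t: "0 < t m" "t m \<le> 1" for m by (auto simp: t_def inverse_eq_divide)
  define q where "q m x = (f (x + t m *\<^sub>R axis i 1) - f x) / t m" for m x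
  have q0: "(LBINT x. q m x) = 0" for m
  proof -
    have "integrable lborel (\<lambda>x. f (x + t m *\<^sub>R axis i 1))"
      using integrable_lborel_minus[OF test_function_integrable[OF f], of "- (t m *\<^sub>R axis i 1)"] by simp
    moreover have "(LBINT x. f (x + t m *\<^sub>R axis i 1)) = (LBINT x. f x)"
      using integral_lborel_minus[of f "- (t m *\<^sub>R axis i 1)"] by simp
    ultimately show ?thesis using test_function_integrable[OF f] by (simp add: q_def)
  qed
  have "(\<lambda>m. LBINT x. q m x) \<longlonglongrightarrow> (LBINT x. partial i f x)"
  proof (rule integral_dominated_convergence[where w = "\<lambda>x. L * indicator (cball 0 (R + 1)) x"])
    show "integrable lborel (\<lambda>x. L * indicator (cball (0::real^'n) (R + 1)) x)"
      by (intro integrable_mult_right integrable_indicator_cball)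
    show "AE x in lborel. (\<lambda>m. q m x) \<longlonglongrightarrow> partial i f x"
    proof (rule AE_I2)
      fix x
      have "((\<lambda>s. f (x + s *\<^sub>R axis i 1)) has_derivative (\<lambda>s. grad f (x + 0 *\<^sub>R axis i 1) \<bullet> (s *\<^sub>R axis i 1))) (at 0)"
        by (rule has_derivative_compose[OF _ test_function_has_derivative[OF f]]) (auto intro!: derivative_eq_intros)
      then have "((\<lambda>s. f (x + s *\<^sub>R axis i 1)) has_real_derivative partial i f x) (at 0)"
        unfolding has_field_derivative_def by (rule has_derivative_eq_rhs) (auto simp: grad_def inner_axis)
      then have d: "(\<lambda>h. (f (x + (0 + h) *\<^sub>R axis i 1) - f (x + 0 *\<^sub>R axis i 1)) / h) \<midarrow>0\<rightarrow> partial i f x"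
        unfolding DERIV_def .
      have t0: "t \<longlonglongrightarrow> 0" unfolding t_def by (rule LIMSEQ_inverse_real_of_nat)
      have "filterlim t (at 0) sequentially"
        unfolding filterlim_at using t0 t(1) by (auto simp: less_imp_neq[THEN not_sym])
      from filterlim_compose[OF d this] show "(\<lambda>m. q m x) \<longlonglongrightarrow> partial i f x" by (simp add: q_def)
    qed
    show "AE x in lborel. norm (q m x) \<le> L * indicator (cball 0 (R + 1)) x" for m
    proof (rule AE_I2)
      fix x
      show "norm (q m x) \<le> L * indicator (cball 0 (R + 1)) x"
      proof (cases "norm x \<le> R + 1")
        case True
        have "\<bar>f (x + t m *\<^sub>R axis i 1) - f x\<bar> \<le> L * t m"
          using L(2)[of "x + t m *\<^sub>R axis i 1" x] t(1)[of m] by (simp add: norm_axis_1)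
        then show ?thesis using True t(1)[of m] by (simp add: q_def field_simps)
      next
        case False
        have "norm x \<le> norm (x + t m *\<^sub>R axis i 1) + norm (t m *\<^sub>R axis i (1::real))"
          using norm_triangle_ineq4[of "x + t m *\<^sub>R axis i 1" "t m *\<^sub>R axis i 1"] by simp
        then have "R < norm (x + t m *\<^sub>R axis i 1)" using False t[of m] by (simp add: norm_axis_1)
        then show ?thesis using R False by (simp add: q_def)
      qed
    qed
  qed (auto simp: q_def[abs_def])
  then show ?thesis unfolding q0 by (simp add: LIMSEQ_const_iff)
qed

lemma integral_by_parts_test:
  fixes f g :: "real ^ 'n::finite \<Rightarrow> real"
  assumes f: "test_function f" and g: "test_function g"
  shows "(LBINT x. f x * partial i g x) = - (LBINT x. partial i f x * g x)"
proof -
  have p: "partial i (\<lambda>x. f x * g x) x = f x * partial i g x + partial i f x * g x" for x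
    using partial_eqI[OF has_derivative_mult[OF test_function_has_derivative[OF f] test_function_has_derivative[OF g]]]
    by (simp add: grad_def inner_axis)
  have "integrable lborel (\<lambda>x. f x * partial i g x)" "integrable lborel (\<lambda>x. partial i f x * g x)"
    by (intro test_function_integrable test_function_mult f g test_function_partial)+
  then show ?thesis
    using integral_partial_test[OF test_function_mult[OF f g], of i] unfolding p by simp
qed

lemma grad_continuous: "test_function v \<Longrightarrow> continuous_on A (grad v)"
  unfolding grad_def[abs_def]
  by (intro continuous_on_vec_lambda test_function_continuous test_function_partial)

lemma grad_measurable: "test_function v \<Longrightarrow> grad v \<in> borel_measurable borel"
  using grad_continuous borel_measurable_continuous_onI by blast

lemma grad_integrable:
  fixes v :: "real ^ 'n::finite \<Rightarrow> real"
  assumes v: "test_function v" shows "integrable lborel (grad v)"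
proof -
  obtain R where R: "R > 0" "\<And>x. R < norm x \<Longrightarrow> v x = 0" using test_function_support[OF v] by metis
  have "integrable lborel (\<lambda>x. indicator (cball 0 R) x *\<^sub>R grad v x)"
    by (rule borel_integrable_compact) (auto intro: grad_continuous v)
  also have "(\<lambda>x. indicator (cball 0 R) x *\<^sub>R grad v x) = grad v"
    using partial_zero_outside[OF R(2)] by (fastforce simp: indicator_def grad_def vec_eq_iff)
  finally show ?thesis .
qed

lemma test_has_weak_gradient:
  fixes v :: "real ^ 'n::finite \<Rightarrow> real"
  assumes v: "test_function v" shows "has_weak_gradient v (grad v)"
  unfolding has_weak_gradient_def
proof (intro conjI allI impI)
  fix K :: "(real^'n) set" assume "compact K"
  then have K: "K \<in> sets lebesgue" by (simp add: borel_compact)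
  have "integrable lebesgue v" "integrable lebesgue (grad v)"
    using test_function_integrable[OF v] grad_integrable[OF v] by (auto simp: integrable_completion)
  then show "v absolutely_integrable_on K" "grad v absolutely_integrable_on K"
    unfolding set_integrable_def using integrable_mult_indicator[OF K] by blast+
next
  fix \<phi> :: "real^'n \<Rightarrow> real" and i assume \<phi>: "test_function \<phi>"
  note [measurable] = test_function_measurable[OF \<phi>] test_function_measurable[OF v]
    test_function_measurable[OF test_function_partial[OF \<phi>]] test_function_measurable[OF test_function_partial[OF v]]
  show "(\<integral>x. v x * partial i \<phi> x \<partial>lebesgue) = - (\<integral>x. grad v x $ i * \<phi> x \<partial>lebesgue)"
    using integral_by_parts_test[OF v \<phi>, of i] by (simp add: integral_completion grad_def)
qed

lemma test_in_H1:
  fixes v :: "real ^ 'n::finite \<Rightarrow> real"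
  assumes v: "test_function v" shows "v \<in> H1"
proof -
  have "integrable lborel (\<lambda>x. (norm (v x))\<^sup>2)"
    using test_function_integrable[OF test_function_mult[OF v v]] by (simp add: power2_eq_square)
  moreover have "integrable lborel (\<lambda>x. (norm (grad v x))\<^sup>2)"
    unfolding power2_norm_eq_inner inner_vec_def grad_def
    by (rule Bochner_Integration.integrable_sum)
      (auto intro!: test_function_integrable test_function_mult test_function_partial v)
  ultimately show ?thesis
    using test_has_weak_gradient[OF v] test_function_measurable[OF v] grad_measurable[OF v]
    by (auto simp: H1_def L2_def integrable_completion measurable_completion)
qed

lemma integrable_L2_mult_test:
  fixes f :: "real ^ 'n::finite \<Rightarrow> real"
  assumes [measurable]: "f \<in> borel_measurable borel" and f: "integrable lborel (\<lambda>x. (f x)\<^sup>2)" and \<phi>: "test_function \<phi>"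
  shows "integrable lborel (\<lambda>x. f x * \<phi> x)"
proof (rule Bochner_Integration.integrable_bound)
  show "integrable lborel (\<lambda>x. (f x)\<^sup>2 + \<phi> x * \<phi> x)"
    by (intro Bochner_Integration.integrable_add f test_function_integrable test_function_mult \<phi>)
  have "norm (f x * \<phi> x) \<le> norm ((f x)\<^sup>2 + \<phi> x * \<phi> x)" for x
  proof -
    have "0 \<le> (\<bar>f x\<bar> - \<bar>\<phi> x\<bar>)\<^sup>2 + (f x)\<^sup>2 + (\<phi> x)\<^sup>2" by simp
    then have "2 * (\<bar>f x\<bar> * \<bar>\<phi> x\<bar>) \<le> 2 * ((f x)\<^sup>2 + (\<phi> x)\<^sup>2)" by (simp add: power2_diff)
    then show ?thesis by (simp add: abs_mult power2_eq_square)
  qed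
  then show "AE x in lborel. norm (f x * \<phi> x) \<le> norm ((f x)\<^sup>2 + \<phi> x * \<phi> x)" by simp
qed (use test_function_measurable[OF \<phi>] in measurable)

section \<open>Borel versions of solutions\<close>

lemma AE_lborel_pair:
  assumes "AE x in (lborel :: 'a::euclidean_space measure). P x"
  shows "AE z in (lborel :: ('a \<times> 'a) measure). P (fst z) \<and> P (snd z)"
proof -
  obtain N where N: "{x \<in> space (lborel :: 'a measure). \<not> P x} \<subseteq> N" "N \<in> null_sets lborel"
    using AE_E[OF assms] by (metis null_setsI)
  have [measurable]: "N \<in> sets borel" using N by auto
  have "AE z in (lborel \<Otimes>\<^sub>M lborel). fst z \<notin> N \<and> snd z \<notin> N"
  proof (rule lborel_pair.AE_pair_measure)
    show "AE x in lborel. AE y in lborel. fst (x, y) \<notin> N \<and> snd (x, y) \<notin> N"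
      using AE_not_in[OF N(2)] by eventually_elim (use AE_not_in[OF N(2)] in simp)
  qed measurable
  then have "AE z in (lborel :: ('a \<times> 'a) measure). fst z \<notin> N \<and> snd z \<notin> N" unfolding lborel_prod .
  then show ?thesis by eventually_elim (use N in auto)
qed

lemma Lp_bound_2I:
  assumes f: "f \<in> borel_measurable borel" "\<And>x. 0 \<le> f x" "integrable lborel (\<lambda>x. (f x)\<^sup>2)" "(LBINT x. (f x)\<^sup>2) \<le> N"
  shows "Lp_bound 2 N f"
proof -
  have e: "f x powr 2 = (f x)\<^sup>2" for x using f(2)[of x] by (cases "f x = 0") auto
  show ?thesis
    unfolding Lp_bound_def e using f by (auto simp: nn_integral_eq_integral ennreal_leI)
qed

lemma weak_gradient_works: "u \<in> H1 \<Longrightarrow> has_weak_gradient u (weak_gradient u)"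
  unfolding H1_def weak_gradient_def using someI_ex[of "has_weak_gradient u"] by blast

lemma H1_borel_version:
  fixes u :: "real ^ 'n::finite \<Rightarrow> real"
  assumes u: "u \<in> H1" and M: "H1_norm u = M"
  obtains u' g' where "u' \<in> borel_measurable borel" "g' \<in> borel_measurable borel"
    "AE x in lborel. u x = u' x" "AE x in lborel. weak_gradient u x = g' x"
    "integrable lborel (\<lambda>x. (u' x)\<^sup>2)" "integrable lborel (\<lambda>x. (norm (g' x))\<^sup>2)"
    "Lp_bound 2 (M\<^sup>2) (\<lambda>x. \<bar>u' x\<bar>)" "Lp_bound 2 (M\<^sup>2) (\<lambda>x. norm (g' x))"
proof -
  obtain g where g: "has_weak_gradient u g" "g \<in> L2" and uL: "u \<in> L2" using u by (auto simp: H1_def)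
  obtain u' where u' [measurable]: "u' \<in> borel_measurable borel" "AE x in lborel. u x = u' x"
    using completion_ex_borel_measurable_real[of u lborel] uL by (auto simp: L2_def)
  obtain g' where g' [measurable]: "g' \<in> borel_measurable borel" "AE x in lborel. g x = g' x"
    using borel_version_vec[of g] g(2) by (auto simp: L2_def)
  \<comment> \<open>The chosen gradient agrees almost everywhere with the square-integrable one, so
    the norm in \<open>H1_norm\<close> is that of \<open>g'\<close>.\<close>
  have wg: "AE x in lborel. weak_gradient u x = g' x"
    using weak_gradient_unique[OF weak_gradient_works[OF u] g(1)] g'(2) by eventually_elim simp
  have eu: "AE x in lborel. (norm (u x))\<^sup>2 = (u' x)\<^sup>2" using u'(2) by eventually_elim simp
  have eg: "AE x in lborel. (norm (g x))\<^sup>2 = (norm (g' x))\<^sup>2" using g'(2) by eventually_elim simp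
  have ewg: "AE x in lborel. (norm (weak_gradient u x))\<^sup>2 = (norm (g' x))\<^sup>2" using wg by eventually_elim simp
  have iu: "integrable lborel (\<lambda>x. (u' x)\<^sup>2)"
    using lebesgue_integral_borel_version(2)[OF _ eu] uL by (simp add: L2_def)
  have ig: "integrable lborel (\<lambda>x. (norm (g' x))\<^sup>2)"
    using lebesgue_integral_borel_version(2)[OF _ eg] g(2) by (simp add: L2_def)
  have nu: "L2_norm u = sqrt (LBINT x. (u' x)\<^sup>2)"
    unfolding L2_norm_def using lebesgue_integral_borel_version(1)[OF _ eu] by simp
  have ng: "L2_norm (weak_gradient u) = sqrt (LBINT x. (norm (g' x))\<^sup>2)"
    unfolding L2_norm_def using lebesgue_integral_borel_version(1)[OF _ ewg] by simp
  have le: "a \<le> M\<^sup>2" if "0 \<le> a" "sqrt a \<le> M" for a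
    using that real_sqrt_le_iff[of a "M\<^sup>2"] real_sqrt_ge_zero[of a] by (simp add: real_le_lsqrt sqrt_le_D)
  have p: "0 \<le> (LBINT x. (u' x)\<^sup>2)" "0 \<le> (LBINT x. (norm (g' x))\<^sup>2)"
    by (intro integral_nonneg_AE; simp)+
  have s: "0 \<le> L2_norm u" "0 \<le> L2_norm (weak_gradient u)" unfolding nu ng using p by simp_all
  have bu: "(LBINT x. (u' x)\<^sup>2) \<le> M\<^sup>2" and bg: "(LBINT x. (norm (g' x))\<^sup>2) \<le> M\<^sup>2"
    by (rule le[OF p(1)], use M s nu in \<open>simp add: H1_norm_def\<close>, rule le[OF p(2)], use M s ng in \<open>simp add: H1_norm_def\<close>)
  show ?thesis
  proof (rule that)
    show "Lp_bound 2 (M\<^sup>2) (\<lambda>x. \<bar>u' x\<bar>)" by (rule Lp_bound_2I) (use iu bu in auto)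
    show "Lp_bound 2 (M\<^sup>2) (\<lambda>x. norm (g' x))" by (rule Lp_bound_2I) (use ig bg in auto)
  qed (use u' g' wg iu ig in auto)
qed

text \<open>Everything that the estimates need from a solution, tested with test functions only. The
  identity with \<open>lap v\<close> is the definition of the weak gradient, applied to the partial
  derivatives of \<open>v\<close> and summed.\<close>

definition borel_solution :: "real \<Rightarrow> real \<Rightarrow> real \<Rightarrow> (real ^ 'n::finite \<Rightarrow> real) \<Rightarrow> (real ^ 'n \<Rightarrow> real ^ 'n) \<Rightarrow> bool" where
  "borel_solution s p M u g \<longleftrightarrow> u \<in> borel_measurable borel \<and> integrable lborel (\<lambda>x. (u x)\<^sup>2) \<and>
     Lp_bound 2 (M\<^sup>2) (\<lambda>x. \<bar>u x\<bar>) \<and> Lp_bound 2 (M\<^sup>2) (\<lambda>x. norm (g x)) \<and>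
     (\<forall>v. test_function v \<longrightarrow> integrable lborel (\<lambda>x. g x \<bullet> grad v x) \<and>
        (LBINT x. u x * lap v x) = - (LBINT x. g x \<bullet> grad v x) \<and>
        (LBINT x. u x * v x) + (LBINT x. g x \<bullet> grad v x) + nonlocal_form s u v
          = (LBINT x. \<bar>u x\<bar> powr (p - 1) * u x * v x))"

lemma weak_solution_borel_version:
  fixes u :: "real ^ 'n::finite \<Rightarrow> real"
  assumes ws: "weak_solution s p u" and M: "H1_norm u = M"
  obtains u' g' where "borel_solution s p M u' g'" "AE x in lborel. u x = u' x"
proof -
  have u: "u \<in> H1" using ws by (simp add: weak_solution_def)
  obtain u' g' where u' [measurable]: "u' \<in> borel_measurable borel" and g' [measurable]: "g' \<in> borel_measurable borel"
    and ae: "AE x in lborel. u x = u' x" "AE x in lborel. weak_gradient u x = g' x"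
    and i: "integrable lborel (\<lambda>x. (u' x)\<^sup>2)" "integrable lborel (\<lambda>x. (norm (g' x))\<^sup>2)"
    and b: "Lp_bound 2 (M\<^sup>2) (\<lambda>x. \<bar>u' x\<bar>)" "Lp_bound 2 (M\<^sup>2) (\<lambda>x. norm (g' x))"
    by (rule H1_borel_version[OF u M])
  note [measurable] = vec_nth_borel_measurable
  have gi: "integrable lborel (\<lambda>x. (g' x $ j)\<^sup>2)" for j
  proof (rule Bochner_Integration.integrable_bound[OF i(2)])
    show "AE x in lborel. norm ((g' x $ j)\<^sup>2) \<le> norm ((norm (g' x))\<^sup>2)"
      using component_le_norm_cart by (auto simp: power2_le_iff_abs_le)
  qed measurable
  have iu: "integrable lborel (\<lambda>x. u' x * \<phi> x)" if "test_function \<phi>" for \<phi>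
    by (rule integrable_L2_mult_test[OF u' i(1) that])
  have ig: "integrable lborel (\<lambda>x. g' x $ j * \<phi> x)" if "test_function \<phi>" for \<phi> j
    by (rule integrable_L2_mult_test[OF _ gi that]) measurable
  have inner: "g' x \<bullet> grad v x = (\<Sum>j\<in>UNIV. g' x $ j * partial j v x)" for v x
    by (simp add: inner_vec_def grad_def)
  have igv: "integrable lborel (\<lambda>x. g' x \<bullet> grad v x)" if "test_function v" for v
    unfolding inner by (intro Bochner_Integration.integrable_sum ig test_function_partial that)
  have 1: "(LBINT x. u' x * lap v x) = - (LBINT x. g' x \<bullet> grad v x)" if v: "test_function v" for v
  proof -
    have e: "(LBINT x. u' x * partial j (partial j v) x) = - (LBINT x. g' x $ j * partial j v x)" for j
    proof -
      note [measurable] = test_function_measurable[OF test_function_partial[OF v]]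
        test_function_measurable[OF test_function_partial[OF test_function_partial[OF v]]]
      have "AE x in lborel. u x * partial j (partial j v) x = u' x * partial j (partial j v) x"
        using ae(1) by eventually_elim simp
      then have "(\<integral>x. u x * partial j (partial j v) x \<partial>lebesgue) = (LBINT x. u' x * partial j (partial j v) x)"
        by (intro lebesgue_integral_borel_version) measurable
      moreover have "AE x in lborel. weak_gradient u x $ j * partial j v x = g' x $ j * partial j v x"
        using ae(2) by eventually_elim simp
      then have "(\<integral>x. weak_gradient u x $ j * partial j v x \<partial>lebesgue) = (LBINT x. g' x $ j * partial j v x)"
        by (intro lebesgue_integral_borel_version) measurable
      moreover have "(\<integral>x. u x * partial j (partial j v) x \<partial>lebesgue) = - (\<integral>x. weak_gradient u x $ j * partial j v x \<partial>lebesgue)"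
        using weak_gradient_works[OF u] test_function_partial[OF v] unfolding has_weak_gradient_def by blast
      ultimately show ?thesis by simp
    qed
    have "(LBINT x. u' x * lap v x) = (\<Sum>j\<in>UNIV. LBINT x. u' x * partial j (partial j v) x)"
      unfolding lap_def sum_distrib_left by (intro Bochner_Integration.integral_sum iu test_function_partial v)
    also have "\<dots> = - (\<Sum>j\<in>UNIV. LBINT x. g' x $ j * partial j v x)" unfolding e by (simp add: sum_negf)
    also have "(\<Sum>j\<in>UNIV. LBINT x. g' x $ j * partial j v x) = (LBINT x. g' x \<bullet> grad v x)"
      unfolding inner by (intro Bochner_Integration.integral_sum[symmetric] ig test_function_partial v)
    finally show ?thesis .
  qed
  have 2: "(LBINT x. u' x * v x) + (LBINT x. g' x \<bullet> grad v x) + nonlocal_form s u' v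
       = (LBINT x. \<bar>u' x\<bar> powr (p - 1) * u' x * v x)" if v: "test_function v" for v
  proof -
    note [measurable] = test_function_measurable[OF v] grad_measurable[OF v]
    have vg: "AE x in lborel. weak_gradient v x = grad v x"
      by (rule weak_gradient_unique[OF weak_gradient_works[OF test_in_H1[OF v]] test_has_weak_gradient[OF v]])
    have "AE x in lborel. u x * v x + weak_gradient u x \<bullet> weak_gradient v x = u' x * v x + g' x \<bullet> grad v x"
      using ae vg by eventually_elim simp
    then have a: "(\<integral>x. u x * v x + weak_gradient u x \<bullet> weak_gradient v x \<partial>lebesgue) = (LBINT x. u' x * v x + g' x \<bullet> grad v x)"
      by (intro lebesgue_integral_borel_version) measurable
    \<comment> \<open>The double integral sees \<open>u\<close> at both coordinates, so both must
      avoid the exceptional null set.\<close>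
    have "AE z in (lborel :: ((real^'n) \<times> (real^'n)) measure).
      (case z of (x, y) \<Rightarrow> (u x - u y) * (v x - v y) / norm (x - y) powr (real CARD('n) + 2 * s)) =
      (case z of (x, y) \<Rightarrow> (u' x - u' y) * (v x - v y) / norm (x - y) powr (real CARD('n) + 2 * s))"
      using AE_lborel_pair[OF ae(1)] by eventually_elim auto
    then have c: "(\<integral>(x, y). (u x - u y) * (v x - v y) / norm (x - y) powr (real CARD('n) + 2 * s)
              \<partial>(lebesgue :: ((real ^ 'n) \<times> (real ^ 'n)) measure)) = nonlocal_form s u' v"
      unfolding nonlocal_form_def
      by (intro lebesgue_integral_borel_version) (simp only: borel_prod[symmetric], measurable)
    have "AE x in lborel. \<bar>u x\<bar> powr (p - 1) * u x * v x = \<bar>u' x\<bar> powr (p - 1) * u' x * v x"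
      using ae(1) by eventually_elim simp
    then have d: "(\<integral>x. \<bar>u x\<bar> powr (p - 1) * u x * v x \<partial>lebesgue) = (LBINT x. \<bar>u' x\<bar> powr (p - 1) * u' x * v x)"
      by (intro lebesgue_integral_borel_version) measurable
    have "(LBINT x. u' x * v x + g' x \<bullet> grad v x) = (LBINT x. u' x * v x) + (LBINT x. g' x \<bullet> grad v x)"
      by (intro Bochner_Integration.integral_add iu igv v)
    moreover have "(\<integral>x. u x * v x + weak_gradient u x \<bullet> weak_gradient v x \<partial>lebesgue)
        + (\<integral>(x, y). (u x - u y) * (v x - v y) / norm (x - y) powr (real CARD('n) + 2 * s)
              \<partial>(lebesgue :: ((real ^ 'n) \<times> (real ^ 'n)) measure))
        = (\<integral>x. \<bar>u x\<bar> powr (p - 1) * u x * v x \<partial>lebesgue)"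
      using ws test_in_H1[OF v] unfolding weak_solution_def by blast
    ultimately show ?thesis unfolding a c d by simp
  qed
  show ?thesis
    by (rule that[of u' g', OF _ ae(1)], unfold borel_solution_def) (intro conjI allI impI u' i(1) b igv 1 2)
qed

section \<open>Dyadic estimates for solutions\<close>

text \<open>One envelope dominates everything that a solution is averaged against. The terms
  \<bar>\<gamma>\<bar> and \<open>frac_env\<close> are bounded together because the linear and the
  nonlocal part of the equation are estimated together. No solution is mentioned, so constants built
  from these parameters are uniform.\<close>

locale dyadic = env: envelope \<Lambda> A B + moll: mollifier \<rho> R Bm
  for \<Lambda> \<rho> :: "real ^ 'n::finite \<Rightarrow> real" and A B R Bm :: real +
  fixes \<gamma> :: "real ^ 'n \<Rightarrow> real" and s :: real
  assumes s: "0 < s" "s < 1"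
    and \<rho>_test: "test_function \<rho>" and \<gamma>_test: "test_function \<gamma>"
    and \<gamma>_lap: "lap \<gamma> x = \<rho> x - 2 ^ CARD('n) * \<rho> (2 *\<^sub>R x)"
    and env_\<rho>: "\<rho> z \<le> \<Lambda> z" and env_grad: "norm (grad \<gamma> z) \<le> \<Lambda> z"
    and env_frac: "ennreal \<bar>\<gamma> z\<bar> + frac_env s \<gamma> z \<le> ennreal (\<Lambda> z)"
begin

text \<open>The factor \<open>(1 / 4) ^ k\<close> cancels the 4^k that two derivatives of the
  dilation produce, so the Laplacian is normalised like the mollifier.\<close>

definition bump :: "nat \<Rightarrow> real ^ 'n \<Rightarrow> real ^ 'n \<Rightarrow> real" where
  "bump k x y = (2 ^ k) ^ CARD('n) * (1 / 4) ^ k * \<gamma> (2 ^ k *\<^sub>R (y - x))"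

lemma test_bump: "test_function (bump k x)"
  unfolding bump_def[abs_def] by (intro test_function_cmult test_function_affine \<gamma>_test) simp

lemma partial_bump:
  assumes "test_function f"
  shows "partial i (\<lambda>y. c * f (2 ^ k *\<^sub>R (y - x))) = (\<lambda>y. (c * 2 ^ k) * partial i f (2 ^ k *\<^sub>R (y - x)))"
proof -
  have "test_function (\<lambda>y. f (2 ^ k *\<^sub>R (y - x)))" by (rule test_function_affine[OF assms]) simp
  from partial_cmult[OF test_function_C_k[OF this, of "Suc 0"], of i c] show ?thesis
    unfolding partial_affine[OF test_function_C_k[OF assms, of "Suc 0"]] by (simp only: mult.assoc)
qed

lemma grad_bump: "norm (grad (bump k x) y) = (2 ^ k) ^ CARD('n) * (1 / 2) ^ k * norm (grad \<gamma> (2 ^ k *\<^sub>R (y - x)))"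
proof -
  have "grad (bump k x) y = ((2 ^ k) ^ CARD('n) * (1 / 4) ^ k * 2 ^ k) *\<^sub>R grad \<gamma> (2 ^ k *\<^sub>R (y - x))"
    unfolding grad_def bump_def[abs_def] partial_bump[OF \<gamma>_test] by (simp add: vec_eq_iff)
  moreover have "(1 / 4) ^ k * 2 ^ k = (1 / 2 :: real) ^ k" by (simp flip: power_mult_distrib)
  ultimately show ?thesis by (simp add: mult.assoc)
qed

lemma lap_bump: "lap (bump k x) y = moll.scaled k (y - x) - moll.scaled (Suc k) (y - x)"
proof -
  have "lap (bump k x) y = (2 ^ k) ^ CARD('n) * ((1 / 4) ^ k * 2 ^ k * 2 ^ k) * lap \<gamma> (2 ^ k *\<^sub>R (y - x))"
    unfolding lap_def bump_def[abs_def] partial_bump[OF \<gamma>_test] partial_bump[OF test_function_partial[OF \<gamma>_test]]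
    by (simp add: sum_distrib_left mult_ac)
  also have "(1 / 4) ^ k * 2 ^ k * 2 ^ k = (1 :: real)" by (simp flip: power_mult_distrib)
  also have "(2 ^ k) ^ CARD('n) * 1 * lap \<gamma> (2 ^ k *\<^sub>R (y - x)) = moll.scaled k (y - x) - moll.scaled (Suc k) (y - x)"
    unfolding \<gamma>_lap moll.scaled_def by (simp add: right_diff_distrib power_mult_distrib mult_ac)
  finally show ?thesis .
qed

lemma test_scaled: "test_function (\<lambda>y. moll.scaled k (y - x))"
  unfolding moll.scaled_def by (intro test_function_cmult test_function_affine \<rho>_test) simp

context
  fixes p M :: real and u :: "real ^ 'n \<Rightarrow> real" and g :: "real ^ 'n \<Rightarrow> real ^ 'n"
  assumes sol: "borel_solution s p M u g"
begin

lemma u_measurable: "u \<in> borel_measurable borel"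
  and u_L2: "integrable lborel (\<lambda>x. (u x)\<^sup>2)"
  and u_bound: "Lp_bound 2 (M\<^sup>2) (\<lambda>x. \<bar>u x\<bar>)"
  and g_bound: "Lp_bound 2 (M\<^sup>2) (\<lambda>x. norm (g x))"
  using sol by (auto simp: borel_solution_def)

lemma u_test: "test_function v \<Longrightarrow> integrable lborel (\<lambda>x. u x * v x)"
  by (rule integrable_L2_mult_test[OF u_measurable u_L2])

lemma conv_diff: "moll.conv (Suc k) u x - moll.conv k u x = (LBINT y. g y \<bullet> grad (bump k x) y)"
proof -
  have "moll.conv (Suc k) u x - moll.conv k u x = - (LBINT y. u y * lap (bump k x) y)"
    unfolding moll.conv_def lap_bump using u_test[OF test_scaled] by (simp add: right_diff_distrib)
  then show ?thesis using sol test_bump[of k x] by (simp add: borel_solution_def)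
qed

lemma conv_zero: "\<bar>moll.conv 0 u x\<bar> \<le> env.conv 0 (\<lambda>y. \<bar>u y\<bar>) x"
proof -
  have "\<bar>moll.conv 0 u x\<bar> \<le> (LBINT y. \<bar>u y * moll.scaled 0 (y - x)\<bar>)"
    unfolding moll.conv_def by (rule integral_abs_bound)
  also have "\<dots> \<le> env.conv 0 (\<lambda>y. \<bar>u y\<bar>) x"
    unfolding env.conv_def
  proof (rule integral_mono)
    show "integrable lborel (\<lambda>y. \<bar>u y\<bar> * env.scaled 0 (y - x))"
      by (rule env.conv_integrable[OF _ _ u_bound]) auto
    show "integrable lborel (\<lambda>y. \<bar>u y * moll.scaled 0 (y - x)\<bar>)" using u_test[OF test_scaled] by simp
    show "\<bar>u y * moll.scaled 0 (y - x)\<bar> \<le> \<bar>u y\<bar> * env.scaled 0 (y - x)" for y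
      unfolding abs_mult moll.scaled_def env.scaled_def using env_\<rho> moll.moll_nonneg by (auto intro!: mult_left_mono)
  qed
  finally show ?thesis .
qed

lemma conv_diff_gradient:
  "\<bar>moll.conv (Suc k) u x - moll.conv k u x\<bar> \<le> 2 powr (- 1 * real k) * env.conv k (\<lambda>y. norm (g y)) x"
proof -
  have i: "integrable lborel (\<lambda>y. norm (g y) * env.scaled k (y - x))"
    by (rule env.conv_integrable[OF _ _ g_bound]) auto
  have h: "(1 / 2 :: real) ^ k = 2 powr (- 1 * real k)" by (simp add: powr_minus powr_realpow power_divide inverse_eq_divide)
  have "\<bar>moll.conv (Suc k) u x - moll.conv k u x\<bar> \<le> (LBINT y. \<bar>g y \<bullet> grad (bump k x) y\<bar>)"
    unfolding conv_diff by (rule integral_abs_bound)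
  also have "\<dots> \<le> (LBINT y. (1 / 2) ^ k * (norm (g y) * env.scaled k (y - x)))"
  proof (rule integral_mono)
    show "integrable lborel (\<lambda>y. \<bar>g y \<bullet> grad (bump k x) y\<bar>)" using sol test_bump by (simp add: borel_solution_def)
    show "integrable lborel (\<lambda>y. (1 / 2) ^ k * (norm (g y) * env.scaled k (y - x)))" using i by simp
    fix y
    have "\<bar>g y \<bullet> grad (bump k x) y\<bar> \<le> norm (g y) * norm (grad (bump k x) y)" by (rule Cauchy_Schwarz_ineq2)
    also have "\<dots> \<le> norm (g y) * ((2 ^ k) ^ CARD('n) * (1 / 2) ^ k * \<Lambda> (2 ^ k *\<^sub>R (y - x)))"
      unfolding grad_bump by (intro mult_left_mono env_grad) auto
    finally show "\<bar>g y \<bullet> grad (bump k x) y\<bar> \<le> (1 / 2) ^ k * (norm (g y) * env.scaled k (y - x))"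
      by (simp add: env.scaled_def mult_ac)
  qed
  finally show ?thesis unfolding env.conv_def h by simp
qed

lemma env_\<gamma>: "\<bar>\<gamma> z\<bar> \<le> \<Lambda> z"
proof -
  have "ennreal \<bar>\<gamma> z\<bar> \<le> ennreal \<bar>\<gamma> z\<bar> + frac_env s \<gamma> z" by (simp add: add_increasing2)
  also have "\<dots> \<le> ennreal (\<Lambda> z)" by (rule env_frac)
  finally show ?thesis using env.env_nonneg by (simp add: ennreal_le_iff)
qed

text \<open>The nonlinear term gains two derivatives, the linear and nonlocal terms together gain \<open>2 - 2 s\<close>.\<close>

lemma conv_diff_equation:
  assumes a: "1 \<le> a" "0 \<le> N" "Lp_bound a N (\<lambda>y. \<bar>u y\<bar> powr p)"
  shows "\<bar>moll.conv (Suc k) u x - moll.conv k u x\<bar> \<le>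
     2 powr (- 2 * real k) * env.conv k (\<lambda>y. \<bar>u y\<bar> powr p) x + 2 powr (- (2 - 2 * s) * real k) * env.conv k (\<lambda>y. \<bar>u y\<bar>) x"
proof -
  note [measurable] = u_measurable test_function_measurable[OF test_bump] test_function_measurable[OF \<gamma>_test]
  let ?v = "bump k x"
  let ?c = "(2 ^ k) ^ CARD('n) * (1 / 4 :: real) ^ k"
  have i1: "integrable lborel (\<lambda>y. \<bar>u y\<bar> powr p * env.scaled k (y - x))" by (rule env.conv_integrable[OF a])
  have i2: "integrable lborel (\<lambda>y. \<bar>u y\<bar> * env.scaled k (y - x))" by (rule env.conv_integrable[OF _ _ u_bound]) auto
  have q: "(1 / 4 :: real) ^ k = 2 powr (- 2 * real k)"
  proof -
    have "(2::real) powr (- 2 * real k) = (2 powr (-2)) powr real k" by (simp only: powr_powr)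
    also have "(2::real) powr (-2) = 1 / 4" by (simp add: powr_minus)
    finally show ?thesis by (simp add: powr_realpow)
  qed
  have vle: "\<bar>?v y\<bar> \<le> (1 / 4) ^ k * env.scaled k (y - x)" for y
    using env_\<gamma>[of "2 ^ k *\<^sub>R (y - x)"] by (simp add: bump_def env.scaled_def abs_mult mult_ac mult_left_mono)
  define I1 I2 where "I1 = (LBINT y. \<bar>u y\<bar> powr (p - 1) * u y * ?v y)" and "I2 = (LBINT y. u y * ?v y)"
  have "(LBINT y. g y \<bullet> grad ?v y) = I1 - I2 - nonlocal_form s u ?v"
    using sol test_bump[of k x] by (auto simp: borel_solution_def I1_def I2_def)
  then have d: "\<bar>moll.conv (Suc k) u x - moll.conv k u x\<bar> \<le> \<bar>I1\<bar> + (\<bar>I2\<bar> + \<bar>nonlocal_form s u ?v\<bar>)"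
    unfolding conv_diff by linarith
  have "ennreal \<bar>I1\<bar> \<le> (\<integral>\<^sup>+y. ennreal \<bar>\<bar>u y\<bar> powr (p - 1) * u y * ?v y\<bar> \<partial>lborel)"
    unfolding I1_def by (rule abs_integral_le_nn_integral)
  also have "\<dots> \<le> (\<integral>\<^sup>+y. ennreal ((1 / 4) ^ k * (\<bar>u y\<bar> powr p * env.scaled k (y - x))) \<partial>lborel)"
  proof (intro nn_integral_mono ennreal_leI)
    fix y
    have "\<bar>\<bar>u y\<bar> powr (p - 1) * u y\<bar> = \<bar>u y\<bar> powr p"
      by (cases "u y = 0") (auto simp: abs_mult powr_diff)
    then have "\<bar>\<bar>u y\<bar> powr (p - 1) * u y * ?v y\<bar> = \<bar>u y\<bar> powr p * \<bar>?v y\<bar>" by (simp add: abs_mult)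
    also have "\<dots> \<le> \<bar>u y\<bar> powr p * ((1 / 4) ^ k * env.scaled k (y - x))" by (intro mult_left_mono vle) simp
    finally show "\<bar>\<bar>u y\<bar> powr (p - 1) * u y * ?v y\<bar> \<le> (1 / 4) ^ k * (\<bar>u y\<bar> powr p * env.scaled k (y - x))" by (simp add: mult_ac)
  qed
  also have "\<dots> = ennreal ((1 / 4) ^ k * env.conv k (\<lambda>y. \<bar>u y\<bar> powr p) x)"
    unfolding env.conv_def using i1 env.scaled_facts by (subst nn_integral_eq_integral) auto
  finally have 1: "\<bar>I1\<bar> \<le> 2 powr (- 2 * real k) * env.conv k (\<lambda>y. \<bar>u y\<bar> powr p) x"
    using env.conv_nonneg[OF a] by (simp add: q ennreal_le_iff)
  have vf: "ennreal \<bar>?v y\<bar> + frac_env s ?v y \<le> ennreal (2 powr (- (2 - 2 * s) * real k) * env.scaled k (y - x))" for y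
  proof -
    let ?z = "2 ^ k *\<^sub>R (y - x)"
    let ?t = "(2 ^ k) powr (2 * s) :: real"
    \<comment> \<open>The linear term on its own would gain two derivatives; it is weakened by the
      factor \<open>?t\<close> so that it can share the envelope with the nonlocal term.\<close>
    have t: "1 \<le> ?t" using s by (intro ge_one_powr_ge_zero) auto
    have "frac_env s ?v y = ennreal (?c * ?t) * frac_env s \<gamma> ?z"
      unfolding bump_def[abs_def] by (rule frac_env_scale) auto
    moreover have "ennreal \<bar>?v y\<bar> \<le> ennreal (?c * ?t) * ennreal \<bar>\<gamma> ?z\<bar>"
      using t mult_right_mono[OF t, of "?c * \<bar>\<gamma> ?z\<bar>"]
      by (simp add: bump_def abs_mult ennreal_mult[symmetric] mult_ac ennreal_leI)
    ultimately have "ennreal \<bar>?v y\<bar> + frac_env s ?v y \<le> ennreal (?c * ?t) * (ennreal \<bar>\<gamma> ?z\<bar> + frac_env s \<gamma> ?z)"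
      by (simp add: distrib_left add_mono)
    also have "\<dots> \<le> ennreal (?c * ?t) * ennreal (\<Lambda> ?z)" by (intro mult_left_mono env_frac) simp
    also have "\<dots> = ennreal ((1 / 4) ^ k * ?t * env.scaled k (y - x))"
      using env.env_nonneg by (simp add: ennreal_mult[symmetric] env.scaled_def mult_ac)
    also have "(1 / 4) ^ k * ?t = 2 powr (- (2 - 2 * s) * real k)"
    proof -
      have "?t = 2 powr (real k * (2 * s))" by (simp add: powr_realpow[symmetric] powr_powr)
      then show ?thesis unfolding q by (simp add: powr_add[symmetric] algebra_simps)
    qed
    finally show ?thesis .
  qed
  have "ennreal (\<bar>I2\<bar> + \<bar>nonlocal_form s u ?v\<bar>) = ennreal \<bar>I2\<bar> + ennreal \<bar>nonlocal_form s u ?v\<bar>" by simp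
  also have "\<dots> \<le> (\<integral>\<^sup>+y. ennreal \<bar>u y * ?v y\<bar> \<partial>lborel) + (\<integral>\<^sup>+y. ennreal \<bar>u y\<bar> * frac_env s ?v y \<partial>lborel)"
    unfolding I2_def
    by (intro add_mono abs_integral_le_nn_integral nonlocal_form_bound u_measurable test_bump u_test)
  also have "\<dots> = (\<integral>\<^sup>+y. ennreal \<bar>u y\<bar> * (ennreal \<bar>?v y\<bar> + frac_env s ?v y) \<partial>lborel)"
    by (subst nn_integral_add[symmetric]) (auto simp: abs_mult ennreal_mult distrib_left)
  also have "\<dots> \<le> (\<integral>\<^sup>+y. ennreal \<bar>u y\<bar> * ennreal (2 powr (- (2 - 2 * s) * real k) * env.scaled k (y - x)) \<partial>lborel)"
    by (intro nn_integral_mono mult_left_mono vf) simp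
  also have "\<dots> = (\<integral>\<^sup>+y. ennreal (2 powr (- (2 - 2 * s) * real k) * (\<bar>u y\<bar> * env.scaled k (y - x))) \<partial>lborel)"
    using env.scaled_facts by (intro nn_integral_cong) (simp add: ennreal_mult[symmetric] mult_ac)
  also have "\<dots> = ennreal (2 powr (- (2 - 2 * s) * real k) * env.conv k (\<lambda>y. \<bar>u y\<bar>) x)"
    unfolding env.conv_def using i2 env.scaled_facts by (subst nn_integral_eq_integral) auto
  finally have e: "ennreal (\<bar>I2\<bar> + \<bar>nonlocal_form s u ?v\<bar>) \<le> ennreal (2 powr (- (2 - 2 * s) * real k) * env.conv k (\<lambda>y. \<bar>u y\<bar>) x)" .
  have 2: "\<bar>I2\<bar> + \<bar>nonlocal_form s u ?v\<bar> \<le> 2 powr (- (2 - 2 * s) * real k) * env.conv k (\<lambda>y. \<bar>u y\<bar>) x"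
    by (rule ennreal_le_iff[THEN iffD1, OF _ e]) (use env.conv_nonneg[OF _ _ u_bound] in simp)
  from d 1 2 show ?thesis by linarith
qed

lemma u_AE_subseq: "AE x in lborel. \<exists>r. strict_mono r \<and> (\<lambda>k. moll.conv (r k) u x) \<longlonglongrightarrow> u x"
proof (rule moll.conv_AE_subseq[OF u_measurable], unfold locally_integrable_def, rule allI)
  fix m :: nat
  note [measurable] = u_measurable borel_measurable_integrable[OF integrable_indicator_cball]
  show "integrable lborel (\<lambda>x. indicator (cball 0 (real m)) x * u x)"
  proof (rule Bochner_Integration.integrable_bound[OF Bochner_Integration.integrable_add[OF integrable_indicator_cball u_L2]])
    have t: "\<bar>t\<bar> \<le> 1 + t\<^sup>2" for t :: real
    proof (cases "\<bar>t\<bar> \<le> 1")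
      case False
      then have "\<bar>t\<bar> * 1 \<le> \<bar>t\<bar> * \<bar>t\<bar>" by (intro mult_left_mono) auto
      then show ?thesis by (simp add: power2_eq_square)
    qed (auto intro: add_increasing2)
    show "AE x in lborel. norm (indicator (cball 0 (real m)) x * u x) \<le> norm (indicator (cball 0 (real m)) x + (u x)\<^sup>2)"
      by (rule AE_I2, rename_tac x, case_tac "x \<in> cball 0 (real m)") (use t in \<open>auto simp: abs_of_nonneg\<close>)
  qed measurable
qed

end

end

text \<open>The first condition on \<open>q\<close> is what the gradient can reach, the second what
  makes the equation improve. For n > 2 the former means that \<open>q\<close> lies below c = 2 n /
  (n - 2), and the lower bound n (p - 1) / 2 required by the latter is below \<open>c\<close>
  exactly for subcritical \<open>p\<close>. For n = 2 every large \<open>q\<close> serves.\<close>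

lemma subcritical_exponent:
  fixes n p :: real
  assumes "2 \<le> n" "1 < p" "2 < n \<Longrightarrow> p < (n + 2) / (n - 2)"
  shows "\<exists>q\<ge>2. p \<le> q \<and> n * (1 / 2 - 1 / q) < 1 \<and> n * ((p - 1) / q) < 2"
proof -
  define L where "L = max 2 (max p (n * (p - 1) / 2))"
  have L: "2 \<le> L" "p \<le> L" "n * (p - 1) / 2 \<le> L" by (auto simp: L_def)
  have "\<exists>q>L. n * (1 / 2 - 1 / q) < 1"
  proof (cases "n = 2")
    case True
    then show ?thesis using L by (intro exI[of _ "L + 1"]) auto
  next
    case False
    then have n: "n > 2" using assms by simp
    define c where "c = 2 * n / (n - 2)"
    have "p < (n + 2) / (n - 2)" using assms(3) n .
    then have p: "p * (n - 2) < n + 2" using n by (simp add: field_simps)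
    have "p * (n - 2) < 2 * n" using p n by linarith
    then have "p < c" using n by (simp add: c_def field_simps)
    moreover have "2 < c" using n by (simp add: c_def field_simps)
    moreover have "n * (p - 1) / 2 < c"
    proof -
      have "(p - 1) * (n - 2) < 4" using p by (simp add: algebra_simps)
      then have "n * ((p - 1) * (n - 2)) < n * 4" using n by (intro mult_strict_left_mono) auto
      then show ?thesis using n by (simp add: c_def field_simps)
    qed
    ultimately have "L < c" by (simp add: L_def)
    then obtain q where q: "L < q" "q < c" using dense by blast
    have "1 / c < 1 / q" using q L by (intro divide_strict_left_mono) auto
    moreover have "n * (1 / 2 - 1 / c) = 1" using n by (simp add: c_def field_simps)
    ultimately have "n * (1 / 2 - 1 / q) < 1" using n by (smt (verit) mult_strict_left_mono)
    with q show ?thesis by blast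
  qed
  then obtain q where q: "L < q" "n * (1 / 2 - 1 / q) < 1" by blast
  have "n * ((p - 1) / q) < 2" using q L by (simp add: field_simps)
  with q L show ?thesis by (intro exI[of _ q]) auto
qed

section \<open>The exponent iteration, uniform over a class of solutions\<close>

context dyadic
begin

definition solutions :: "real \<Rightarrow> real \<Rightarrow> (real ^ 'n \<Rightarrow> real) set" where
  "solutions p M = {u. \<exists>g. borel_solution s p M u g}"

text \<open>Both increment slots of \<open>decomposable\<close> are filled with the gradient
  estimate; the second copy adds only a nonnegative term.\<close>

lemma sobolev_bound:
  assumes "2 \<le> q" "real CARD('n) * (1 / 2 - 1 / q) < 1"
  shows "\<exists>D\<ge>0. \<forall>u\<in>solutions p M. Lp_bound q D (\<lambda>x. \<bar>u x\<bar>)"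
proof -
  have "\<exists>D\<ge>0. \<forall>u. env.decomposable 2 (M\<^sup>2) 2 (M\<^sup>2) 1 2 (M\<^sup>2) 1 u \<longrightarrow> Lp_bound q D (\<lambda>x. \<bar>u x\<bar>)"
    by (rule env.bootstrap_Lp) (use assms in auto)
  then obtain D where D: "0 \<le> D" "\<And>u. env.decomposable 2 (M\<^sup>2) 2 (M\<^sup>2) 1 2 (M\<^sup>2) 1 u \<Longrightarrow> Lp_bound q D (\<lambda>x. \<bar>u x\<bar>)"
    by blast
  show ?thesis
  proof (intro exI[of _ D] conjI D ballI)
    fix u assume "u \<in> solutions p M"
    then obtain g where sol: "borel_solution s p M u g" by (auto simp: solutions_def)
    have "\<bar>moll.conv (Suc k) u x - moll.conv k u x\<bar> \<le>
        2 powr (- 1 * real k) * env.conv k (\<lambda>y. norm (g y)) x + 2 powr (- 1 * real k) * env.conv k (\<lambda>y. norm (g y)) x" for k x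
    proof -
      have "0 \<le> env.conv k (\<lambda>y. norm (g y)) x" by (rule env.conv_nonneg[OF _ _ g_bound[OF sol]]) auto
      then show ?thesis using conv_diff_gradient[OF sol, of k x] by (simp add: add_increasing)
    qed
    then show "env.decomposable 2 (M\<^sup>2) 2 (M\<^sup>2) 1 2 (M\<^sup>2) 1 u"
      unfolding env.decomposable_def
      by (intro conjI u_measurable[OF sol] exI[of _ "\<lambda>k. moll.conv k u"] exI[of _ "\<lambda>y. \<bar>u y\<bar>"] exI[of _ "\<lambda>y. norm (g y)"]
          u_AE_subseq[OF sol] u_bound[OF sol] g_bound[OF sol] allI conv_zero[OF sol])
  qed
qed

text \<open>The bound stays \<open>N\<close> because \<open>Lp_bound\<close> controls the integral
  of the power.\<close>

lemma Lp_bound_powr: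
  assumes "1 < p" "Lp_bound q N (\<lambda>x. \<bar>u x\<bar>)"
  shows "Lp_bound (q / p) N (\<lambda>x. \<bar>u x\<bar> powr p)"
  using assms unfolding Lp_bound_def by (auto simp: powr_powr)

text \<open>The last two hypotheses are the gain conditions for \<bar>u\<bar>^p in L^(q / p), with
  gain 2, and for \<open>u\<close> in L^q, with gain \<open>2 - 2 * s\<close>. The condition
  \<open>p \<le> q\<close> keeps \<open>q / p\<close> at least 1, as Jensen requires.\<close>

lemma bootstrap_step:
  assumes "1 < p" "p \<le> q" "q \<le> Q" "0 \<le> N"
    and "real CARD('n) * (p / q - 1 / Q) < 2" "real CARD('n) * (1 / q - 1 / Q) < 2 - 2 * s"
  shows "\<exists>D\<ge>0. \<forall>u\<in>solutions p M. Lp_bound q N (\<lambda>x. \<bar>u x\<bar>) \<longrightarrow> Lp_bound Q D (\<lambda>x. \<bar>u x\<bar>)"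
proof -
  have qp: "1 \<le> q / p" using assms by simp
  have "q / p \<le> q / 1" using assms by (intro divide_left_mono) auto
  then have qp': "q / p \<le> Q" using assms by simp
  have "\<exists>D\<ge>0. \<forall>u. env.decomposable q N (q / p) N 2 q N (2 - 2 * s) u \<longrightarrow> Lp_bound Q D (\<lambda>x. \<bar>u x\<bar>)"
    by (rule env.bootstrap_Lp) (use assms qp qp' in auto)
  then obtain D where D: "0 \<le> D" "\<And>u. env.decomposable q N (q / p) N 2 q N (2 - 2 * s) u \<Longrightarrow> Lp_bound Q D (\<lambda>x. \<bar>u x\<bar>)"
    by blast
  show ?thesis
  proof (intro exI[of _ D] conjI D ballI impI)
    fix u assume "u \<in> solutions p M" and b: "Lp_bound q N (\<lambda>x. \<bar>u x\<bar>)"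
    then obtain g where sol: "borel_solution s p M u g" by (auto simp: solutions_def)
    note b' = Lp_bound_powr[OF assms(1) b]
    show "env.decomposable q N (q / p) N 2 q N (2 - 2 * s) u"
      unfolding env.decomposable_def
      by (intro conjI u_measurable[OF sol] exI[of _ "\<lambda>k. moll.conv k u"] exI[of _ "\<lambda>y. \<bar>u y\<bar>"] exI[of _ "\<lambda>y. \<bar>u y\<bar> powr p"]
          u_AE_subseq[OF sol] b b' allI conv_zero[OF sol] conv_diff_equation[OF sol qp assms(4) b'])
  qed
qed

text \<open>In terms of the reciprocal exponent t = 1 / q a step is a subtraction: passing from
  \<open>t\<close> to \<open>t - \<eta>\<close> needs (p - 1) t + \<eta> < 2 / n and n \<eta> < 2 -
  2 s. A single \<eta> serves all steps, so finitely many of them suffice.\<close>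

lemma bootstrap:
  assumes n: "2 \<le> CARD('n)" and p: "1 < p"
    and sub: "2 < CARD('n) \<Longrightarrow> p < (real CARD('n) + 2) / (real CARD('n) - 2)"
  shows "\<exists>q D. p \<le> q \<and> 0 \<le> D \<and> real CARD('n) * (p / q) < 2 \<and> real CARD('n) * (1 / q) < 2 - 2 * s \<and>
    (\<forall>u\<in>solutions p M. Lp_bound q D (\<lambda>x. \<bar>u x\<bar>))"
proof -
  define d where "d = real CARD('n)"
  have d: "2 \<le> d" using n by (simp add: d_def)
  obtain q0 where q0: "2 \<le> q0" "p \<le> q0" "d * (1 / 2 - 1 / q0) < 1" "d * ((p - 1) / q0) < 2"
    using subcritical_exponent[of d p] d p sub by (auto simp: d_def)
  define \<tau> where "\<tau> = 1 / q0"
  \<comment> \<open>The target: a reciprocal exponent below \<kappa> satisfies both strict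
    inequalities of the conclusion.\<close>
  define \<kappa> where "\<kappa> = min (2 / (d * p)) ((2 - 2 * s) / d)"
  \<comment> \<open>Half of \<kappa>, so that the last value, at most \<eta>, is below the target;
    and half of the room left by subcriticality at the starting exponent.\<close>
  define \<eta> where "\<eta> = min (\<kappa> / 2) ((2 / d - (p - 1) * \<tau>) / 2)"
  have \<tau>: "0 < \<tau>" using q0 by (simp add: \<tau>_def)
  have \<kappa>: "0 < \<kappa>" using d p s by (simp add: \<kappa>_def)
  have "d * ((p - 1) * \<tau>) < 2" using q0(4) by (simp add: \<tau>_def)
  then have "(p - 1) * \<tau> < 2 / d" using d by (simp add: field_simps)
  then have \<eta>: "0 < \<eta>" "\<eta> < \<kappa>" "(p - 1) * \<tau> + \<eta> < 2 / d"
    using \<kappa> by (auto simp: \<eta>_def min_def field_simps)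
  have \<kappa>2: "d * \<eta> < 2 - 2 * s"
  proof -
    have "\<eta> < (2 - 2 * s) / d" using \<eta>(2) by (simp add: \<kappa>_def)
    then show ?thesis using d by (simp add: field_simps)
  qed
  have iter: "0 < \<tau> - real j * \<eta> \<Longrightarrow> \<exists>D\<ge>0. \<forall>u\<in>solutions p M. Lp_bound (1 / (\<tau> - real j * \<eta>)) D (\<lambda>x. \<bar>u x\<bar>)" for j
  proof (induction j)
    case 0
    then show ?case using sobolev_bound[OF q0(1) q0(3)[unfolded d_def]] by (simp add: \<tau>_def)
  next
    case (Suc j)
    define t where "t = \<tau> - real j * \<eta>"
    have t: "0 < t - \<eta>" "\<tau> - real (Suc j) * \<eta> = t - \<eta>" "t \<le> \<tau>" using Suc.prems \<eta>(1) by (auto simp: t_def algebra_simps)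
    then have t0: "0 < t" using \<eta>(1) by simp
    from Suc.IH t0 obtain D where D: "0 \<le> D" "\<And>u. u \<in> solutions p M \<Longrightarrow> Lp_bound (1 / t) D (\<lambda>x. \<bar>u x\<bar>)"
      unfolding t_def by blast
    have "\<exists>D'\<ge>0. \<forall>u\<in>solutions p M. Lp_bound (1 / t) D (\<lambda>x. \<bar>u x\<bar>) \<longrightarrow> Lp_bound (1 / (t - \<eta>)) D' (\<lambda>x. \<bar>u x\<bar>)"
    proof (rule bootstrap_step[OF p _ _ D(1)])
      have "q0 \<le> 1 / t" using t(3) t0 q0 by (simp add: \<tau>_def field_simps)
      then show "p \<le> 1 / t" using q0 by simp
      show "1 / t \<le> 1 / (t - \<eta>)" using t \<eta>(1) by (intro divide_left_mono) auto
      \<comment> \<open>The reciprocal exponent only decreases, so the starting value is the worst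
        case.\<close>
      have "(p - 1) * t \<le> (p - 1) * \<tau>" using t p by (intro mult_left_mono) auto
      then have "p * t - (t - \<eta>) < 2 / d" using \<eta>(3) by (simp add: algebra_simps)
      then have "d * (p * t - (t - \<eta>)) < d * (2 / d)" using d by (intro mult_strict_left_mono) auto
      then show "real CARD('n) * (p / (1 / t) - 1 / (1 / (t - \<eta>))) < 2"
        using d by (simp add: d_def)
      show "real CARD('n) * (1 / (1 / t) - 1 / (1 / (t - \<eta>))) < 2 - 2 * s"
        using \<kappa>2 by (simp add: d_def)
    qed
    with D(2) show ?case unfolding t(2) by blast
  qed
  \<comment> \<open>The largest number of steps that keeps the reciprocal exponent positive; the
    ceiling minus 1 also covers an integral quotient.\<close>
  define j where "j = nat (\<lceil>\<tau> / \<eta>\<rceil> - 1)"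
  have "1 \<le> \<lceil>\<tau> / \<eta>\<rceil>" using \<tau> \<eta>(1) by (simp add: one_le_ceiling)
  then have "real j = real_of_int \<lceil>\<tau> / \<eta>\<rceil> - 1" by (simp add: j_def)
  then have "real j < \<tau> / \<eta>" "\<tau> / \<eta> \<le> real j + 1" by linarith+
  then have j: "0 < \<tau> - real j * \<eta>" "\<tau> - real j * \<eta> \<le> \<eta>" using \<eta>(1) by (auto simp: field_simps)
  define t where "t = \<tau> - real j * \<eta>"
  have t: "0 < t" "t < \<kappa>" "t \<le> \<tau>" using j \<eta> by (auto simp: t_def)
  obtain D where D: "0 \<le> D" "\<And>u. u \<in> solutions p M \<Longrightarrow> Lp_bound (1 / t) D (\<lambda>x. \<bar>u x\<bar>)"
    using iter[OF j(1)] unfolding t_def by blast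
  have "q0 \<le> 1 / t" using t q0 by (simp add: \<tau>_def field_simps)
  moreover have "d * (p / (1 / t)) < 2" "d * (1 / (1 / t)) < 2 - 2 * s"
    using t(2) d p by (auto simp: \<kappa>_def field_simps)
  ultimately show ?thesis using q0(2) D by (intro exI[of _ "1 / t"] exI[of _ D]) (auto simp: d_def)
qed

text \<open>Formally a last step with infinite target exponent: the growth 2^(k n p / q) of the
  averages of \<bar>u\<bar>^p is beaten by 2^(-2 k), and the growth 2^(k n / q) of those of
  \<bar>u\<bar> by 2^(-(2 - 2 s) k). The smaller surplus becomes \<epsilon>.\<close>

lemma conv_decay:
  assumes p: "1 < p" "p \<le> q" and N: "0 \<le> N"
    and q: "real CARD('n) * (p / q) < 2" "real CARD('n) * (1 / q) < 2 - 2 * s"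
  shows "\<exists>C \<epsilon>. 0 \<le> C \<and> 0 < \<epsilon> \<and> (\<forall>u\<in>solutions p M. Lp_bound q N (\<lambda>x. \<bar>u x\<bar>) \<longrightarrow> moll.decay C \<epsilon> u)"
proof -
  define d where "d = real CARD('n)"
  define C1 where "C1 = (A powr (q / p - 1) * (B * N)) powr (1 / (q / p))"
  define C2 where "C2 = (A powr (q - 1) * (B * N)) powr (1 / q)"
  define \<epsilon> where "\<epsilon> = min (2 - d * (p / q)) (2 - 2 * s - d * (1 / q))"
  have e: "0 < \<epsilon>" using q by (simp add: \<epsilon>_def d_def)
  define C where "C = C1 + C2"
  have C: "0 \<le> C1" "0 \<le> C2" "0 \<le> C" by (simp_all add: C1_def C2_def C_def)
  have qp: "1 \<le> q / p" "1 \<le> q" using p by auto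
  have "moll.decay C \<epsilon> u" if "u \<in> solutions p M" and b: "Lp_bound q N (\<lambda>x. \<bar>u x\<bar>)" for u
  proof -
    from that(1) obtain g where sol: "borel_solution s p M u g" by (auto simp: solutions_def)
    note b' = Lp_bound_powr[OF p(1) b]
    have c1: "env.conv k (\<lambda>y. \<bar>u y\<bar> powr p) x \<le> C1 * 2 powr (real k * d * (p / q))" for k x
      using env.conv_sup[OF qp(1) N b', of k x] by (simp add: C1_def d_def)
    have c2: "env.conv k (\<lambda>y. \<bar>u y\<bar>) x \<le> C2 * 2 powr (real k * d * (1 / q))" for k x
      using env.conv_sup[OF qp(2) N b, of k x] by (simp add: C2_def d_def)
    have 0: "\<bar>moll.conv 0 u x\<bar> \<le> C" for x using conv_zero[OF sol, of x] c2[of 0 x] C by (simp add: C_def)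
    have 1: "\<bar>moll.conv (Suc k) u x - moll.conv k u x\<bar> \<le> C * 2 powr (- \<epsilon> * real k)" for k x
    proof -
      have "2 powr (- 2 * real k) * env.conv k (\<lambda>y. \<bar>u y\<bar> powr p) x \<le> 2 powr (- 2 * real k) * (C1 * 2 powr (real k * d * (p / q)))"
        by (intro mult_left_mono c1) simp
      also have "\<dots> = C1 * 2 powr (- (2 - d * (p / q)) * real k)"
        by (simp add: powr_add[symmetric] algebra_simps)
      also have "\<dots> \<le> C1 * 2 powr (- \<epsilon> * real k)"
        using C by (intro mult_left_mono powr_mono mult_right_mono) (auto simp: \<epsilon>_def)
      finally have 1: "2 powr (- 2 * real k) * env.conv k (\<lambda>y. \<bar>u y\<bar> powr p) x \<le> C1 * 2 powr (- \<epsilon> * real k)" .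
      have "2 powr (- (2 - 2 * s) * real k) * env.conv k (\<lambda>y. \<bar>u y\<bar>) x \<le> 2 powr (- (2 - 2 * s) * real k) * (C2 * 2 powr (real k * d * (1 / q)))"
        by (intro mult_left_mono c2) simp
      also have "\<dots> = C2 * 2 powr (- (2 - 2 * s - d * (1 / q)) * real k)"
        by (simp add: powr_add[symmetric] algebra_simps)
      also have "\<dots> \<le> C2 * 2 powr (- \<epsilon> * real k)"
        using C by (intro mult_left_mono powr_mono mult_right_mono) (auto simp: \<epsilon>_def)
      finally have 2: "2 powr (- (2 - 2 * s) * real k) * env.conv k (\<lambda>y. \<bar>u y\<bar>) x \<le> C2 * 2 powr (- \<epsilon> * real k)" .
      show ?thesis
        using conv_diff_equation[OF sol qp(1) N b', of k x] 1 2 by (simp add: C_def distrib_right)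
    qed
    show ?thesis
      unfolding moll.decay_def by (intro conjI allI u_measurable[OF sol] u_AE_subseq[OF sol] 0 1)
  qed
  with C e show ?thesis by blast
qed

end

section \<open>Hoelder continuity\<close>

definition holder_version :: "real \<Rightarrow> real \<Rightarrow> ('a::euclidean_space \<Rightarrow> real) \<Rightarrow> bool" where
  "holder_version \<mu> K u \<longleftrightarrow> (\<exists>w. (AE x in lborel. u x = w x) \<and> (\<forall>x. \<bar>w x\<bar> \<le> K) \<and>
     (\<forall>x y. \<bar>w x - w y\<bar> \<le> K * norm (x - y) powr \<mu>))"

context mollifier
begin

text \<open>The difference is at most \<open>L * norm (a - b)\<close> and vanishes off two balls of
  radius \<bar>R\<bar>.\<close>

lemma shift_L1:
  assumes L: "0 \<le> L" "\<And>x y. \<bar>\<rho> x - \<rho> y\<bar> \<le> L * norm (x - y)"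
  shows "(LBINT z. \<bar>\<rho> (z - a) - \<rho> (z - b)\<bar>) \<le> 2 * L * measure lborel (cball (0::'a) \<bar>R\<bar>) * norm (a - b)"
proof -
  let ?I = "indicator (cball 0 \<bar>R\<bar>) :: 'a \<Rightarrow> real"
  have i: "integrable lborel ?I" by (rule integrable_indicator_cball)
  have [measurable]: "?I \<in> borel_measurable borel" using i by auto
  have ii: "integrable lborel (\<lambda>z. ?I (z - c))" for c by (rule integrable_lborel_minus[OF i])
  have "(LBINT z. \<bar>\<rho> (z - a) - \<rho> (z - b)\<bar>) \<le> (LBINT z. L * norm (a - b) * (?I (z - a) + ?I (z - b)))"
  proof (rule integral_mono)
    show "integrable lborel (\<lambda>z. \<bar>\<rho> (z - a) - \<rho> (z - b)\<bar>)"
      using integrable_lborel_minus[OF moll_integrable] by simp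
    show "integrable lborel (\<lambda>z. L * norm (a - b) * (?I (z - a) + ?I (z - b)))" using ii by simp
    fix z
    show "\<bar>\<rho> (z - a) - \<rho> (z - b)\<bar> \<le> L * norm (a - b) * (?I (z - a) + ?I (z - b))"
    proof (cases "norm (z - a) \<le> \<bar>R\<bar> \<or> norm (z - b) \<le> \<bar>R\<bar>")
      case True
      have "\<bar>\<rho> (z - a) - \<rho> (z - b)\<bar> \<le> L * norm (a - b) * 1"
        using L(2)[of "z - a" "z - b"] by (simp add: norm_minus_commute)
      also have "\<dots> \<le> L * norm (a - b) * (?I (z - a) + ?I (z - b))"
        using True L(1) by (intro mult_left_mono) (auto simp: indicator_def)
      finally show ?thesis .
    next
      case False
      then have "\<rho> (z - a) = 0" "\<rho> (z - b) = 0" by (auto intro!: moll_support)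
      then show ?thesis using L(1) by simp
    qed
  qed
  also have "\<dots> = L * norm (a - b) * ((LBINT z. ?I (z - a)) + (LBINT z. ?I (z - b)))"
    using ii by simp
  also have "\<dots> = 2 * L * measure lborel (cball (0::'a) \<bar>R\<bar>) * norm (a - b)"
    by (simp add: integral_lborel_minus)
  finally show ?thesis .
qed

text \<open>After rescaling to unit scale, a shift by \<open>x - y\<close> at level \<open>k\<close>
  is a shift by 2^k (x - y) of the fixed mollifier, and \<open>u\<close> enters through its
  essential bound alone.\<close>

lemma conv_lipschitz:
  assumes L: "0 \<le> L" "\<And>x y. \<bar>\<rho> x - \<rho> y\<bar> \<le> L * norm (x - y)"
    and u: "u \<in> borel_measurable borel" "AE x in lborel. \<bar>u x\<bar> \<le> W"
  shows "\<bar>conv k u x - conv k u y\<bar> \<le> W * (2 * L * measure lborel (cball (0::'a) \<bar>R\<bar>)) * 2 ^ k * norm (x - y)"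
proof -
  note [measurable] = u(1)
  have W: "0 \<le> W"
  proof (rule ccontr)
    assume "\<not> 0 \<le> W"
    then have "AE x in (lborel :: 'a measure). False" using u(2) by (auto elim!: eventually_mono)
    then show False by (simp add: ae_filter_eq_bot_iff flip: trivial_limit_def)
  qed
  have ik: "integrable lborel (\<lambda>z. scaled k (z - c))" for c
    by (rule integrable_lborel_minus[OF scaled_facts(3)])
  have iu: "integrable lborel (\<lambda>z. u z * scaled k (z - c))" for c
  proof (rule Bochner_Integration.integrable_bound[OF integrable_mult_right[OF ik[of c], of W]])
    show "AE z in lborel. norm (u z * scaled k (z - c)) \<le> norm (W * scaled k (z - c))"
      using u(2) by eventually_elim (auto simp: abs_mult intro!: mult_right_mono)
  qed measurable
  have "\<bar>conv k u x - conv k u y\<bar> = \<bar>LBINT z. u z * (scaled k (z - x) - scaled k (z - y))\<bar>"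
    unfolding conv_def using iu by (simp add: right_diff_distrib)
  also have "\<dots> \<le> (LBINT z. \<bar>u z * (scaled k (z - x) - scaled k (z - y))\<bar>)" by (rule integral_abs_bound)
  also have "\<dots> \<le> (LBINT z. W * \<bar>scaled k (z - x) - scaled k (z - y)\<bar>)"
  proof (rule integral_mono_AE)
    show "integrable lborel (\<lambda>z. \<bar>u z * (scaled k (z - x) - scaled k (z - y))\<bar>)"
      using iu by (simp add: right_diff_distrib)
    show "integrable lborel (\<lambda>z. W * \<bar>scaled k (z - x) - scaled k (z - y)\<bar>)" using ik by simp
    show "AE z in lborel. \<bar>u z * (scaled k (z - x) - scaled k (z - y))\<bar> \<le> W * \<bar>scaled k (z - x) - scaled k (z - y)\<bar>"
      using u(2) by eventually_elim (auto simp: abs_mult intro!: mult_right_mono)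
  qed
  also have "\<dots> = W * (LBINT z. (2 ^ k) ^ DIM('a) * \<bar>\<rho> (2 ^ k *\<^sub>R z - 2 ^ k *\<^sub>R x) - \<rho> (2 ^ k *\<^sub>R z - 2 ^ k *\<^sub>R y)\<bar>)"
    unfolding scaled_def by (simp add: scaleR_diff_right abs_mult flip: right_diff_distrib)
  also have "(LBINT z. (2 ^ k) ^ DIM('a) * \<bar>\<rho> (2 ^ k *\<^sub>R z - 2 ^ k *\<^sub>R x) - \<rho> (2 ^ k *\<^sub>R z - 2 ^ k *\<^sub>R y)\<bar>)
     = (LBINT z. \<bar>\<rho> (z - 2 ^ k *\<^sub>R x) - \<rho> (z - 2 ^ k *\<^sub>R y)\<bar>)"
    by (rule integral_lborel_scale) auto
  also have "W * \<dots> \<le> W * (2 * L * measure lborel (cball (0::'a) \<bar>R\<bar>) * norm (2 ^ k *\<^sub>R x - 2 ^ k *\<^sub>R y))"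
    by (intro mult_left_mono shift_L1 L W)
  also have "norm (2 ^ k *\<^sub>R x - 2 ^ k *\<^sub>R y) = 2 ^ k * norm (x - y)" by (simp flip: scaleR_diff_right)
  finally show ?thesis by (simp add: mult_ac)
qed

text \<open>At distance h < 1 the Lipschitz bound at level \<open>k\<close> costs 2^k h and the two
  tails cost 2^(-\<epsilon> k). Taking 2^k of order h^(-1 / (1 + \<epsilon>)) balances them, and
  both become h^(\<epsilon> / (1 + \<epsilon>)).\<close>

lemma holder_of_decay:
  assumes L: "0 \<le> L" "\<And>x y. \<bar>\<rho> x - \<rho> y\<bar> \<le> L * norm (x - y)" and C: "0 \<le> C" and \<epsilon>: "0 < \<epsilon>"
  shows "\<exists>K\<ge>0. \<forall>u. decay C \<epsilon> u \<longrightarrow> holder_version (\<epsilon> / (1 + \<epsilon>)) K u"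
proof -
  define r where "r = 2 powr (- \<epsilon>)"
  have r: "0 < r" "r < 1" using \<epsilon> powr_less_mono[of "-\<epsilon>" 0 2] by (auto simp: r_def)
  have rk: "r ^ k = 2 powr (- \<epsilon> * real k)" for k
    by (simp add: r_def powr_realpow[symmetric] powr_powr)
  \<comment> \<open>The sum of the geometric series that bounds all increments.\<close>
  define T where "T = C / (1 - r)"
  have T: "0 \<le> T" "C = T * (1 - r)" using r C by (auto simp: T_def)
  define W where "W = C + T"
  define J where "J = 2 * L * measure lborel (cball (0::'a) \<bar>R\<bar>)"
  define \<mu> where "\<mu> = \<epsilon> / (1 + \<epsilon>)"
  have J: "0 \<le> J" and W: "0 \<le> W" using L T C by (simp_all add: J_def W_def)
  \<comment> \<open>The summands serve distances at least 1, the Lipschitz part, and the two tails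
    at smaller distances.\<close>
  define K where "K = 2 * W + W * J + 2 * T * 2 powr \<epsilon>"
  have K: "0 \<le> K" using W J T by (simp add: K_def)
  show ?thesis
  proof (intro exI[of _ K] conjI K allI impI)
    fix u assume "decay C \<epsilon> u"
    then have u: "u \<in> borel_measurable borel"
      and ae: "AE x in lborel. \<exists>r. strict_mono r \<and> (\<lambda>k. conv (r k) u x) \<longlonglongrightarrow> u x"
      and U0: "\<forall>x. \<bar>conv 0 u x\<bar> \<le> C"
      and d: "\<forall>k x. \<bar>conv (Suc k) u x - conv k u x\<bar> \<le> C * 2 powr (- \<epsilon> * real k)"
      by (simp_all add: decay_def)
    \<comment> \<open>The subtracted \<open>r ^ m\<close> makes the induction close.\<close>
    have tele: "\<bar>conv m u x - conv k u x\<bar> \<le> T * (r ^ k - r ^ m)" if "k \<le> m" for k m x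
      using that
    proof (induction m rule: dec_induct)
      case (step m)
      have "\<bar>conv (Suc m) u x - conv m u x\<bar> \<le> T * (1 - r) * r ^ m" using d rk T(2) by metis
      with step show ?case by (simp add: algebra_simps)
    qed simp
    have tele': "\<bar>conv m u x - conv k u x\<bar> \<le> T * r ^ k" if "k \<le> m" for k m x
      using tele[OF that, of x] mult_left_mono[of "r ^ k - r ^ m" "r ^ k" T] T r by simp
    have "Cauchy (\<lambda>k. conv k u x)" for x
    proof (rule metric_CauchyI)
      fix e :: real assume e: "0 < e"
      have "(\<lambda>k. T * r ^ k) \<longlonglongrightarrow> T * 0" using r by (intro tendsto_mult_left LIMSEQ_power_zero) auto
      then have "\<forall>\<^sub>F k in sequentially. T * r ^ k < e / 2" by (rule order_tendstoD) (use e in simp)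
      then obtain k where k: "T * r ^ k < e / 2" by (auto simp: eventually_sequentially)
      have "dist (conv m u x) (conv m' u x) < e" if "k \<le> m" "k \<le> m'" for m m'
        using tele'[OF that(1), of x] tele'[OF that(2), of x] k by (simp add: dist_real_def)
      then show "\<exists>M. \<forall>m\<ge>M. \<forall>n\<ge>M. dist (conv m u x) (conv n u x) < e" by blast
    qed
    then have lim: "(\<lambda>k. conv k u x) \<longlonglongrightarrow> lim (\<lambda>k. conv k u x)" for x
      using Cauchy_convergent convergent_LIMSEQ_iff by blast
    define w where "w x = lim (\<lambda>k. conv k u x)" for x
    have wk: "\<bar>w x - conv k u x\<bar> \<le> T * r ^ k" for k x
    proof (rule LIMSEQ_le_const2)
      show "(\<lambda>m. \<bar>conv m u x - conv k u x\<bar>) \<longlonglongrightarrow> \<bar>w x - conv k u x\<bar>"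
        unfolding w_def by (intro tendsto_intros lim)
      show "\<exists>N. \<forall>m\<ge>N. \<bar>conv m u x - conv k u x\<bar> \<le> T * r ^ k" using tele' by blast
    qed
    have wW: "\<bar>w x\<bar> \<le> W" for x using wk[of x 0] U0[rule_format, of x] by (simp add: W_def)
    have uw: "AE x in lborel. u x = w x"
      using ae
    proof eventually_elim
      case (elim x)
      then obtain q where q: "strict_mono q" "(\<lambda>k. conv (q k) u x) \<longlonglongrightarrow> u x" by blast
      have "(\<lambda>k. conv (q k) u x) \<longlonglongrightarrow> w x"
        using LIMSEQ_subseq_LIMSEQ[OF lim q(1)] by (simp add: w_def o_def)
      then show ?case using q(2) LIMSEQ_unique by blast
    qed
    \<comment> \<open>Boundedness of \<open>u\<close> is obtained here from its limit function, as
      the Lipschitz bound presupposes it.\<close>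
    then have uW: "AE x in lborel. \<bar>u x\<bar> \<le> W" by eventually_elim (simp add: wW)
    have lip: "\<bar>conv k u x - conv k u y\<bar> \<le> W * J * 2 ^ k * norm (x - y)" for k x y
      using conv_lipschitz[OF L u uW] by (simp add: J_def)
    have "\<bar>w x - w y\<bar> \<le> K * norm (x - y) powr \<mu>" for x y
    proof -
      define h where "h = norm (x - y)"
      have \<mu>: "0 < \<mu>" using \<epsilon> by (simp add: \<mu>_def)
      consider "h = 0" | "1 \<le> h" | "0 < h" "h < 1" by (fastforce simp: h_def)
      then show ?thesis
      proof cases
        case 1 then show ?thesis by (simp add: h_def)
      next
        case 2
        have "\<bar>w x - w y\<bar> \<le> (2 * W) * 1" using wW[of x] wW[of y] by simp
        also have "\<dots> \<le> K * h powr \<mu>"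
          using 2 \<mu> W J T by (intro mult_mono ge_one_powr_ge_zero) (auto simp: K_def)
        finally show ?thesis by (simp add: h_def)
      next
        case 3
        define q where "q = h powr (- (1 / (1 + \<epsilon>)))"
        have "1 \<le> q" using 3 \<epsilon> powr_mono2'[of "- (1 / (1 + \<epsilon>))" h 1] by (simp add: q_def)
        then obtain k :: nat where k: "2 ^ k \<le> q" "q < 2 ^ Suc k" using ex_dyadic by blast
        have e1: "q * h = h powr \<mu>"
        proof -
          have "q * h powr 1 = h powr (- (1 / (1 + \<epsilon>)) + 1)" unfolding q_def by (rule powr_add[symmetric])
          also have "- (1 / (1 + \<epsilon>)) + 1 = \<mu>" using \<epsilon> by (simp add: \<mu>_def field_simps)
          finally show ?thesis using 3 by simp
        qed
        have e2: "r ^ k \<le> 2 powr \<epsilon> * h powr \<mu>"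
        proof -
          have "r ^ k = (2 ^ k) powr (- \<epsilon>)" unfolding rk by (simp add: powr_realpow[symmetric] powr_powr mult.commute)
          \<comment> \<open>The level is determined only up to a factor 2, since
            \<open>2 ^ k\<close> exceeds \<open>q / 2\<close>; this costs the factor
            \<open>2 powr \<epsilon>\<close> in \<open>K\<close>.\<close>
          also have "\<dots> \<le> (q / 2) powr (- \<epsilon>)" using k(2) \<open>1 \<le> q\<close> \<epsilon> by (intro powr_mono2') auto
          also have "\<dots> = 2 powr \<epsilon> * q powr (- \<epsilon>)" using \<open>1 \<le> q\<close> by (simp add: powr_divide powr_minus) (simp only: divide_inverse)
          also have "q powr (- \<epsilon>) = h powr \<mu>" unfolding q_def \<mu>_def powr_powr by simp
          finally show ?thesis .
        qed
        have "\<bar>w x - w y\<bar> \<le> \<bar>conv k u x - conv k u y\<bar> + 2 * (T * r ^ k)"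
          using wk[of x k] wk[of y k] by linarith
        also have "\<dots> \<le> W * J * (2 ^ k * h) + 2 * (T * r ^ k)"
          using lip[of k x y] by (simp add: h_def mult.assoc)
        also have "\<dots> \<le> W * J * (q * h) + 2 * (T * (2 powr \<epsilon> * h powr \<mu>))"
          using k(1) 3 W J T e2 by (intro add_mono mult_left_mono mult_right_mono) auto
        also have "\<dots> \<le> K * h powr \<mu>" unfolding e1 K_def using W by (simp add: algebra_simps)
        finally show ?thesis by (simp add: h_def)
      qed
    qed
    moreover have "\<bar>w x\<bar> \<le> K" for x
    proof -
      have "W \<le> K" using W J T by (simp add: K_def)
      then show ?thesis using wW[of x] by linarith
    qed
    ultimately show "holder_version (\<epsilon> / (1 + \<epsilon>)) K u"
      using uw unfolding \<mu>_def holder_version_def by blast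
  qed
qed

end

section \<open>Uniform Hoelder bounds and choice of the kernels\<close>

context dyadic
begin

lemma borel_solution_holder:
  assumes n: "2 \<le> CARD('n)" and p: "1 < p"
    and sub: "2 < CARD('n) \<Longrightarrow> p < (real CARD('n) + 2) / (real CARD('n) - 2)"
  shows "\<exists>\<mu> K. 0 < \<mu> \<and> \<mu> < 1 \<and> 0 \<le> K \<and> (\<forall>u\<in>solutions p M. holder_version \<mu> K u)"
proof -
  obtain q D where q: "p \<le> q" "0 \<le> D" "real CARD('n) * (p / q) < 2" "real CARD('n) * (1 / q) < 2 - 2 * s"
    and D: "\<forall>u\<in>solutions p M. Lp_bound q D (\<lambda>x. \<bar>u x\<bar>)"
    using bootstrap[OF n p sub] by blast
  obtain C \<epsilon> where C: "0 \<le> C" "0 < \<epsilon>"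
    and dec: "\<forall>u\<in>solutions p M. Lp_bound q D (\<lambda>x. \<bar>u x\<bar>) \<longrightarrow> moll.decay C \<epsilon> u"
    using conv_decay[OF p q(1,2,3,4)] by blast
  obtain L where L: "0 < L" "\<And>x y. \<bar>\<rho> x - \<rho> y\<bar> \<le> L * norm (x - y)" using test_function_lipschitz[OF \<rho>_test] by blast
  obtain K where K: "0 \<le> K" "\<forall>u. moll.decay C \<epsilon> u \<longrightarrow> holder_version (\<epsilon> / (1 + \<epsilon>)) K u"
    using moll.holder_of_decay[OF less_imp_le[OF L(1)] L(2) C] by blast
  have "0 < \<epsilon> / (1 + \<epsilon>)" "\<epsilon> / (1 + \<epsilon>) < 1" using C by auto
  with K D dec show ?thesis by blast
qed

end

text \<open>The envelope is the sum of the four functions it has to dominate. Three are compactly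
  supported; the fourth, \<open>frac_env\<close>, is bounded and integrable although it may have
  tails.\<close>

lemma ex_dyadic_locale:
  assumes s: "0 < s" "s < 1"
  shows "\<exists>\<Lambda> \<rho> A B R Bm (\<gamma> :: real ^ 'n::finite \<Rightarrow> real). dyadic \<Lambda> \<rho> A B R Bm \<gamma> s"
proof -
  obtain \<rho> \<gamma> :: "real^'n \<Rightarrow> real" where \<rho>: "test_function \<rho>" "\<And>x. 0 \<le> \<rho> x" "(LBINT x. \<rho> x) = 1"
    and \<gamma>: "test_function \<gamma>" "\<And>x. lap \<gamma> x = \<rho> x - 2 ^ CARD('n) * \<rho> (2 *\<^sub>R x)"
    using ex_mollifier_pair by metis
  note [measurable] = test_function_measurable[OF \<rho>(1)] test_function_measurable[OF \<gamma>(1)] grad_measurable[OF \<gamma>(1)]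
  obtain R where R: "\<And>x. R < norm x \<Longrightarrow> \<rho> x = 0" using test_function_support[OF \<rho>(1)] by metis
  obtain B1 where B1: "B1 > 0" "\<And>x. \<bar>\<rho> x\<bar> \<le> B1" using test_function_bounded[OF \<rho>(1)] by blast
  obtain B2 where B2: "B2 > 0" "\<And>x. \<bar>\<gamma> x\<bar> \<le> B2" using test_function_bounded[OF \<gamma>(1)] by blast
  obtain B3 where B3: "B3 > 0" "\<And>x. norm (grad \<gamma> x) \<le> B3" using grad_bounded[OF \<gamma>(1)] by blast
  obtain C where C: "0 \<le> C" "\<And>z. frac_env s \<gamma> z \<le> ennreal C" "(\<integral>\<^sup>+z. frac_env s \<gamma> z \<partial>lborel) \<le> ennreal C"
    using frac_env_finite[OF \<gamma>(1) s] by metis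
  define f where "f z = enn2real (frac_env s \<gamma> z)" for z
  have fe: "frac_env s \<gamma> z = ennreal (f z)" for z
    using C(2)[of z] le_less_trans[OF _ ennreal_less_top] by (auto simp: f_def)
  have f0: "0 \<le> f z" for z by (simp add: f_def)
  have fC: "f z \<le> C" for z using C(1,2) by (simp add: fe ennreal_le_iff)
  have [measurable]: "f \<in> borel_measurable borel" unfolding f_def[abs_def] by measurable
  have fi: "integrable lborel f"
    by (rule integrableI_nonneg) (use f0 C(3) le_less_trans[OF C(3) ennreal_less_top] in \<open>auto simp: fe[symmetric]\<close>)
  define \<Lambda> where "\<Lambda> z = \<rho> z + norm (grad \<gamma> z) + \<bar>\<gamma> z\<bar> + f z" for z
  have \<Lambda>i: "integrable lborel \<Lambda>"
    unfolding \<Lambda>_def[abs_def]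
    using test_function_integrable[OF \<rho>(1)] test_function_integrable[OF \<gamma>(1)] grad_integrable[OF \<gamma>(1)] fi by simp
  have "dyadic \<Lambda> \<rho> (1 + \<bar>LBINT z. \<Lambda> z\<bar>) (B1 + B3 + B2 + C) R B1 \<gamma> s"
  proof unfold_locales
    show "\<Lambda> \<in> borel_measurable borel" using \<Lambda>i by auto
    show "\<Lambda> x \<le> B1 + B3 + B2 + C" for x
      using B1(2)[of x] B2(2)[of x] B3(2)[of x] fC[of x] by (simp add: \<Lambda>_def)
    show "\<rho> x \<le> B1" for x using B1(2)[of x] by simp
    show "ennreal \<bar>\<gamma> z\<bar> + frac_env s \<gamma> z \<le> ennreal (\<Lambda> z)" for z
      unfolding fe using f0 \<rho>(2) by (simp add: \<Lambda>_def ennreal_leI flip: ennreal_plus)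
  qed (use \<rho> \<gamma> s R B1 B2 B3 C(1) f0 \<Lambda>i test_function_integrable in \<open>auto simp: \<Lambda>_def add_pos_nonneg add_nonneg_nonneg\<close>)
  then show ?thesis by blast
qed

theorem theorem1p2:
  fixes s p M :: real
  assumes "CARD('n::finite) \<ge> 2"
    and "0 < s" and "s < 1"
    and "1 < p"
    and "CARD('n) > 2 \<Longrightarrow> p < (real CARD('n) + 2) / (real CARD('n) - 2)"
  shows "\<exists>\<mu> C. 0 < \<mu> \<and> \<mu> < 1 \<and> 0 < C \<and>
    (\<forall>u :: real ^ 'n \<Rightarrow> real. weak_solution s p u \<and> H1_norm u = M \<longrightarrow>
      (\<exists>w. (AE x in lebesgue. u x = w x) \<and> w \<in> holder_space \<mu> \<and> holder_norm \<mu> w \<le> C))"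
proof -
  obtain \<Lambda> \<rho> A B R Bm and \<gamma> :: "real ^ 'n \<Rightarrow> real" where "dyadic \<Lambda> \<rho> A B R Bm \<gamma> s"
    using ex_dyadic_locale[OF assms(2,3)] by blast
  then interpret dyadic \<Lambda> \<rho> A B R Bm \<gamma> s .
  obtain \<mu> K where \<mu>: "0 < \<mu>" "\<mu> < 1" "0 \<le> K"
    and hol: "\<forall>u\<in>solutions p M. holder_version \<mu> K u"
    using borel_solution_holder[OF assms(1,4,5), of M] by blast
  show ?thesis
  \<comment> \<open>One \<open>K\<close> bounds the supremum, the other the seminorm; the 1 makes
    the constant positive even for \<open>K = 0\<close>.\<close>
  proof (rule exI[of _ \<mu>], rule exI[of _ "2 * K + 1"], intro conjI \<mu>(1,2) allI impI)
    show "0 < 2 * K + 1" using \<mu>(3) by simp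
    fix u :: "real ^ 'n \<Rightarrow> real" assume "weak_solution s p u \<and> H1_norm u = M"
    then have ws: "weak_solution s p u" "H1_norm u = M" by auto
    obtain u' g' where "borel_solution s p M u' g'" and ae: "AE x in lborel. u x = u' x"
      by (rule weak_solution_borel_version[OF ws])
    then have "holder_version \<mu> K u'" using hol by (auto simp: solutions_def)
    then obtain w where w: "AE x in lborel. u' x = w x" "\<And>x. \<bar>w x\<bar> \<le> K"
      "\<And>x y. \<bar>w x - w y\<bar> \<le> K * norm (x - y) powr \<mu>"
      unfolding holder_version_def by blast
    have "AE x in lborel. u x = w x" using ae w(1) by eventually_elim simp
    then have 1: "AE x in lebesgue. u x = w x" by (rule AE_completion)
    have hq: "t \<le> K" if "t \<in> holder_quotients \<mu> w" for t
      using that w(3) by (auto simp: holder_quotients_def divide_le_eq)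
    obtain i :: 'n where True by simp
    \<comment> \<open>A nonzero vector yields two distinct points, so the supremum of the quotients
      is over a nonempty set.\<close>
    have "axis i (1::real) \<noteq> 0" by (simp add: axis_eq_0_iff)
    then have ne: "holder_quotients \<mu> w \<noteq> {}" unfolding holder_quotients_def by blast
    have 2: "w \<in> holder_space \<mu>"
      unfolding holder_space_def using w(2) hq by (auto intro!: bdd_aboveI2 bdd_aboveI)
    have "(SUP x. \<bar>w x\<bar>) \<le> K" by (rule cSUP_least) (use w(2) in auto)
    moreover have "Sup (holder_quotients \<mu> w) \<le> K" by (rule cSup_least) (use ne hq in auto)
    ultimately have "holder_norm \<mu> w \<le> 2 * K + 1" by (simp add: holder_norm_def)
    with 1 2 show "\<exists>w. (AE x in lebesgue. u x = w x) \<and> w \<in> holder_space \<mu> \<and> holder_norm \<mu> w \<le> 2 * K + 1" by blast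
  qed
qed

end
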